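(* Let $(X,Y)\sim p(x,y)$ on finite alphabets $\mathcal X\times\mathcal Y$ and let $f:\mathcal X\times\mathcal Y\to\mathcal F$. A rate triple $(R_0,R_X,R_Y)$ is achievable for the function computation problem whenever \begin{align*} R_0 &> I(X;U|Y),\\ R_X &> I(V;X|T,W),\\ R_Y &> I(U,Y;W|V,T),\\ R_X+R_Y &> I(X,Y;V,T,W)+I(U;W|V,X,T,Y), \end{align*} for some random variables $T,U,V,W$ with finite alphabets $\mathcal T,\mathcal U,\mathcal V,\mathcal W$, jointly distributed with $(X,Y)$, such that the Markov chains $T-U-X-Y$ and $V-(X,T)-(U,Y)-W$ hold, and such that $(T,X)\in V\in \mathrm M(\Gamma(G_{T,X|T,U,Y}))$ and $(T,U,Y)\in W\in \mathrm M(\Gamma(G_{T,U,Y|T,V}))$. Moreover, the union of these achievable regions over all such $(T,U,V,W)$ is unchanged if one restricts to $|\mathcal T|\le|\mathcal X|+4$, $|\mathcal V|\le(|\mathcal X|+4)|\mathcal X|+1$, $|\mathcal W|\le|\mathcal U|\cdot|\mathcal Y|+1$.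
   Context: Setup: $\mathcal X,\mathcal Y,\mathcal F$ are finite sets, $(X_i,Y_i)_{i\ge1}$ are i.i.d. copies of $(X,Y)\sim p(x,y)$, $\mathbf X=(X_1,\dots,X_n)$, $\mathbf Y=(Y_1,\dots,Y_n)$, and $f(\mathbf X,\mathbf Y)=(f(X_1,Y_1),\dots,f(X_n,Y_n))$. An $(n,R_0,R_X,R_Y)$ code consists of encoders $\varphi_0:\mathcal X^n\to\{1,\dots,2^{nR_0}\}$ (transmitter-$X$ to transmitter-$Y$), $\varphi_X:\mathcal X^n\to\{1,\dots,2^{nR_X}\}$, $\varphi_Y:\mathcal Y^n\times\{1,\dots,2^{nR_0}\}\to\{1,\dots,2^{nR_Y}\}$ and a decoder $\psi:\{1,\dots,2^{nR_X}\}\times\{1,\dots,2^{nR_Y}\}\to\mathcal F^n$; its error probability is $P(\psi(\varphi_X(\mathbf X),\varphi_Y(\varphi_0(\mathbf X),\mathbf Y))\ne f(\mathbf X,\mathbf Y))$. A triple $(R_0,R_X,R_Y)$ is achievable if for every $\varepsilon>0$ and all $n$ large enough there is an $(n,R_0,R_X,R_Y)$ code with error probability at most $\varepsilon$; the rate region is the closure of the set of achievable triples. Generalized conditional characteristic graph: for jointly distributed discrete random variables $(L,K,S)\sim p(l,k,s)$ and a function $f$ of $S$ with $H(f(S)|L,K)=0$, $G_{L|K}$ (w.r.t. $f$) is the graph with vertex set $\mathcal L$ (support of $L$) in which $l_1,l_2$ are adjacent iff there exist $s_1,s_2$ and $k$ with $p(l_1,k,s_1)p(l_2,k,s_2)>0$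 and $f(s_1)\ne f(s_2)$. Here always $S=(X,Y)$ and the function is $f(X,Y)$; e.g. $G_{T,X|T,U,Y}$ uses $L=(T,X)$, $K=(T,U,Y)$, and $G_{T,U,Y|T,V}$ uses $L=(T,U,Y)$, $K=(T,V)$. $\Gamma(G)$ is the set of independent sets of $G$ (sets of vertices no two adjacent). $\mathrm M(\Gamma(G))$ denotes multisets of independent sets; the notation $Z\in V\in\mathrm M(\Gamma(G))$ means that $V$ is a random variable each of whose values is an independent set of $G$ (distinct values of $V$ may be the same set) and $P(Z\in V)=1$. *)

theory Defs
  imports "HOL-Probability.Probability_Mass_Function"
begin

definition ent :: "'o pmf \<Rightarrow> ('o \<Rightarrow> 'a) \<Rightarrow> real" where
  "ent P g = - (\<Sum>z\<in>set_pmf (map_pmf g P).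
                  pmf (map_pmf g P) z * log 2 (pmf (map_pmf g P) z))"

definition cmi :: "'o pmf \<Rightarrow> ('o \<Rightarrow> 'a) \<Rightarrow> ('o \<Rightarrow> 'b) \<Rightarrow> ('o \<Rightarrow> 'c) \<Rightarrow> real" where
  "cmi P A B C = ent P (\<lambda>\<omega>. (A \<omega>, C \<omega>)) + ent P (\<lambda>\<omega>. (B \<omega>, C \<omega>))
                 - ent P (\<lambda>\<omega>. (A \<omega>, B \<omega>, C \<omega>)) - ent P C"

definition markov :: "'o pmf \<Rightarrow> ('o \<Rightarrow> 'a) \<Rightarrow> ('o \<Rightarrow> 'b) \<Rightarrow> ('o \<Rightarrow> 'c) \<Rightarrow> bool" where
  "markov P A B C = (\<forall>a b c.
      measure_pmf.prob P {\<omega>. A \<omega> = a \<and> B \<omega> = b \<and> C \<omega> = c} * measure_pmf.prob P {\<omega>. B \<omega> = b}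
    = measure_pmf.prob P {\<omega>. A \<omega> = a \<and> B \<omega> = b} * measure_pmf.prob P {\<omega>. B \<omega> = b \<and> C \<omega> = c})"

definition char_adj :: "'o pmf \<Rightarrow> ('o \<Rightarrow> 'l) \<Rightarrow> ('o \<Rightarrow> 'k) \<Rightarrow> ('o \<Rightarrow> 'f) \<Rightarrow> 'l \<Rightarrow> 'l \<Rightarrow> bool" where
  "char_adj P L K F l1 l2 = (\<exists>\<omega>1\<in>set_pmf P. \<exists>\<omega>2\<in>set_pmf P.
      L \<omega>1 = l1 \<and> L \<omega>2 = l2 \<and> K \<omega>1 = K \<omega>2 \<and> F \<omega>1 \<noteq> F \<omega>2)"

definition indep_set :: "'o pmf \<Rightarrow> ('o \<Rightarrow> 'l) \<Rightarrow> ('o \<Rightarrow> 'k) \<Rightarrow> ('o \<Rightarrow> 'f) \<Rightarrow> 'l set \<Rightarrow> bool" where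
  "indep_set P L K F A = (A \<subseteq> L ` set_pmf P \<and>
      (\<forall>l1\<in>A. \<forall>l2\<in>A. l1 \<noteq> l2 \<longrightarrow> \<not> char_adj P L K F l1 l2))"

section \<open>Joint distribution of (X,Y,T,U,V,W); auxiliary alphabets are finite subsets of nat\<close>

type_synonym ('x,'y) jnt = "'x \<times> 'y \<times> nat \<times> nat \<times> nat \<times> nat"

definition rX :: "('x,'y) jnt \<Rightarrow> 'x" where "rX = (\<lambda>(x,y,t,u,v,w). x)"
definition rY :: "('x,'y) jnt \<Rightarrow> 'y" where "rY = (\<lambda>(x,y,t,u,v,w). y)"
definition rT :: "('x,'y) jnt \<Rightarrow> nat" where "rT = (\<lambda>(x,y,t,u,v,w). t)"
definition rU :: "('x,'y) jnt \<Rightarrow> nat" where "rU = (\<lambda>(x,y,t,u,v,w). u)"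
definition rV :: "('x,'y) jnt \<Rightarrow> nat" where "rV = (\<lambda>(x,y,t,u,v,w). v)"
definition rW :: "('x,'y) jnt \<Rightarrow> nat" where "rW = (\<lambda>(x,y,t,u,v,w). w)"

text \<open>Admissible auxiliaries.  The value v of V stands for the independent set sV v
  (so distinct values may label the same set: multisets of independent sets); likewise sW.\<close>
definition admissible ::
  "('x \<times> 'y) pmf \<Rightarrow> ('x \<Rightarrow> 'y \<Rightarrow> 'f) \<Rightarrow> ('x,'y) jnt pmf
    \<Rightarrow> (nat \<Rightarrow> (nat \<times> 'x) set) \<Rightarrow> (nat \<Rightarrow> (nat \<times> nat \<times> 'y) set) \<Rightarrow> bool" where
  "admissible p f Q sV sW = (
     finite (set_pmf Q) \<and>
     map_pmf (\<lambda>\<omega>. (rX \<omega>, rY \<omega>)) Q = p \<and>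
     \<comment> \<open>T - U - X - Y\<close>
     markov Q rT rU (\<lambda>\<omega>. (rX \<omega>, rY \<omega>)) \<and>
     markov Q (\<lambda>\<omega>. (rT \<omega>, rU \<omega>)) rX rY \<and>
     \<comment> \<open>V - (X,T) - (U,Y) - W\<close>
     markov Q rV (\<lambda>\<omega>. (rX \<omega>, rT \<omega>)) (\<lambda>\<omega>. (rU \<omega>, rY \<omega>, rW \<omega>)) \<and>
     markov Q (\<lambda>\<omega>. (rV \<omega>, rX \<omega>, rT \<omega>)) (\<lambda>\<omega>. (rU \<omega>, rY \<omega>)) rW \<and>
     \<comment> \<open>(T,X) in V in M(Gamma(G_{T,X|T,U,Y}))\<close>
     (\<forall>\<omega>\<in>set_pmf Q. (rT \<omega>, rX \<omega>) \<in> sV (rV \<omega>) \<and>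
        indep_set Q (\<lambda>\<omega>. (rT \<omega>, rX \<omega>)) (\<lambda>\<omega>. (rT \<omega>, rU \<omega>, rY \<omega>))
                  (\<lambda>\<omega>. f (rX \<omega>) (rY \<omega>)) (sV (rV \<omega>))) \<and>
     \<comment> \<open>(T,U,Y) in W in M(Gamma(G_{T,U,Y|T,V}))\<close>
     (\<forall>\<omega>\<in>set_pmf Q. (rT \<omega>, rU \<omega>, rY \<omega>) \<in> sW (rW \<omega>) \<and>
        indep_set Q (\<lambda>\<omega>. (rT \<omega>, rU \<omega>, rY \<omega>)) (\<lambda>\<omega>. (rT \<omega>, rV \<omega>))
                  (\<lambda>\<omega>. f (rX \<omega>) (rY \<omega>)) (sW (rW \<omega>))))"

definition aux_region :: "('x,'y) jnt pmf \<Rightarrow> (real \<times> real \<times> real) set" where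
  "aux_region Q = {(R0, RX, RY).
     R0 > cmi Q rX rU rY \<and>
     RX > cmi Q rV rX (\<lambda>\<omega>. (rT \<omega>, rW \<omega>)) \<and>
     RY > cmi Q (\<lambda>\<omega>. (rU \<omega>, rY \<omega>)) rW (\<lambda>\<omega>. (rV \<omega>, rT \<omega>)) \<and>
     RX + RY > cmi Q (\<lambda>\<omega>. (rX \<omega>, rY \<omega>)) (\<lambda>\<omega>. (rV \<omega>, rT \<omega>, rW \<omega>)) (\<lambda>_. ())
               + cmi Q rU rW (\<lambda>\<omega>. (rV \<omega>, rX \<omega>, rT \<omega>, rY \<omega>))}"

definition msgs :: "nat \<Rightarrow> real \<Rightarrow> nat set" where
  "msgs n R = {1..nat \<lfloor>2 powr (real n * R)\<rfloor>}"

definition is_code :: "nat \<Rightarrow> real \<Rightarrow> real \<Rightarrow> real \<Rightarrow>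
    ('x list \<Rightarrow> nat) \<Rightarrow> ('x list \<Rightarrow> nat) \<Rightarrow> ('y list \<Rightarrow> nat \<Rightarrow> nat) \<Rightarrow> bool" where
  "is_code n R0 RX RY phi0 phiX phiY =
     ((\<forall>xs. length xs = n \<longrightarrow> phi0 xs \<in> msgs n R0 \<and> phiX xs \<in> msgs n RX) \<and>
      (\<forall>ys m. length ys = n \<and> m \<in> msgs n R0 \<longrightarrow> phiY ys m \<in> msgs n RY))"

definition err_prob :: "('x \<times> 'y) pmf \<Rightarrow> ('x \<Rightarrow> 'y \<Rightarrow> 'f) \<Rightarrow> nat \<Rightarrow>
    ('x list \<Rightarrow> nat) \<Rightarrow> ('x list \<Rightarrow> nat) \<Rightarrow> ('y list \<Rightarrow> nat \<Rightarrow> nat) \<Rightarrow> (nat \<Rightarrow> nat \<Rightarrow> 'f list) \<Rightarrow> real" where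
  "err_prob p f n phi0 phiX phiY psi =
     (\<Sum>zs\<in>{zs. length zs = n}. prod_list (map (pmf p) zs) *
        (if psi (phiX (map fst zs)) (phiY (map snd zs) (phi0 (map fst zs)))
              \<noteq> map (\<lambda>(x, y). f x y) zs then 1 else 0))"

definition achievable :: "('x::finite \<times> 'y::finite) pmf \<Rightarrow> ('x \<Rightarrow> 'y \<Rightarrow> 'f) \<Rightarrow> real \<times> real \<times> real \<Rightarrow> bool" where
  "achievable p f R = (case R of (R0, RX, RY) \<Rightarrow>
     (\<forall>\<epsilon>>0. \<exists>N. \<forall>n\<ge>N. \<exists>phi0 phiX phiY psi.
        is_code n R0 RX RY phi0 phiX phiY \<and> err_prob p f n phi0 phiX phiY psi \<le> \<epsilon>))"

end

theory Submission
  imports Defs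
begin

text \<open>
  Achievability. Given \<open>(T,V,W)\<close> the value of the function is determined, so it suffices that the
  receiver recovers \<open>(T,V,W)\<close>. All codebooks arise by random thinning of the set of all sequences.
  Transmitter \<open>X\<close> draws \<open>T\<close>, then \<open>U\<close> and \<open>V\<close>, from the true conditional laws restricted to the
  codebooks; transmitter \<open>Y\<close> recovers \<open>(T,U)\<close> from its side information and a bin number of \<open>(T,U)\<close> and
  draws \<open>W\<close> in the same way; the receiver gets bin numbers of \<open>(T,V)\<close> and \<open>(T,W)\<close>. If each codebook
  is thinned by less than the conditional entropy of its variable given what the encoder
  knows, the law produced by the encoders is close in total variation to the target law, so no
  Markov lemma is needed, and every decoding error reduces to counting the typical
  competitors. Codebooks, bins and local randomness are then fixed by averaging.

  Cardinality. Reweighting the joint law by a function of one auxiliary variable keeps all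
  Markov chains, and the rates become affine in the weights once the relevant marginal is fixed. A
  vertex of the resulting polytope has small support. For \<open>V\<close> and \<open>W\<close> one of the two remaining
  functionals is minimised instead of preserved, which saves one atom.
\<close>

section \<open>Random hashing\<close>

text \<open>The codebooks of T, U, V, W are thinned at rates just below H(T|X), H(U|X,T), H(V|X,T),
  H(W|T,U,Y). Transmitter Y faces about 2^(n H(T,U|Y)) typical pairs (T,U), so the bins must supply
  the gap H(T,U|Y) - H(T,U|X), which the Markov chains identify as I(X;U|Y). The bounds on R_X, R_Y
  and R_X + R_Y arise likewise from competitors that differ in V only, in W only, or in T.
  Competitors with the correct T and wrong U, or with wrong V and W, cost no extra rate, as H(T|X)
  is at most H(T|Y) and at most H(T). The obstacle is that the encoders renormalise their thinned
  kernels, which couples all hash values; each normalisation is traded for a mean absolute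
  deviation, and the remaining expectations can be evaluated one hash index at a time. Reweighting
  alters entropies nonlinearly, but in a difference of two entropies that both involve the
  reweighted variable the density cancels inside the logarithm. For V, R_Y fixes one such
  difference, while R_X and the sum rate share the other, so lowering it is harmless; for W, R_X and
  R_Y exchange roles.\<close>

locale random_hash =
  fixes D :: "'d set" and K :: "'d \<Rightarrow> nat"
  assumes finite_D: "finite D" and K_pos: "\<And>d. K d > 0"
begin

definition Fns :: "('d \<Rightarrow> nat) set" where "Fns = Pi\<^sub>E D (\<lambda>d. {..<K d})"

definition Exp :: "(('d \<Rightarrow> nat) \<Rightarrow> real) \<Rightarrow> real" where
  "Exp h = (\<Sum>b\<in>Fns. h b) / real (card Fns)"

lemma finite_Fns: "finite Fns"
  unfolding Fns_def by (intro finite_PiE finite_D) auto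

lemma card_Fns_pos: "card Fns > 0"
proof -
  have "Fns \<noteq> {}" unfolding Fns_def PiE_eq_empty_iff using K_pos by (metis empty_iff lessThan_iff)
  then show ?thesis by (simp add: card_gt_0_iff finite_Fns)
qed

lemma Fns_less: "b \<in> Fns \<Longrightarrow> d \<in> D \<Longrightarrow> b d < K d"
  unfolding Fns_def by (auto dest: PiE_mem)

lemma Exp_add: "Exp (\<lambda>b. g b + h b) = Exp g + Exp h"
  by (simp add: Exp_def sum.distrib add_divide_distrib)

lemma Exp_cmult: "Exp (\<lambda>b. c * h b) = c * Exp h"
  by (simp add: Exp_def sum_distrib_left)

lemma Exp_sum: "Exp (\<lambda>b. \<Sum>i\<in>I. h i b) = (\<Sum>i\<in>I. Exp (h i))"
  unfolding Exp_def by (subst sum.swap) (simp add: sum_divide_distrib)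

lemma Exp_const: "Exp (\<lambda>b. c) = c"
  using card_Fns_pos by (simp add: Exp_def)

lemma Exp_mono: "(\<And>b. b \<in> Fns \<Longrightarrow> g b \<le> h b) \<Longrightarrow> Exp g \<le> Exp h"
  unfolding Exp_def by (intro divide_right_mono sum_mono) auto

lemma Exp_cong: "(\<And>b. b \<in> Fns \<Longrightarrow> g b = h b) \<Longrightarrow> Exp g = Exp h"
  unfolding Exp_def by (simp cong: sum.cong)

lemma exists_le_Exp: "\<exists>b\<in>Fns. h b \<le> Exp h"
proof (rule ccontr)
  assume "\<not> ?thesis"
  then have a: "\<And>b. b \<in> Fns \<Longrightarrow> Exp h < h b" by force
  have "(\<Sum>b\<in>Fns. Exp h) < (\<Sum>b\<in>Fns. h b)"
    using card_Fns_pos a finite_Fns by (intro sum_strict_mono) auto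
  then show False using card_Fns_pos by (simp add: Exp_def)
qed

text \<open>The uniform law on \<open>Fns\<close> is a product law: a function splits into its value
  at \<open>d\<close> and its restriction to the other indices. Independence enters the argument
  through this identity.\<close>

lemma Exp_resample:
  assumes "d \<in> D"
  shows "Exp h = Exp (\<lambda>b. (\<Sum>j<K d. h (b(d := j))) / real (K d))"
proof -
  let ?P = "Pi\<^sub>E (D - {d}) (\<lambda>d. {..<K d})"
  have F: "Fns = (\<lambda>(j, b). b(d := j)) ` ({..<K d} \<times> ?P)"
    unfolding Fns_def using assms PiE_insert_eq[of d "D - {d}" "\<lambda>d. {..<K d}"]
    by (simp add: insert_absorb)
  have inj: "inj_on (\<lambda>(j, b). b(d := j)) ({..<K d} \<times> ?P)"
    using inj_combinator[of d "D - {d}" "\<lambda>d. {..<K d}"] by simp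
  have split: "(\<Sum>b\<in>Fns. g b) = (\<Sum>j<K d. \<Sum>b\<in>?P. g (b(d := j)))" for g :: "('d \<Rightarrow> nat) \<Rightarrow> real"
    unfolding F by (subst sum.reindex[OF inj]) (simp add: sum.cartesian_product case_prod_unfold)
  have "(\<Sum>b\<in>Fns. (\<Sum>j<K d. h (b(d := j))) / real (K d)) = (\<Sum>b\<in>Fns. h b)"
    unfolding split using K_pos[of d]
    by (simp add: sum.swap[of _ "{..<K d}" ?P] flip: sum_divide_distrib)
  then show ?thesis by (simp add: Exp_def)
qed

text \<open>Invariance is asked of all functions \<open>b\<close>, not only of those in
  \<open>Fns\<close>, so that it can be checked by looking at which coordinates \<open>h\<close>
  reads.\<close>

definition indep_of :: "(('d \<Rightarrow> nat) \<Rightarrow> real) \<Rightarrow> 'd \<Rightarrow> bool" where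
  "indep_of h d \<longleftrightarrow> (\<forall>b j. h (b(d := j)) = h b)"

lemma Exp_indep:
  assumes "d \<in> D" "indep_of h d"
  shows "Exp (\<lambda>b. g (b d) * h b) = (\<Sum>j<K d. g j) / real (K d) * Exp h"
proof -
  have "Exp (\<lambda>b. g (b d) * h b) = Exp (\<lambda>b. (\<Sum>j<K d. g j) / real (K d) * h b)"
    using assms(2) by (subst Exp_resample[OF assms(1)]) (simp add: indep_of_def sum_distrib_right)
  then show ?thesis by (simp only: Exp_cmult)
qed

text \<open>Importance weight of the thinning: index \<open>d\<close> is selected (value 0) with
  probability \<open>1 / K d\<close>, and the factor \<open>K d\<close> brings the mean back to
  1.\<close>

definition xi :: "('d \<Rightarrow> nat) \<Rightarrow> 'd \<Rightarrow> real" where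
  "xi b d = (if b d = 0 then real (K d) else 0)"

lemma xi_nonneg: "0 \<le> xi b d" by (simp add: xi_def)

lemma Exp_xi:
  assumes "d \<in> D" "indep_of h d"
  shows "Exp (\<lambda>b. xi b d * h b) = Exp h"
  using Exp_indep[OF assms, of "\<lambda>j. if j = 0 then real (K d) else 0"] K_pos[of d]
  by (simp add: xi_def sum.delta)

lemma Exp_member:
  assumes "d \<in> D" "indep_of h d"
  shows "Exp (\<lambda>b. of_bool (b d = 0) * h b) = Exp h / real (K d)"
  using Exp_indep[OF assms, of "\<lambda>j. of_bool (j = 0)"] K_pos[of d]
  by (simp add: of_bool_def sum.delta)

text \<open>Coordinate \<open>d\<close> is uniform whatever \<open>b d'\<close> is, and
  \<open>h\<close> may still read \<open>b d'\<close>. The two indices may have different ranges, so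
  \<open>b d'\<close> may be out of reach for \<open>b d\<close>; hence an inequality.\<close>

lemma Exp_collision:
  assumes "d \<in> D" "d \<noteq> d'" "indep_of h d" and h: "\<And>b. 0 \<le> h b"
  shows "Exp (\<lambda>b. of_bool (b d = b d') * h b) \<le> Exp h / real (K d)"
proof -
  have "Exp (\<lambda>b. of_bool (b d = b d') * h b)
      = Exp (\<lambda>b. (\<Sum>j<K d. of_bool (j = b d') * h b) / real (K d))"
    using assms(2,3) by (subst Exp_resample[OF assms(1)]) (simp add: indep_of_def)
  also have "\<dots> \<le> Exp (\<lambda>b. (1 / real (K d)) * h b)"
  proof (rule Exp_mono)
    fix b
    have "(\<Sum>j<K d. of_bool (j = b d') * h b) = (\<Sum>j<K d. if j = b d' then h b else 0)"
      by (intro sum.cong) auto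
    also have "\<dots> \<le> h b" using h[of b] by (simp add: sum.delta)
    finally show "(\<Sum>j<K d. of_bool (j = b d') * h b) / real (K d) \<le> (1 / real (K d)) * h b"
      by (simp add: divide_right_mono)
  qed
  also have "\<dots> = Exp h / real (K d)" by (subst Exp_cmult) simp
  finally show ?thesis .
qed

text \<open>Cauchy-Schwarz over the finite set \<open>Fns\<close>.\<close>

lemma Exp_abs_le: "Exp (\<lambda>b. \<bar>z b\<bar>) \<le> sqrt (Exp (\<lambda>b. (z b)\<^sup>2))"
proof -
  let ?N = "real (card Fns)"
  have N: "?N > 0" using card_Fns_pos by simp
  have "(\<Sum>b\<in>Fns. \<bar>z b\<bar>)\<^sup>2 \<le> (\<Sum>b\<in>Fns. \<bar>z b\<bar>\<^sup>2) * ?N"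
    using sum_squared_le_sum_of_squares[of "\<lambda>b. \<bar>z b\<bar>" Fns] by simp
  then have "(Exp (\<lambda>b. \<bar>z b\<bar>))\<^sup>2 \<le> Exp (\<lambda>b. (z b)\<^sup>2)"
    using N by (simp add: Exp_def power_divide divide_simps power2_eq_square)
  then show ?thesis by (rule real_le_rsqrt)
qed

text \<open>Atoms of weight at most \<open>\<tau>\<close> are controlled by their variance, the heavier ones by their mass.\<close>
lemma Exp_abs_deviation:
  fixes q :: "'a \<Rightarrow> real" and e :: "'a \<Rightarrow> 'd"
  assumes A: "finite A" and inj: "inj_on e A" and eD: "e ` A \<subseteq> D" and Ke: "\<And>a. a \<in> A \<Longrightarrow> K (e a) = k"
    and q: "\<And>a. a \<in> A \<Longrightarrow> 0 \<le> q a" and q1: "(\<Sum>a\<in>A. q a) = 1" and tau: "0 \<le> \<tau>"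
  shows "Exp (\<lambda>b. \<bar>1 - (\<Sum>a\<in>A. q a * xi b (e a))\<bar>)
     \<le> 2 * (\<Sum>a\<in>A. q a * of_bool (q a > \<tau>)) + sqrt ((real k - 1) * \<tau>)"
proof -
  define G where "G = {a\<in>A. q a \<le> \<tau>}"
  define B where "B = {a\<in>A. q a > \<tau>}"
  have fin: "finite G" "finite B" using A by (auto simp: G_def B_def)
  have AGB: "A = G \<union> B" "G \<inter> B = {}" by (auto simp: G_def B_def)
  have split: "(\<Sum>a\<in>A. h a) = (\<Sum>a\<in>G. h a) + (\<Sum>a\<in>B. h a)" for h :: "'a \<Rightarrow> real"
    using fin AGB by (simp add: sum.union_disjoint)
  have A_ne: "A \<noteq> {}" using q1 by auto
  then have k1: "real k \<ge> 1" using Ke K_pos by (metis One_nat_def Suc_leI ex_in_conv of_nat_1 of_nat_le_iff)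
  have one: "Exp (\<lambda>b. xi b (e a)) = 1" if "a \<in> A" for a
    using Exp_xi[of "e a" "\<lambda>_. 1"] that eD by (auto simp: indep_of_def Exp_const)
  define z where "z b = (\<Sum>a\<in>G. q a * (xi b (e a) - 1))" for b
  \<comment> \<open>As \<open>e\<close> is injective, distinct atoms have distinct indices and
    uncorrelated weights. At a single index the square of a variable with values 0 and k is k times
    the variable, so the variance is k - 1.\<close>
  have cov: "Exp (\<lambda>b. (xi b (e a) - 1) * (xi b (e a') - 1)) = (if a = a' then real k - 1 else 0)"
    if "a \<in> A" "a' \<in> A" for a a'
  proof -
    have eq: "(xi b (e a) - 1) * (xi b (e a') - 1)
       = xi b (e a) * xi b (e a') + ((-1) * xi b (e a) + ((-1) * xi b (e a') + 1))" for b
      by (simp add: algebra_simps)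
    have "Exp (\<lambda>b. xi b (e a) * xi b (e a')) = (if a = a' then real k else 1)"
    proof (cases "a = a'")
      case True
      have "Exp (\<lambda>b. xi b (e a) * xi b (e a)) = Exp (\<lambda>b. real k * xi b (e a))"
        using Ke[OF that(1)] by (intro Exp_cong) (simp add: xi_def)
      then show ?thesis using True one[OF that(1)] by (simp add: Exp_cmult)
    next
      case False
      then have ne: "e a \<noteq> e a'" using inj that by (meson inj_onD)
      have "Exp (\<lambda>b. xi b (e a) * xi b (e a')) = Exp (\<lambda>b. xi b (e a'))"
        using ne eD that(1) by (intro Exp_xi) (auto simp: indep_of_def xi_def)
      then show ?thesis using False one[OF that(2)] by simp
    qed
    then show ?thesis
      unfolding eq Exp_add Exp_cmult Exp_const using one that by simp
  qed
  have "Exp (\<lambda>b. (z b)\<^sup>2) = Exp (\<lambda>b. \<Sum>a\<in>G. \<Sum>a'\<in>G. (q a * q a') * ((xi b (e a) - 1) * (xi b (e a') - 1)))"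
    unfolding z_def power2_eq_square sum_product by (intro Exp_cong sum.cong refl) (simp add: algebra_simps)
  also have "\<dots> = (\<Sum>a\<in>G. \<Sum>a'\<in>G. (q a * q a') * (if a = a' then real k - 1 else 0))"
    unfolding Exp_sum Exp_cmult by (intro sum.cong refl) (use cov G_def in auto)
  also have "\<dots> = (\<Sum>a\<in>G. q a * q a * (real k - 1))"
    by (intro sum.cong refl) (use fin in \<open>simp add: sum.delta if_distrib cong: if_cong\<close>)
  also have "\<dots> \<le> (\<Sum>a\<in>G. q a * (\<tau> * (real k - 1)))"
    using q k1 unfolding mult.assoc by (intro sum_mono mult_left_mono mult_right_mono) (auto simp: G_def)
  also have "\<dots> = (\<Sum>a\<in>G. q a) * (\<tau> * (real k - 1))" by (simp add: sum_distrib_right)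
  also have "\<dots> \<le> 1 * (\<tau> * (real k - 1))"
  proof (rule mult_right_mono)
    have "(\<Sum>a\<in>G. q a) \<le> (\<Sum>a\<in>A. q a)" using q A by (intro sum_mono2) (auto simp: G_def)
    then show "(\<Sum>a\<in>G. q a) \<le> 1" using q1 by simp
  qed (use tau k1 in auto)
  finally have z2: "Exp (\<lambda>b. (z b)\<^sup>2) \<le> (real k - 1) * \<tau>" by (simp add: mult.commute)
  \<comment> \<open>Light atoms contribute the absolute value of \<open>z\<close>. For heavy atoms
    the triangle inequality is enough: thinned and original mass have the same mean, whence the
    factor 2.\<close>
  have "Exp (\<lambda>b. \<bar>1 - (\<Sum>a\<in>A. q a * xi b (e a))\<bar>)
      \<le> Exp (\<lambda>b. \<bar>z b\<bar> + ((\<Sum>a\<in>B. q a * xi b (e a)) + (\<Sum>a\<in>B. q a)))"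
  proof (rule Exp_mono)
    fix b
    have "1 - (\<Sum>a\<in>A. q a * xi b (e a)) = (\<Sum>a\<in>A. q a) - (\<Sum>a\<in>A. q a * xi b (e a))"
      using q1 by simp
    also have "\<dots> = - z b + ((\<Sum>a\<in>B. q a) - (\<Sum>a\<in>B. q a * xi b (e a)))"
      unfolding split z_def by (simp add: algebra_simps sum_subtractf)
    finally have e: "1 - (\<Sum>a\<in>A. q a * xi b (e a))
        = - z b + ((\<Sum>a\<in>B. q a) - (\<Sum>a\<in>B. q a * xi b (e a)))" .
    have "0 \<le> (\<Sum>a\<in>B. q a)" "0 \<le> (\<Sum>a\<in>B. q a * xi b (e a))"
      using q by (auto intro!: sum_nonneg mult_nonneg_nonneg xi_nonneg simp: B_def)
    then show "\<bar>1 - (\<Sum>a\<in>A. q a * xi b (e a))\<bar> \<le> \<bar>z b\<bar> + ((\<Sum>a\<in>B. q a * xi b (e a)) + (\<Sum>a\<in>B. q a))"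
      unfolding e by linarith
  qed
  also have "\<dots> = Exp (\<lambda>b. \<bar>z b\<bar>) + 2 * (\<Sum>a\<in>B. q a)"
  proof -
    have "(\<Sum>a\<in>B. q a * Exp (\<lambda>b. xi b (e a))) = (\<Sum>a\<in>B. q a)"
      using one by (intro sum.cong) (auto simp: B_def)
    then show ?thesis by (simp add: Exp_add Exp_sum Exp_cmult Exp_const)
  qed
  also have "Exp (\<lambda>b. \<bar>z b\<bar>) \<le> sqrt ((real k - 1) * \<tau>)"
    using Exp_abs_le[of z] z2 real_sqrt_le_mono order_trans by blast
  also have "(\<Sum>a\<in>B. q a) = (\<Sum>a\<in>A. q a * of_bool (q a > \<tau>))"
    using A by (simp add: B_def sum.inter_filter of_bool_def if_distrib cong: if_cong)
  finally show ?thesis by simp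
qed

end

text \<open>The kernel \<open>k\<close> thinned by the weights \<open>w\<close> and renormalised.
  When the weighted mass is zero, that is when no codeword carries mass, \<open>k\<close> itself is
  the default, so the result is a probability vector in every case.\<close>

definition tilt :: "'a set \<Rightarrow> ('a \<Rightarrow> real) \<Rightarrow> ('a \<Rightarrow> real) \<Rightarrow> 'a \<Rightarrow> real" where
  "tilt A k w a = (if (\<Sum>b\<in>A. k b * w b) = 0 then k a else k a * w a / (\<Sum>b\<in>A. k b * w b))"

lemma tilt_nonneg:
  assumes "\<And>a. a \<in> A \<Longrightarrow> 0 \<le> k a" "\<And>a. a \<in> A \<Longrightarrow> 0 \<le> w a" "a \<in> A"
  shows "0 \<le> tilt A k w a"
  using assms by (auto simp: tilt_def intro!: divide_nonneg_nonneg sum_nonneg)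

lemma tilt_sum: "(\<Sum>a\<in>A. k a) = 1 \<Longrightarrow> (\<Sum>a\<in>A. tilt A k w a) = 1"
  by (cases "(\<Sum>b\<in>A. k b * w b) = 0") (simp_all add: tilt_def flip: sum_divide_distrib)

text \<open>Absolute continuity: thinned encoders produce only tuples that are possible under the
  ideal law, and on those the function value can be read off.\<close>

lemma tilt_neq_0: "tilt A k w a \<noteq> 0 \<Longrightarrow> k a \<noteq> 0"
  by (auto simp: tilt_def split: if_splits)

text \<open>With S the weighted mass and z the weighted cost, z / S = z + (z / S) (1 - S), and z
  \<le> S because costs are at most 1. If S = 0, the error term equals 1 and absorbs any
  cost.\<close>

lemma tilt_sum_le:
  assumes k: "\<And>a. a \<in> A \<Longrightarrow> 0 \<le> k a" and w: "\<And>a. a \<in> A \<Longrightarrow> 0 \<le> w a" and k1: "(\<Sum>a\<in>A. k a) = 1"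
    and c: "\<And>a. a \<in> A \<Longrightarrow> 0 \<le> c a" "\<And>a. a \<in> A \<Longrightarrow> c a \<le> 1"
  shows "(\<Sum>a\<in>A. tilt A k w a * c a) \<le> (\<Sum>a\<in>A. k a * w a * c a) + \<bar>1 - (\<Sum>a\<in>A. k a * w a)\<bar>"
proof -
  let ?S = "\<Sum>a\<in>A. k a * w a" and ?z = "\<Sum>a\<in>A. k a * w a * c a"
  have S0: "0 \<le> ?S" using k w by (intro sum_nonneg) auto
  have z0: "0 \<le> ?z" using k w c by (intro sum_nonneg) auto
  have zS: "?z \<le> ?S" using k w c by (intro sum_mono) (simp add: mult_left_le)
  show ?thesis
  proof (cases "?S = 0")
    case True
    have "(\<Sum>a\<in>A. k a * c a) \<le> (\<Sum>a\<in>A. k a)" using k c by (intro sum_mono) (simp add: mult_left_le)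
    then show ?thesis using True k1 z0 by (simp add: tilt_def)
  next
    case False
    then have S: "?S > 0" using S0 by simp
    have "(\<Sum>a\<in>A. tilt A k w a * c a) = ?z / ?S"
      using False by (simp add: tilt_def sum_divide_distrib)
    also have "\<dots> = ?z + (?z / ?S) * (1 - ?S)" using S by (simp add: field_simps)
    also have "(?z / ?S) * (1 - ?S) \<le> (?z / ?S) * \<bar>1 - ?S\<bar>"
      using S z0 by (intro mult_left_mono) auto
    also have "\<dots> \<le> 1 * \<bar>1 - ?S\<bar>"
      using S zS by (intro mult_right_mono) auto
    finally show ?thesis by simp
  qed
qed

section \<open>One-shot coding by tilted kernels\<close>

lemma exists_le_weighted_average:
  fixes k F :: "'a \<Rightarrow> real"
  assumes "finite A" "\<And>a. a \<in> A \<Longrightarrow> 0 \<le> k a" "(\<Sum>a\<in>A. k a) = 1"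
  shows "\<exists>a\<in>A. F a \<le> (\<Sum>a\<in>A. k a * F a)"
proof (rule ccontr)
  assume "\<not> ?thesis"
  then have less: "\<And>a. a \<in> A \<Longrightarrow> (\<Sum>a\<in>A. k a * F a) < F a" by force
  obtain a0 where a0: "a0 \<in> A" "k a0 \<noteq> 0"
    using assms(3) by (metis sum.neutral zero_neq_one)
  have "(\<Sum>a\<in>A. k a * (\<Sum>a\<in>A. k a * F a)) < (\<Sum>a\<in>A. k a * F a)"
    using a0 less assms(1,2) by (intro sum_strict_mono_ex1)
      (auto intro!: bexI[of _ a0] mult_left_mono mult_strict_left_mono simp: less_eq_real_def)
  then show False using assms(3) by (simp flip: sum_distrib_right)
qed

text \<open>The error is affine in the kernel of either encoder, so each encoder may in turn be
  replaced by a deterministic one.\<close>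
lemma derandomize:
  fixes p :: "'x \<Rightarrow> 'y \<Rightarrow> real" and c :: "'x \<Rightarrow> 'y \<Rightarrow> 'a \<Rightarrow> 'b \<Rightarrow> real" and m :: "'a \<Rightarrow> 'm"
  assumes fin: "finite SX" "finite SY" "finite A" "finite B"
    and k1: "\<And>x a. x \<in> SX \<Longrightarrow> a \<in> A \<Longrightarrow> 0 \<le> k1 x a" "\<And>x. x \<in> SX \<Longrightarrow> (\<Sum>a\<in>A. k1 x a) = 1"
    and k2: "\<And>y j b. y \<in> SY \<Longrightarrow> b \<in> B \<Longrightarrow> 0 \<le> k2 y j b" "\<And>y j. y \<in> SY \<Longrightarrow> (\<Sum>b\<in>B. k2 y j b) = 1"
  shows "\<exists>g h. (\<forall>x\<in>SX. g x \<in> A) \<and> (\<forall>y\<in>SY. \<forall>j. h y j \<in> B) \<and>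
      (\<Sum>x\<in>SX. \<Sum>y\<in>SY. p x y * c x y (g x) (h y (m (g x))))
      \<le> (\<Sum>x\<in>SX. \<Sum>y\<in>SY. p x y * (\<Sum>a\<in>A. k1 x a * (\<Sum>b\<in>B. k2 y (m a) b * c x y a b)))"
proof -
  define F where "F x a = (\<Sum>y\<in>SY. p x y * (\<Sum>b\<in>B. k2 y (m a) b * c x y a b))" for x a
  have "\<forall>x\<in>SX. \<exists>a\<in>A. F x a \<le> (\<Sum>a\<in>A. k1 x a * F x a)"
    using exists_le_weighted_average[OF fin(3)] k1 by blast
  then obtain g where g: "\<And>x. x \<in> SX \<Longrightarrow> g x \<in> A" "\<And>x. x \<in> SX \<Longrightarrow> F x (g x) \<le> (\<Sum>a\<in>A. k1 x a * F x a)"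
    by metis
  \<comment> \<open>The second encoder sees \<open>y\<close> and the message \<open>j\<close> only,
    so its choice at (y, j) concerns exactly those \<open>x\<close> whose message is
    \<open>j\<close>.\<close>
  define H where "H y j b = (\<Sum>x\<in>{x\<in>SX. m (g x) = j}. p x y * c x y (g x) b)" for y j b
  have "\<forall>y\<in>SY. \<forall>j. \<exists>b\<in>B. H y j b \<le> (\<Sum>b\<in>B. k2 y j b * H y j b)"
    using exists_le_weighted_average[OF fin(4)] k2 by blast
  then obtain h where h: "\<And>y j. y \<in> SY \<Longrightarrow> h y j \<in> B"
      "\<And>y j. y \<in> SY \<Longrightarrow> H y j (h y j) \<le> (\<Sum>b\<in>B. k2 y j b * H y j b)"
    by metis
  have grp: "(\<Sum>x\<in>SX. G x) = (\<Sum>j\<in>(\<lambda>x. m (g x)) ` SX. \<Sum>x\<in>{x\<in>SX. m (g x) = j}. G x)" for G :: "'x \<Rightarrow> real"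
    using sum.image_gen[OF fin(1), of G "\<lambda>x. m (g x)"] .
  have "(\<Sum>x\<in>SX. \<Sum>y\<in>SY. p x y * c x y (g x) (h y (m (g x))))
      = (\<Sum>y\<in>SY. \<Sum>j\<in>(\<lambda>x. m (g x)) ` SX. H y j (h y j))"
    unfolding H_def by (subst sum.swap, subst grp) (intro sum.cong refl, auto)
  also have "\<dots> \<le> (\<Sum>y\<in>SY. \<Sum>j\<in>(\<lambda>x. m (g x)) ` SX. \<Sum>b\<in>B. k2 y j b * H y j b)"
    using h by (intro sum_mono) auto
  also have "\<dots> = (\<Sum>y\<in>SY. \<Sum>j\<in>(\<lambda>x. m (g x)) ` SX. \<Sum>x\<in>{x\<in>SX. m (g x) = j}.
      p x y * (\<Sum>b\<in>B. k2 y (m (g x)) b * c x y (g x) b))"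
  proof (intro sum.cong refl)
    fix y j
    have "(\<Sum>b\<in>B. k2 y j b * H y j b)
        = (\<Sum>x\<in>{x\<in>SX. m (g x) = j}. \<Sum>b\<in>B. k2 y j b * (p x y * c x y (g x) b))"
      unfolding H_def sum_distrib_left by (rule sum.swap)
    also have "\<dots> = (\<Sum>x\<in>{x\<in>SX. m (g x) = j}. p x y * (\<Sum>b\<in>B. k2 y (m (g x)) b * c x y (g x) b))"
      by (intro sum.cong refl) (auto simp: sum_distrib_left mult_ac)
    finally show "(\<Sum>b\<in>B. k2 y j b * H y j b) = \<dots>" .
  qed
  also have "\<dots> = (\<Sum>x\<in>SX. F x (g x))"
    unfolding F_def by (subst (2) sum.swap) (simp only: grp)
  also have "\<dots> \<le> (\<Sum>x\<in>SX. \<Sum>a\<in>A. k1 x a * F x a)"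
    using g by (intro sum_mono) auto
  also have "\<dots> = (\<Sum>x\<in>SX. \<Sum>y\<in>SY. p x y * (\<Sum>a\<in>A. k1 x a * (\<Sum>b\<in>B. k2 y (m a) b * c x y a b)))"
    unfolding F_def sum_distrib_left
    by (intro sum.cong refl, subst sum.swap, intro sum.cong refl) (simp add: mult_ac)
  finally show ?thesis using g(1) h(1) by blast
qed

lemma weighted_average_bounds:
  fixes k g :: "'a \<Rightarrow> real"
  assumes "\<And>a. a \<in> A \<Longrightarrow> 0 \<le> k a" "(\<Sum>a\<in>A. k a) = 1" "\<And>a. a \<in> A \<Longrightarrow> 0 \<le> g a \<and> g a \<le> 1"
  shows "0 \<le> (\<Sum>a\<in>A. k a * g a) \<and> (\<Sum>a\<in>A. k a * g a) \<le> 1"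
proof -
  have "(\<Sum>a\<in>A. k a * g a) \<le> (\<Sum>a\<in>A. k a)" using assms by (intro sum_mono) (simp add: mult_left_le)
  moreover have "0 \<le> (\<Sum>a\<in>A. k a * g a)" using assms by (intro sum_nonneg) auto
  ultimately show ?thesis using assms(2) by simp
qed

lemma weighted_sum_le_add:
  fixes k z g g' d :: "'a \<Rightarrow> real"
  assumes "\<And>a. 0 \<le> k a" "\<And>a. 0 \<le> z a" "\<And>a. a \<in> A \<Longrightarrow> g a \<le> g' a + d a"
  shows "(\<Sum>a\<in>A. k a * z a * g a) \<le> (\<Sum>a\<in>A. k a * z a * g' a) + (\<Sum>a\<in>A. k a * z a * d a)"
  using assms unfolding sum.distrib[symmetric] distrib_left[symmetric]
  by (intro sum_mono mult_left_mono) auto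

text \<open>\<open>CT\<close>, \<open>CU\<close>, \<open>CV\<close>, \<open>CW\<close> index codebook membership: a sequence is a codeword iff its
  hash is \<open>0\<close>, and the weight \<open>xi\<close> compensates for this thinning. \<open>MU\<close>, \<open>MV\<close>, \<open>MW\<close> index the
  bin numbers sent by the encoders; since all bins except \<open>CT\<close> are bins of a pair containing \<open>t\<close>, a
  wrong \<open>t\<close> makes all of them fresh.\<close>
datatype ('t,'u,'v,'w) idx = CT 't | CU 't 'u | CV 't 'v | CW 't 'w | MU 't 'u | MV 't 'v | MW 't 'w

text \<open>The kernels are real functions on finite carriers, so that products of single-letter
  kernels over a block are instances. Their arguments record who knows what: u and v are drawn from
  (x, t), and w from (t, u, y). \<open>KT\<close> to \<open>KW\<close> are the thinning factors of
  the codebooks, \<open>M0\<close>, \<open>MX\<close>, \<open>MY\<close> the numbers of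
  bins.\<close>

locale one_shot =
  fixes SX :: "'x set" and SY :: "'y set" and ST :: "'t set" and SU :: "'u set"
    and SV :: "'v set" and SW :: "'w set"
    and p :: "'x \<Rightarrow> 'y \<Rightarrow> real" and kT :: "'x \<Rightarrow> 't \<Rightarrow> real" and kU :: "'x \<Rightarrow> 't \<Rightarrow> 'u \<Rightarrow> real"
    and kV :: "'x \<Rightarrow> 't \<Rightarrow> 'v \<Rightarrow> real" and kW :: "'t \<Rightarrow> 'u \<Rightarrow> 'y \<Rightarrow> 'w \<Rightarrow> real"
    and KT KU KV KW M0 MX MY :: nat
  assumes fin: "finite SX" "finite SY" "finite ST" "finite SU" "finite SV" "finite SW"
    and pos: "KT > 0" "KU > 0" "KV > 0" "KW > 0" "M0 > 0" "MX > 0" "MY > 0"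
    and p: "\<And>x y. 0 \<le> p x y" "(\<Sum>x\<in>SX. \<Sum>y\<in>SY. p x y) = 1"
    and kT: "\<And>x t. 0 \<le> kT x t" "\<And>x. x \<in> SX \<Longrightarrow> (\<Sum>t\<in>ST. kT x t) = 1"
    and kU: "\<And>x t u. 0 \<le> kU x t u" "\<And>x t. x \<in> SX \<Longrightarrow> t \<in> ST \<Longrightarrow> (\<Sum>u\<in>SU. kU x t u) = 1"
    and kV: "\<And>x t v. 0 \<le> kV x t v" "\<And>x t. x \<in> SX \<Longrightarrow> t \<in> ST \<Longrightarrow> (\<Sum>v\<in>SV. kV x t v) = 1"
    and kW: "\<And>t u y w. 0 \<le> kW t u y w"
      "\<And>t u y. t \<in> ST \<Longrightarrow> u \<in> SU \<Longrightarrow> y \<in> SY \<Longrightarrow> (\<Sum>w\<in>SW. kW t u y w) = 1"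
begin

definition Ds :: "('t,'u,'v,'w) idx set" where
  "Ds = CT ` ST \<union> case_prod CU ` (ST \<times> SU) \<union> case_prod CV ` (ST \<times> SV) \<union> case_prod CW ` (ST \<times> SW)
      \<union> case_prod MU ` (ST \<times> SU) \<union> case_prod MV ` (ST \<times> SV) \<union> case_prod MW ` (ST \<times> SW)"

primrec Kf :: "('t,'u,'v,'w) idx \<Rightarrow> nat" where
  "Kf (CT t) = KT" | "Kf (CU t u) = KU" | "Kf (CV t v) = KV" | "Kf (CW t w) = KW"
| "Kf (MU t u) = M0" | "Kf (MV t v) = MX" | "Kf (MW t w) = MY"

sublocale random_hash Ds Kf
proof
  show "finite Ds" using fin by (auto simp: Ds_def)
  show "Kf d > 0" for d using pos by (cases d) auto
qed

lemma mem_Ds [simp]: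
  "CT t \<in> Ds \<longleftrightarrow> t \<in> ST" "CU t u \<in> Ds \<longleftrightarrow> t \<in> ST \<and> u \<in> SU" "CV t v \<in> Ds \<longleftrightarrow> t \<in> ST \<and> v \<in> SV"
  "CW t w \<in> Ds \<longleftrightarrow> t \<in> ST \<and> w \<in> SW" "MU t u \<in> Ds \<longleftrightarrow> t \<in> ST \<and> u \<in> SU" "MV t v \<in> Ds \<longleftrightarrow> t \<in> ST \<and> v \<in> SV"
  "MW t w \<in> Ds \<longleftrightarrow> t \<in> ST \<and> w \<in> SW"
  by (auto simp: Ds_def)

definition tT where "tT b x = tilt ST (kT x) (\<lambda>t. xi b (CT t))"
definition tU where "tU b x t = tilt SU (kU x t) (\<lambda>u. xi b (CU t u))"
definition tV where "tV b x t = tilt SV (kV x t) (\<lambda>v. xi b (CV t v))"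
definition tW where "tW b t u y = tilt SW (kW t u y) (\<lambda>w. xi b (CW t w))"

lemma tilted_nonneg:
  "t \<in> ST \<Longrightarrow> 0 \<le> tT b x t" "u \<in> SU \<Longrightarrow> 0 \<le> tU b x t u"
  "v \<in> SV \<Longrightarrow> 0 \<le> tV b x t v" "w \<in> SW \<Longrightarrow> 0 \<le> tW b t u y w"
  unfolding tT_def tU_def tV_def tW_def by (auto intro!: tilt_nonneg kT kU kV kW xi_nonneg)

lemma tilted_sum:
  "x \<in> SX \<Longrightarrow> (\<Sum>t\<in>ST. tT b x t) = 1" "x \<in> SX \<Longrightarrow> t \<in> ST \<Longrightarrow> (\<Sum>u\<in>SU. tU b x t u) = 1"
  "x \<in> SX \<Longrightarrow> t \<in> ST \<Longrightarrow> (\<Sum>v\<in>SV. tV b x t v) = 1"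
  "t \<in> ST \<Longrightarrow> u \<in> SU \<Longrightarrow> y \<in> SY \<Longrightarrow> (\<Sum>w\<in>SW. tW b t u y w) = 1"
  unfolding tT_def tU_def tV_def tW_def by (auto intro!: tilt_sum kT kU kV kW)

text \<open>Deviation of the random normalising constant from its mean 1, the error term of
  \<open>tilt_sum_le\<close>; likewise for the other three kernels.\<close>

definition dT where "dT b x = \<bar>1 - (\<Sum>t\<in>ST. kT x t * xi b (CT t))\<bar>"
definition dU where "dU b x t = \<bar>1 - (\<Sum>u\<in>SU. kU x t u * xi b (CU t u))\<bar>"
definition dV where "dV b x t = \<bar>1 - (\<Sum>v\<in>SV. kV x t v * xi b (CV t v))\<bar>"
definition dW where "dW b t u y = \<bar>1 - (\<Sum>w\<in>SW. kW t u y w * xi b (CW t w))\<bar>"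

definition J where "J x y t u v w = p x y * kT x t * kU x t u * kV x t v * kW t u y w"

definition Ex :: "('x \<Rightarrow> 'y \<Rightarrow> 't \<Rightarrow> 'u \<Rightarrow> 'v \<Rightarrow> 'w \<Rightarrow> real) \<Rightarrow> real" where
  "Ex F = (\<Sum>x\<in>SX. \<Sum>y\<in>SY. \<Sum>t\<in>ST. \<Sum>u\<in>SU. \<Sum>v\<in>SV. \<Sum>w\<in>SW. J x y t u v w * F x y t u v w)"

text \<open>\<open>tilt_sum_le\<close> removes the normalisation of T, U, V, W in turn, while the
  averages over the later kernels, still normalised, stay in [0,1]. Each deviation is thus weighted
  only by \<open>xi\<close> of earlier variables, which sit at other hash indices than the deviation
  itself.\<close>

lemma tilted_cost_le:
  assumes c: "\<And>x y t u v w. 0 \<le> c x y t u v w" "\<And>x y t u v w. c x y t u v w \<le> (1::real)"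
  shows "(\<Sum>x\<in>SX. \<Sum>y\<in>SY. p x y * (\<Sum>t\<in>ST. tT b x t * (\<Sum>u\<in>SU. tU b x t u *
           (\<Sum>v\<in>SV. tV b x t v * (\<Sum>w\<in>SW. tW b t u y w * c x y t u v w)))))
    \<le> Ex (\<lambda>x y t u v w. xi b (CT t) * (xi b (CU t u) * (xi b (CV t v) * (xi b (CW t w) * c x y t u v w))))
    + (\<Sum>x\<in>SX. \<Sum>y\<in>SY. \<Sum>t\<in>ST. \<Sum>u\<in>SU. \<Sum>v\<in>SV. (p x y * kT x t * kU x t u * kV x t v)
         * (xi b (CT t) * (xi b (CU t u) * (xi b (CV t v) * dW b t u y))))
    + (\<Sum>x\<in>SX. \<Sum>y\<in>SY. \<Sum>t\<in>ST. \<Sum>u\<in>SU. (p x y * kT x t * kU x t u)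
         * (xi b (CT t) * (xi b (CU t u) * dV b x t)))
    + (\<Sum>x\<in>SX. \<Sum>y\<in>SY. \<Sum>t\<in>ST. (p x y * kT x t) * (xi b (CT t) * dU b x t))
    + (\<Sum>x\<in>SX. \<Sum>y\<in>SY. p x y * dT b x)"
proof -
  define cW where "cW x y t u v = (\<Sum>w\<in>SW. tW b t u y w * c x y t u v w)" for x y t u v
  define cV where "cV x y t u = (\<Sum>v\<in>SV. tV b x t v * cW x y t u v)" for x y t u
  define cU where "cU x y t = (\<Sum>u\<in>SU. tU b x t u * cV x y t u)" for x y t
  have cW1: "0 \<le> cW x y t u v \<and> cW x y t u v \<le> 1" if "t \<in> ST" "u \<in> SU" "y \<in> SY" for x y t u v
    unfolding cW_def using that by (intro weighted_average_bounds tilted_nonneg tilted_sum conjI c)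
  have cV1: "0 \<le> cV x y t u \<and> cV x y t u \<le> 1" if "x \<in> SX" "t \<in> ST" "u \<in> SU" "y \<in> SY" for x y t u
    unfolding cV_def using that by (intro weighted_average_bounds tilted_nonneg tilted_sum cW1)
  have cU1: "0 \<le> cU x y t \<and> cU x y t \<le> 1" if "x \<in> SX" "t \<in> ST" "y \<in> SY" for x y t
    unfolding cU_def using that by (intro weighted_average_bounds tilted_nonneg tilted_sum cV1)
  have W: "cW x y t u v \<le> (\<Sum>w\<in>SW. kW t u y w * xi b (CW t w) * c x y t u v w) + dW b t u y"
    if "t \<in> ST" "u \<in> SU" "y \<in> SY" for x y t u v
    unfolding cW_def tW_def dW_def using that by (intro tilt_sum_le kW xi_nonneg c)
  have V: "cV x y t u \<le> (\<Sum>v\<in>SV. kV x t v * xi b (CV t v) * cW x y t u v) + dV b x t"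
    if "x \<in> SX" "t \<in> ST" "u \<in> SU" "y \<in> SY" for x y t u
    unfolding cV_def tV_def dV_def using that cW1 by (intro tilt_sum_le kV xi_nonneg) auto
  have U: "cU x y t \<le> (\<Sum>u\<in>SU. kU x t u * xi b (CU t u) * cV x y t u) + dU b x t"
    if "x \<in> SX" "t \<in> ST" "y \<in> SY" for x y t
    unfolding cU_def tU_def dU_def using that cV1 by (intro tilt_sum_le kU xi_nonneg) auto
  have T: "(\<Sum>t\<in>ST. tT b x t * cU x y t) \<le> (\<Sum>t\<in>ST. kT x t * xi b (CT t) * cU x y t) + dT b x"
    if "x \<in> SX" "y \<in> SY" for x y
    unfolding tT_def dT_def using that cU1 by (intro tilt_sum_le kT xi_nonneg) auto
  have V': "cV x y t u \<le> (\<Sum>v\<in>SV. kV x t v * xi b (CV t v) * (\<Sum>w\<in>SW. kW t u y w * xi b (CW t w) * c x y t u v w))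
      + ((\<Sum>v\<in>SV. kV x t v * xi b (CV t v) * dW b t u y) + dV b x t)"
    if "x \<in> SX" "t \<in> ST" "u \<in> SU" "y \<in> SY" for x y t u
    using V[OF that] weighted_sum_le_add[where A = SV and k = "kV x t" and z = "\<lambda>v. xi b (CV t v)" and g = "cW x y t u",
      OF kV(1) xi_nonneg W[OF that(2,3,4)]] by linarith
  have U': "cU x y t \<le> (\<Sum>u\<in>SU. kU x t u * xi b (CU t u) *
        (\<Sum>v\<in>SV. kV x t v * xi b (CV t v) * (\<Sum>w\<in>SW. kW t u y w * xi b (CW t w) * c x y t u v w)))
      + ((\<Sum>u\<in>SU. kU x t u * xi b (CU t u) * ((\<Sum>v\<in>SV. kV x t v * xi b (CV t v) * dW b t u y) + dV b x t)) + dU b x t)"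
    if "x \<in> SX" "t \<in> ST" "y \<in> SY" for x y t
    using U[OF that] weighted_sum_le_add[where A = SU and k = "kU x t" and z = "\<lambda>u. xi b (CU t u)" and g = "cV x y t",
      OF kU(1) xi_nonneg V'[OF that(1,2) _ that(3)]] by linarith
  have T': "(\<Sum>t\<in>ST. tT b x t * cU x y t) \<le> (\<Sum>t\<in>ST. kT x t * xi b (CT t) * (\<Sum>u\<in>SU. kU x t u * xi b (CU t u) *
        (\<Sum>v\<in>SV. kV x t v * xi b (CV t v) * (\<Sum>w\<in>SW. kW t u y w * xi b (CW t w) * c x y t u v w))))
      + ((\<Sum>t\<in>ST. kT x t * xi b (CT t) * ((\<Sum>u\<in>SU. kU x t u * xi b (CU t u) *
           ((\<Sum>v\<in>SV. kV x t v * xi b (CV t v) * dW b t u y) + dV b x t)) + dU b x t)) + dT b x)"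
    (is "_ \<le> ?R x y")
    if "x \<in> SX" "y \<in> SY" for x y
    using T[OF that] weighted_sum_le_add[where A = ST and k = "kT x" and z = "\<lambda>t. xi b (CT t)" and g = "cU x y",
      OF kT(1) xi_nonneg U'[OF that(1) _ that(2)]] by linarith
  have "(\<Sum>x\<in>SX. \<Sum>y\<in>SY. p x y * (\<Sum>t\<in>ST. tT b x t * cU x y t)) \<le> (\<Sum>x\<in>SX. \<Sum>y\<in>SY. p x y * ?R x y)"
    using T' p(1) by (intro sum_mono mult_left_mono) auto
  also have "\<dots> = Ex (\<lambda>x y t u v w. xi b (CT t) * (xi b (CU t u) * (xi b (CV t v) * (xi b (CW t w) * c x y t u v w))))
    + (\<Sum>x\<in>SX. \<Sum>y\<in>SY. \<Sum>t\<in>ST. \<Sum>u\<in>SU. \<Sum>v\<in>SV. (p x y * kT x t * kU x t u * kV x t v)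
         * (xi b (CT t) * (xi b (CU t u) * (xi b (CV t v) * dW b t u y))))
    + (\<Sum>x\<in>SX. \<Sum>y\<in>SY. \<Sum>t\<in>ST. \<Sum>u\<in>SU. (p x y * kT x t * kU x t u)
         * (xi b (CT t) * (xi b (CU t u) * dV b x t)))
    + (\<Sum>x\<in>SX. \<Sum>y\<in>SY. \<Sum>t\<in>ST. (p x y * kT x t) * (xi b (CT t) * dU b x t))
    + (\<Sum>x\<in>SX. \<Sum>y\<in>SY. p x y * dT b x)"
    unfolding Ex_def J_def distrib_left sum.distrib sum_distrib_left by (simp add: mult_ac add_ac)
  finally show ?thesis unfolding cU_def cV_def cW_def .
qed

section \<open>Expectations under the ideal law and its marginals\<close>

lemma sum_kernel_const: "(\<Sum>a\<in>A. k a) = (1::real) \<Longrightarrow> (\<Sum>a\<in>A. k a * c) = c"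
  by (simp flip: sum_distrib_right)

text \<open>Variables are summed out in the order W, V, U, T, so that no remaining kernel is
  conditioned on the variable being removed.\<close>

lemma Ex_drop_W:
  "Ex (\<lambda>x y t u v w. F x y t u v) = (\<Sum>x\<in>SX. \<Sum>y\<in>SY. \<Sum>t\<in>ST. \<Sum>u\<in>SU. \<Sum>v\<in>SV.
     (p x y * kT x t * kU x t u * kV x t v) * F x y t u v)"
proof -
  have "(\<Sum>w\<in>SW. J x y t u v w * F x y t u v) = (p x y * kT x t * kU x t u * kV x t v) * F x y t u v"
    if "t \<in> ST" "u \<in> SU" "y \<in> SY" for x y t u v
    using sum_kernel_const[OF kW(2)[OF that], of "(p x y * kT x t * kU x t u * kV x t v) * F x y t u v"]
    by (simp add: J_def mult_ac)
  then show ?thesis unfolding Ex_def by (intro sum.cong refl)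
qed

lemma Ex_drop_VW:
  "Ex (\<lambda>x y t u v w. F x y t u) = (\<Sum>x\<in>SX. \<Sum>y\<in>SY. \<Sum>t\<in>ST. \<Sum>u\<in>SU. (p x y * kT x t * kU x t u) * F x y t u)"
proof -
  have "(\<Sum>v\<in>SV. (p x y * kT x t * kU x t u * kV x t v) * F x y t u) = (p x y * kT x t * kU x t u) * F x y t u"
    if "x \<in> SX" "t \<in> ST" for x y t u
    using sum_kernel_const[OF kV(2)[OF that], of "(p x y * kT x t * kU x t u) * F x y t u"] by (simp add: mult_ac)
  then show ?thesis unfolding Ex_drop_W by (intro sum.cong refl)
qed

lemma Ex_drop_UVW:
  "Ex (\<lambda>x y t u v w. F x y t) = (\<Sum>x\<in>SX. \<Sum>y\<in>SY. \<Sum>t\<in>ST. (p x y * kT x t) * F x y t)"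
proof -
  have "(\<Sum>u\<in>SU. (p x y * kT x t * kU x t u) * F x y t) = (p x y * kT x t) * F x y t"
    if "x \<in> SX" "t \<in> ST" for x y t
    using sum_kernel_const[OF kU(2)[OF that], of "(p x y * kT x t) * F x y t"] by (simp add: mult_ac)
  then show ?thesis unfolding Ex_drop_VW by (intro sum.cong refl)
qed

lemma Ex_drop_TUVW: "Ex (\<lambda>x y t u v w. F x y) = (\<Sum>x\<in>SX. \<Sum>y\<in>SY. p x y * F x y)"
proof -
  have "(\<Sum>t\<in>ST. (p x y * kT x t) * F x y) = p x y * F x y" if "x \<in> SX" for x y
    using sum_kernel_const[OF kT(2)[OF that], of "p x y * F x y"] by (simp add: mult_ac)
  then show ?thesis unfolding Ex_drop_UVW by (intro sum.cong refl)
qed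

lemma Ex_const: "Ex (\<lambda>x y t u v w. c) = c"
  unfolding Ex_drop_TUVW using p(2) by (simp flip: sum_distrib_right)

lemma Ex_add: "Ex (\<lambda>x y t u v w. F x y t u v w + G x y t u v w) = Ex F + Ex G"
  unfolding Ex_def distrib_left sum.distrib ..

lemma J_nonneg: "0 \<le> J x y t u v w"
  unfolding J_def using p kT kU kV kW by simp

lemma Ex_mono:
  assumes "\<And>x y t u v w. x \<in> SX \<Longrightarrow> y \<in> SY \<Longrightarrow> t \<in> ST \<Longrightarrow> u \<in> SU \<Longrightarrow> v \<in> SV \<Longrightarrow> w \<in> SW
      \<Longrightarrow> F x y t u v w \<le> G x y t u v w"
  shows "Ex F \<le> Ex G"
  unfolding Ex_def using assms J_nonneg by (intro sum_mono mult_left_mono)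

lemma Exp_Ex: "Exp (\<lambda>b. Ex (F b)) = Ex (\<lambda>x y t u v w. Exp (\<lambda>b. F b x y t u v w))"
  unfolding Ex_def Exp_sum Exp_cmult ..

section \<open>Mean deviation of the normalising constants\<close>

definition slack :: "nat \<Rightarrow> real \<Rightarrow> real" where "slack k \<tau> = sqrt ((real k - 1) * \<tau>)"

lemma Exp_dT: "x \<in> SX \<Longrightarrow> 0 \<le> \<tau> \<Longrightarrow>
  Exp (\<lambda>b. dT b x) \<le> 2 * (\<Sum>t\<in>ST. kT x t * of_bool (kT x t > \<tau>)) + slack KT \<tau>"
  unfolding dT_def slack_def
  by (rule Exp_abs_deviation) (use fin kT in \<open>auto simp: inj_on_def\<close>)

lemma Exp_dU: "x \<in> SX \<Longrightarrow> t \<in> ST \<Longrightarrow> 0 \<le> \<tau> \<Longrightarrow>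
  Exp (\<lambda>b. dU b x t) \<le> 2 * (\<Sum>u\<in>SU. kU x t u * of_bool (kU x t u > \<tau>)) + slack KU \<tau>"
  unfolding dU_def slack_def
  by (rule Exp_abs_deviation) (use fin kU in \<open>auto simp: inj_on_def\<close>)

lemma Exp_dV: "x \<in> SX \<Longrightarrow> t \<in> ST \<Longrightarrow> 0 \<le> \<tau> \<Longrightarrow>
  Exp (\<lambda>b. dV b x t) \<le> 2 * (\<Sum>v\<in>SV. kV x t v * of_bool (kV x t v > \<tau>)) + slack KV \<tau>"
  unfolding dV_def slack_def
  by (rule Exp_abs_deviation) (use fin kV in \<open>auto simp: inj_on_def\<close>)

lemma Exp_dW: "t \<in> ST \<Longrightarrow> u \<in> SU \<Longrightarrow> y \<in> SY \<Longrightarrow> 0 \<le> \<tau> \<Longrightarrow>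
  Exp (\<lambda>b. dW b t u y) \<le> 2 * (\<Sum>w\<in>SW. kW t u y w * of_bool (kW t u y w > \<tau>)) + slack KW \<tau>"
  unfolding dW_def slack_def
  by (rule Exp_abs_deviation) (use fin kW in \<open>auto simp: inj_on_def\<close>)

lemma Exp_sum_dT:
  assumes "0 \<le> \<tau>"
  shows "Exp (\<lambda>b. \<Sum>x\<in>SX. \<Sum>y\<in>SY. p x y * dT b x)
    \<le> 2 * Ex (\<lambda>x y t u v w. of_bool (kT x t > \<tau>)) + slack KT \<tau>"
proof -
  have "Exp (\<lambda>b. \<Sum>x\<in>SX. \<Sum>y\<in>SY. p x y * dT b x) = (\<Sum>x\<in>SX. \<Sum>y\<in>SY. p x y * Exp (\<lambda>b. dT b x))"
    unfolding Exp_sum Exp_cmult ..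
  also have "\<dots> \<le> (\<Sum>x\<in>SX. \<Sum>y\<in>SY. p x y * (2 * (\<Sum>t\<in>ST. kT x t * of_bool (kT x t > \<tau>)) + slack KT \<tau>))"
    using p assms by (intro sum_mono mult_left_mono Exp_dT)
  also have "\<dots> = 2 * Ex (\<lambda>x y t u v w. of_bool (kT x t > \<tau>)) + Ex (\<lambda>x y t u v w. slack KT \<tau>)"
    unfolding Ex_drop_TUVW Ex_drop_UVW distrib_left sum.distrib sum_distrib_left by (simp add: mult_ac)
  finally show ?thesis unfolding Ex_const .
qed

text \<open>The weight of t sits at index \<open>CT t\<close> and the deviation reads
  \<open>CU\<close> indices only, so the weight averages to 1. The analogues for V and W remove two
  and three weights in the same way.\<close>

lemma Exp_sum_dU:
  assumes "0 \<le> \<tau>"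
  shows "Exp (\<lambda>b. \<Sum>x\<in>SX. \<Sum>y\<in>SY. \<Sum>t\<in>ST. (p x y * kT x t) * (xi b (CT t) * dU b x t))
    \<le> 2 * Ex (\<lambda>x y t u v w. of_bool (kU x t u > \<tau>)) + slack KU \<tau>"
proof -
  have "Exp (\<lambda>b. xi b (CT t) * dU b x t) = Exp (\<lambda>b. dU b x t)" if "t \<in> ST" for x t
    using that by (intro Exp_xi) (auto simp: indep_of_def dU_def xi_def)
  then have "Exp (\<lambda>b. \<Sum>x\<in>SX. \<Sum>y\<in>SY. \<Sum>t\<in>ST. (p x y * kT x t) * (xi b (CT t) * dU b x t))
     = (\<Sum>x\<in>SX. \<Sum>y\<in>SY. \<Sum>t\<in>ST. (p x y * kT x t) * Exp (\<lambda>b. dU b x t))"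
    unfolding Exp_sum Exp_cmult by simp
  also have "\<dots> \<le> (\<Sum>x\<in>SX. \<Sum>y\<in>SY. \<Sum>t\<in>ST. (p x y * kT x t) *
      (2 * (\<Sum>u\<in>SU. kU x t u * of_bool (kU x t u > \<tau>)) + slack KU \<tau>))"
    using p kT assms by (intro sum_mono mult_left_mono Exp_dU mult_nonneg_nonneg)
  also have "\<dots> = 2 * Ex (\<lambda>x y t u v w. of_bool (kU x t u > \<tau>)) + Ex (\<lambda>x y t u v w. slack KU \<tau>)"
    unfolding Ex_drop_UVW Ex_drop_VW distrib_left sum.distrib sum_distrib_left by (simp add: mult_ac)
  finally show ?thesis unfolding Ex_const .
qed

lemma Exp_sum_dV:
  assumes "0 \<le> \<tau>"
  shows "Exp (\<lambda>b. \<Sum>x\<in>SX. \<Sum>y\<in>SY. \<Sum>t\<in>ST. \<Sum>u\<in>SU. (p x y * kT x t * kU x t u)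
         * (xi b (CT t) * (xi b (CU t u) * dV b x t)))
    \<le> 2 * Ex (\<lambda>x y t u v w. of_bool (kV x t v > \<tau>)) + slack KV \<tau>"
proof -
  have "Exp (\<lambda>b. xi b (CT t) * (xi b (CU t u) * dV b x t)) = Exp (\<lambda>b. dV b x t)" if "t \<in> ST" "u \<in> SU" for x t u
    using that by (subst Exp_xi, simp, force simp: indep_of_def dV_def xi_def)+ simp
  then have "Exp (\<lambda>b. \<Sum>x\<in>SX. \<Sum>y\<in>SY. \<Sum>t\<in>ST. \<Sum>u\<in>SU. (p x y * kT x t * kU x t u)
         * (xi b (CT t) * (xi b (CU t u) * dV b x t)))
     = (\<Sum>x\<in>SX. \<Sum>y\<in>SY. \<Sum>t\<in>ST. \<Sum>u\<in>SU. (p x y * kT x t * kU x t u) * Exp (\<lambda>b. dV b x t))"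
    unfolding Exp_sum Exp_cmult by simp
  also have "\<dots> \<le> (\<Sum>x\<in>SX. \<Sum>y\<in>SY. \<Sum>t\<in>ST. \<Sum>u\<in>SU. (p x y * kT x t * kU x t u) *
      (2 * (\<Sum>v\<in>SV. kV x t v * of_bool (kV x t v > \<tau>)) + slack KV \<tau>))"
    using p kT kU assms by (intro sum_mono mult_left_mono Exp_dV mult_nonneg_nonneg)
  also have "\<dots> = 2 * Ex (\<lambda>x y t u v w. of_bool (kV x t v > \<tau>)) + Ex (\<lambda>x y t u v w. slack KV \<tau>)"
    unfolding Ex_drop_VW Ex_drop_W distrib_left sum.distrib sum_distrib_left by (simp add: mult_ac)
  finally show ?thesis unfolding Ex_const .
qed

lemma Exp_sum_dW:
  assumes "0 \<le> \<tau>"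
  shows "Exp (\<lambda>b. \<Sum>x\<in>SX. \<Sum>y\<in>SY. \<Sum>t\<in>ST. \<Sum>u\<in>SU. \<Sum>v\<in>SV. (p x y * kT x t * kU x t u * kV x t v)
         * (xi b (CT t) * (xi b (CU t u) * (xi b (CV t v) * dW b t u y))))
    \<le> 2 * Ex (\<lambda>x y t u v w. of_bool (kW t u y w > \<tau>)) + slack KW \<tau>"
proof -
  have "Exp (\<lambda>b. xi b (CT t) * (xi b (CU t u) * (xi b (CV t v) * dW b t u y))) = Exp (\<lambda>b. dW b t u y)"
    if "t \<in> ST" "u \<in> SU" "v \<in> SV" for t u v y
    using that by (subst Exp_xi, simp, force simp: indep_of_def dW_def xi_def)+ simp
  then have "Exp (\<lambda>b. \<Sum>x\<in>SX. \<Sum>y\<in>SY. \<Sum>t\<in>ST. \<Sum>u\<in>SU. \<Sum>v\<in>SV. (p x y * kT x t * kU x t u * kV x t v)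
         * (xi b (CT t) * (xi b (CU t u) * (xi b (CV t v) * dW b t u y))))
     = (\<Sum>x\<in>SX. \<Sum>y\<in>SY. \<Sum>t\<in>ST. \<Sum>u\<in>SU. \<Sum>v\<in>SV. (p x y * kT x t * kU x t u * kV x t v) * Exp (\<lambda>b. dW b t u y))"
    unfolding Exp_sum Exp_cmult by simp
  also have "\<dots> \<le> (\<Sum>x\<in>SX. \<Sum>y\<in>SY. \<Sum>t\<in>ST. \<Sum>u\<in>SU. \<Sum>v\<in>SV. (p x y * kT x t * kU x t u * kV x t v) *
      (2 * (\<Sum>w\<in>SW. kW t u y w * of_bool (kW t u y w > \<tau>)) + slack KW \<tau>))"
    using p kT kU kV assms by (intro sum_mono mult_left_mono Exp_dW mult_nonneg_nonneg)
  also have "\<dots> = 2 * Ex (\<lambda>x y t u v w. of_bool (kW t u y w > \<tau>)) + Ex (\<lambda>x y t u v w. slack KW \<tau>)"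
    unfolding Ex_drop_W distrib_left sum.distrib sum_distrib_left
    unfolding Ex_def J_def by (simp add: mult_ac sum_distrib_left)
  finally show ?thesis unfolding Ex_const .
qed

section \<open>Decoding errors and their expected probability\<close>

definition ok1 :: "('t \<times> 'u \<times> 'y) set \<Rightarrow> (('t,'u,'v,'w) idx \<Rightarrow> nat) \<Rightarrow> 'y \<Rightarrow> nat \<Rightarrow> 't \<Rightarrow> 'u \<Rightarrow> bool" where
  "ok1 A b y m t u \<longleftrightarrow> t \<in> ST \<and> u \<in> SU \<and> (t, u, y) \<in> A \<and> b (CT t) = 0 \<and> b (CU t u) = 0 \<and> b (MU t u) = m"

definition ok2 :: "('t \<times> 'v \<times> 'w) set \<Rightarrow> (('t,'u,'v,'w) idx \<Rightarrow> nat) \<Rightarrow> nat \<Rightarrow> nat \<Rightarrow> 't \<Rightarrow> 'v \<Rightarrow> 'w \<Rightarrow> bool" where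
  "ok2 A b i j t v w \<longleftrightarrow> t \<in> ST \<and> v \<in> SV \<and> w \<in> SW \<and> (t, v, w) \<in> A \<and> b (CT t) = 0 \<and> b (CV t v) = 0
     \<and> b (CW t w) = 0 \<and> b (MV t v) = i \<and> b (MW t w) = j"

text \<open>Failure of unique typicality decoding: the true pair does not pass the test, or another
  pair passes it too. The typical set \<open>A\<close> stays abstract; its complement is charged as
  it is, and otherwise only the sizes of its sections matter.\<close>

definition E1 where
  "E1 A b y t u \<longleftrightarrow> \<not> ok1 A b y (b (MU t u)) t u \<or> (\<exists>t' u'. (t', u') \<noteq> (t, u) \<and> ok1 A b y (b (MU t u)) t' u')"

definition E2 where
  "E2 A b t v w \<longleftrightarrow> \<not> ok2 A b (b (MV t v)) (b (MW t w)) t v w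
     \<or> (\<exists>t' v' w'. (t', v', w') \<noteq> (t, v, w) \<and> ok2 A b (b (MV t v)) (b (MW t w)) t' v' w')"

definition Xi where "Xi b t u v w = xi b (CT t) * (xi b (CU t u) * (xi b (CV t v) * xi b (CW t w)))"

lemma Xi_nonneg: "0 \<le> Xi b t u v w" unfolding Xi_def by (simp add: xi_nonneg)

text \<open>The passage from the thinned to the ideal law is free for any quantity that avoids the
  four selected indices.\<close>

lemma Exp_Xi:
  assumes "t \<in> ST" "u \<in> SU" "v \<in> SV" "w \<in> SW"
    and h: "indep_of h (CT t)" "indep_of h (CU t u)" "indep_of h (CV t v)" "indep_of h (CW t w)"
  shows "Exp (\<lambda>b. Xi b t u v w * h b) = Exp h"
proof -
  have "Exp (\<lambda>b. Xi b t u v w * h b)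
      = Exp (\<lambda>b. xi b (CT t) * (xi b (CU t u) * (xi b (CV t v) * (xi b (CW t w) * h b))))"
    by (simp add: Xi_def mult_ac)
  also have "\<dots> = Exp h"
    using assms by (subst Exp_xi, simp, force simp: indep_of_def xi_def)+ simp
  finally show ?thesis .
qed

lemma Exp_sum_indicator_le:
  assumes "finite C" "real (card C) \<le> N" "\<And>c. c \<in> C \<Longrightarrow> Exp (h c) \<le> e" "0 \<le> e"
  shows "Exp (\<lambda>b. \<Sum>c\<in>C. h c b) \<le> N * e"
proof -
  have "Exp (\<lambda>b. \<Sum>c\<in>C. h c b) \<le> (\<Sum>c\<in>C. e)" unfolding Exp_sum using assms by (intro sum_mono)
  also have "\<dots> \<le> N * e" using assms by (simp add: mult_right_mono)
  finally show ?thesis .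
qed

lemma of_bool_le_sum:
  assumes "finite C" "c \<in> C" "P c"
  shows "(1::real) \<le> (\<Sum>c\<in>C. of_bool (P c))"
proof -
  have "(of_bool (P c) :: real) \<le> (\<Sum>c\<in>C. of_bool (P c))" using assms by (intro member_le_sum) auto
  then show ?thesis using assms by simp
qed

text \<open>A union bound over competitors. If t' differs from t, the indices \<open>CT t'\<close>,
  \<open>CU t' u'\<close> and \<open>MU t' u'\<close> are all fresh, which gives probability 1 / (KT
  KU M0) at most. If only u' differs, \<open>CT t\<close> is already known to be selected and the
  factor KT is lost. No competitor index occurs in \<open>Xi\<close>, so that weight averages
  out.\<close>

lemma Exp_E1:
  assumes mem: "t \<in> ST" "u \<in> SU" "v \<in> SV" "w \<in> SW"
    and NTU: "real (card {(t', u'). t' \<in> ST \<and> u' \<in> SU \<and> (t', u', y) \<in> A}) \<le> NTU"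
    and NU: "real (card {u'. u' \<in> SU \<and> (t, u', y) \<in> A}) \<le> NU"
  shows "Exp (\<lambda>b. Xi b t u v w * of_bool (E1 A b y t u))
     \<le> of_bool ((t, u, y) \<notin> A) + NTU / (real KT * real KU * real M0) + NU / (real KU * real M0)"
proof -
  define C1 where "C1 = {(t', u'). t' \<in> ST \<and> u' \<in> SU \<and> (t', u', y) \<in> A \<and> t' \<noteq> t}"
  define C2 where "C2 = {u'. u' \<in> SU \<and> (t, u', y) \<in> A \<and> u' \<noteq> u}"
  define h1 where "h1 = (\<lambda>(t', u') (b :: ('t,'u,'v,'w) idx \<Rightarrow> nat). of_bool (b (CT t') = 0) * (of_bool (b (CU t' u') = 0)
      * (of_bool (b (MU t' u') = b (MU t u)) * (1::real))))"
  define h2 where "h2 = (\<lambda>u' (b :: ('t,'u,'v,'w) idx \<Rightarrow> nat). of_bool (b (CU t u') = 0) * (of_bool (b (MU t u') = b (MU t u)) * (1::real)))"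
  have fC1: "finite C1" using fin by (intro finite_subset[of C1 "ST \<times> SU"]) (auto simp: C1_def)
  have fC2: "finite C2" using fin by (simp add: C2_def)
  have c1: "real (card C1) \<le> NTU"
  proof -
    have "finite {(t', u'). t' \<in> ST \<and> u' \<in> SU \<and> (t', u', y) \<in> A}"
      by (rule finite_subset[where B = "ST \<times> SU"]) (use fin in auto)
    then have "card C1 \<le> card {(t', u'). t' \<in> ST \<and> u' \<in> SU \<and> (t', u', y) \<in> A}"
      by (rule card_mono) (auto simp: C1_def)
    then show ?thesis using NTU by linarith
  qed
  have c2: "real (card C2) \<le> NU"
  proof -
    have "card C2 \<le> card {u'. u' \<in> SU \<and> (t, u', y) \<in> A}"
      using fin by (intro card_mono) (auto simp: C2_def)
    then show ?thesis using NU by linarith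
  qed
  have pw: "Xi b t u v w * of_bool (E1 A b y t u) \<le> of_bool ((t, u, y) \<notin> A) * Xi b t u v w
      + ((\<Sum>c\<in>C1. Xi b t u v w * h1 c b) + (\<Sum>u'\<in>C2. Xi b t u v w * h2 u' b))" for b
  proof (cases "Xi b t u v w = 0")
    case False
    \<comment> \<open>Where \<open>Xi\<close> is nonzero, t and u are codewords, so for a typical
      triple the event \<open>E1\<close> can only come from a competitor.\<close>
    then have inC: "b (CT t) = 0" "b (CU t u) = 0" by (auto simp: Xi_def xi_def split: if_splits)
    have nn: "0 \<le> (\<Sum>c\<in>C1. h1 c b)" "0 \<le> (\<Sum>u'\<in>C2. h2 u' b)"
      by (auto intro!: sum_nonneg simp: h1_def h2_def)
    have "of_bool (E1 A b y t u) \<le> of_bool ((t, u, y) \<notin> A) + ((\<Sum>c\<in>C1. h1 c b) + (\<Sum>u'\<in>C2. h2 u' b))"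
    proof (cases "E1 A b y t u \<and> (t, u, y) \<in> A")
      case True
      then obtain t' u' where tu: "(t', u') \<noteq> (t, u)" "ok1 A b y (b (MU t u)) t' u'"
        using inC mem unfolding E1_def by (auto simp: ok1_def)
      show ?thesis
      proof (cases "t' = t")
        case True
        have "1 \<le> (\<Sum>u'\<in>C2. of_bool (b (CU t u') = 0 \<and> b (MU t u') = b (MU t u)) :: real)"
          using tu True by (intro of_bool_le_sum[OF fC2, of u']) (auto simp: C2_def ok1_def)
        also have "\<dots> = (\<Sum>u'\<in>C2. h2 u' b)" by (simp add: h2_def of_bool_conj)
        finally show ?thesis using nn by (auto simp: of_bool_def)
      next
        case False
        have "1 \<le> (\<Sum>c\<in>C1. of_bool (case c of (t', u') \<Rightarrow> b (CT t') = 0 \<and> b (CU t' u') = 0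
            \<and> b (MU t' u') = b (MU t u)) :: real)"
          using tu False by (intro of_bool_le_sum[OF fC1, of "(t', u')"]) (auto simp: C1_def ok1_def)
        also have "\<dots> = (\<Sum>c\<in>C1. h1 c b)" by (simp add: h1_def of_bool_conj case_prod_unfold)
        finally show ?thesis using nn by (auto simp: of_bool_def)
      qed
    qed (use nn in \<open>auto simp: of_bool_def\<close>)
    then have "Xi b t u v w * of_bool (E1 A b y t u) \<le> Xi b t u v w *
        (of_bool ((t, u, y) \<notin> A) + ((\<Sum>c\<in>C1. h1 c b) + (\<Sum>u'\<in>C2. h2 u' b)))"
      by (intro mult_left_mono Xi_nonneg)
    then show ?thesis
      by (simp only: distrib_left sum_distrib_left mult.commute[of "of_bool ((t, u, y) \<notin> A)"])
  qed simp
  have one: "Exp (\<lambda>b. Xi b t u v w) = 1"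
    using Exp_Xi[OF mem, of "\<lambda>_. 1"] by (simp add: indep_of_def Exp_const)
  have x1: "Exp (\<lambda>b. Xi b t u v w * h1 c b) \<le> 1 / (real KT * real KU * real M0)" if cC: "c \<in> C1" for c
  proof -
    obtain t' u' where c: "c = (t', u')" "t' \<in> ST" "u' \<in> SU" "t' \<noteq> t" using cC by (auto simp: C1_def)
    have "Exp (\<lambda>b. Xi b t u v w * h1 c b) = Exp (h1 c)"
      using c by (intro Exp_Xi mem) (auto simp: indep_of_def h1_def)
    also have "\<dots> = Exp (\<lambda>b. of_bool (b (MU t' u') = b (MU t u)) * 1) / real KU / real KT"
      unfolding h1_def c prod.case
      by (subst Exp_member, use c in simp, use c in \<open>force simp: indep_of_def\<close>)+ simp
    also have "\<dots> \<le> (Exp (\<lambda>_. 1) / real M0) / real KU / real KT"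
      using Exp_collision[of "MU t' u'" "MU t u" "\<lambda>_. 1"] c
      by (intro divide_right_mono) (auto simp: indep_of_def)
    also have "\<dots> = 1 / (real KT * real KU * real M0)" by (simp add: Exp_const mult_ac)
    finally show ?thesis .
  qed
  have x2: "Exp (\<lambda>b. Xi b t u v w * h2 u' b) \<le> 1 / (real KU * real M0)" if "u' \<in> C2" for u'
  proof -
    have c: "u' \<in> SU" "u' \<noteq> u" using that by (auto simp: C2_def)
    have "Exp (\<lambda>b. Xi b t u v w * h2 u' b) = Exp (h2 u')"
      using c by (intro Exp_Xi mem) (auto simp: indep_of_def h2_def)
    also have "\<dots> = Exp (\<lambda>b. of_bool (b (MU t u') = b (MU t u)) * 1) / real KU"
      unfolding h2_def
      by (subst Exp_member, use c mem in simp, use c in \<open>force simp: indep_of_def\<close>)+ simp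
    also have "\<dots> \<le> (Exp (\<lambda>_. 1) / real M0) / real KU"
      using Exp_collision[of "MU t u'" "MU t u" "\<lambda>_. 1"] c mem
      by (intro divide_right_mono) (auto simp: indep_of_def)
    also have "\<dots> = 1 / (real KU * real M0)" by (simp add: Exp_const mult_ac)
    finally show ?thesis .
  qed
  have "Exp (\<lambda>b. Xi b t u v w * of_bool (E1 A b y t u)) \<le> Exp (\<lambda>b. of_bool ((t, u, y) \<notin> A) * Xi b t u v w
      + ((\<Sum>c\<in>C1. Xi b t u v w * h1 c b) + (\<Sum>u'\<in>C2. Xi b t u v w * h2 u' b)))"
    by (intro Exp_mono pw)
  also have "\<dots> \<le> of_bool ((t, u, y) \<notin> A) + (NTU * (1 / (real KT * real KU * real M0)) + NU * (1 / (real KU * real M0)))"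
    unfolding Exp_add Exp_cmult one mult_1_right
    by (intro add_mono order_refl Exp_sum_indicator_le fC1 c1 x1 fC2 c2 x2) auto
  finally show ?thesis by simp
qed

text \<open>Competitors are sorted by the wrong components. A wrong t makes all five indices fresh,
  whether or not v' and w' agree with v and w. With t correct, a component that agrees contributes
  no factor, since its codeword and its bin are those actually in use.\<close>

lemma Exp_E2:
  assumes mem: "t \<in> ST" "u \<in> SU" "v \<in> SV" "w \<in> SW"
    and N1: "real (card {(t', v', w'). t' \<in> ST \<and> v' \<in> SV \<and> w' \<in> SW \<and> (t', v', w') \<in> A}) \<le> N1"
    and N2: "real (card {(v', w'). v' \<in> SV \<and> w' \<in> SW \<and> (t, v', w') \<in> A}) \<le> N2"
    and N3: "real (card {v'. v' \<in> SV \<and> (t, v', w) \<in> A}) \<le> N3"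
    and N4: "real (card {w'. w' \<in> SW \<and> (t, v, w') \<in> A}) \<le> N4"
  shows "Exp (\<lambda>b. Xi b t u v w * of_bool (E2 A b t v w))
     \<le> of_bool ((t, v, w) \<notin> A) + N1 / (real KT * real KV * real KW * real MX * real MY)
       + N2 / (real KV * real KW * real MX * real MY) + N3 / (real KV * real MX) + N4 / (real KW * real MY)"
proof -
  define C1 where "C1 = {(t', v', w'). t' \<in> ST \<and> v' \<in> SV \<and> w' \<in> SW \<and> (t', v', w') \<in> A \<and> t' \<noteq> t}"
  define C2 where "C2 = {(v', w'). v' \<in> SV \<and> w' \<in> SW \<and> (t, v', w') \<in> A \<and> v' \<noteq> v \<and> w' \<noteq> w}"
  define C3 where "C3 = {v'. v' \<in> SV \<and> (t, v', w) \<in> A \<and> v' \<noteq> v}"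
  define C4 where "C4 = {w'. w' \<in> SW \<and> (t, v, w') \<in> A \<and> w' \<noteq> w}"
  define h1 where "h1 = (\<lambda>(t', v', w') (b :: ('t,'u,'v,'w) idx \<Rightarrow> nat).
      of_bool (b (CT t') = 0) * (of_bool (b (CV t' v') = 0) * (of_bool (b (CW t' w') = 0)
      * (of_bool (b (MV t' v') = b (MV t v)) * (of_bool (b (MW t' w') = b (MW t w)) * (1::real))))))"
  define h2 where "h2 = (\<lambda>(v', w') (b :: ('t,'u,'v,'w) idx \<Rightarrow> nat).
      of_bool (b (CV t v') = 0) * (of_bool (b (CW t w') = 0)
      * (of_bool (b (MV t v') = b (MV t v)) * (of_bool (b (MW t w') = b (MW t w)) * (1::real)))))"
  define h3 where "h3 = (\<lambda>v' (b :: ('t,'u,'v,'w) idx \<Rightarrow> nat).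
      of_bool (b (CV t v') = 0) * (of_bool (b (MV t v') = b (MV t v)) * (1::real)))"
  define h4 where "h4 = (\<lambda>w' (b :: ('t,'u,'v,'w) idx \<Rightarrow> nat).
      of_bool (b (CW t w') = 0) * (of_bool (b (MW t w') = b (MW t w)) * (1::real)))"
  have sup1: "finite {(t', v', w'). t' \<in> ST \<and> v' \<in> SV \<and> w' \<in> SW \<and> (t', v', w') \<in> A}"
    by (rule finite_subset[where B = "ST \<times> SV \<times> SW"]) (use fin in auto)
  have sup2: "finite {(v', w'). v' \<in> SV \<and> w' \<in> SW \<and> (t, v', w') \<in> A}"
    by (rule finite_subset[where B = "SV \<times> SW"]) (use fin in auto)
  have fC1: "finite C1" by (rule finite_subset[OF _ sup1]) (auto simp: C1_def)
  have fC2: "finite C2" by (rule finite_subset[OF _ sup2]) (auto simp: C2_def)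
  have fC3: "finite C3" and fC4: "finite C4" using fin by (simp_all add: C3_def C4_def)
  have "card C1 \<le> card {(t', v', w'). t' \<in> ST \<and> v' \<in> SV \<and> w' \<in> SW \<and> (t', v', w') \<in> A}"
    using sup1 by (rule card_mono) (auto simp: C1_def)
  then have c1: "real (card C1) \<le> N1" using N1 by linarith
  have "card C2 \<le> card {(v', w'). v' \<in> SV \<and> w' \<in> SW \<and> (t, v', w') \<in> A}"
    using sup2 by (rule card_mono) (auto simp: C2_def)
  then have c2: "real (card C2) \<le> N2" using N2 by linarith
  have "card C3 \<le> card {v'. v' \<in> SV \<and> (t, v', w) \<in> A}"
    using fin by (intro card_mono) (auto simp: C3_def)
  then have c3: "real (card C3) \<le> N3" using N3 by linarith
  have "card C4 \<le> card {w'. w' \<in> SW \<and> (t, v, w') \<in> A}"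
    using fin by (intro card_mono) (auto simp: C4_def)
  then have c4: "real (card C4) \<le> N4" using N4 by linarith
  have pw: "Xi b t u v w * of_bool (E2 A b t v w) \<le> of_bool ((t, v, w) \<notin> A) * Xi b t u v w
      + ((\<Sum>c\<in>C1. Xi b t u v w * h1 c b) + ((\<Sum>c\<in>C2. Xi b t u v w * h2 c b)
      + ((\<Sum>c\<in>C3. Xi b t u v w * h3 c b) + (\<Sum>c\<in>C4. Xi b t u v w * h4 c b))))" for b
  proof (cases "Xi b t u v w = 0")
    case False
    then have inC: "b (CT t) = 0" "b (CV t v) = 0" "b (CW t w) = 0" by (auto simp: Xi_def xi_def split: if_splits)
    have nn: "0 \<le> (\<Sum>c\<in>C1. h1 c b)" "0 \<le> (\<Sum>c\<in>C2. h2 c b)" "0 \<le> (\<Sum>c\<in>C3. h3 c b)" "0 \<le> (\<Sum>c\<in>C4. h4 c b)"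
      by (auto intro!: sum_nonneg simp: h1_def h2_def h3_def h4_def)
    have "of_bool (E2 A b t v w) \<le> of_bool ((t, v, w) \<notin> A)
        + ((\<Sum>c\<in>C1. h1 c b) + ((\<Sum>c\<in>C2. h2 c b) + ((\<Sum>c\<in>C3. h3 c b) + (\<Sum>c\<in>C4. h4 c b))))"
    proof (cases "E2 A b t v w \<and> (t, v, w) \<in> A")
      case True
      then obtain t' v' w' where tvw: "(t', v', w') \<noteq> (t, v, w)" "ok2 A b (b (MV t v)) (b (MW t w)) t' v' w'"
        using inC mem unfolding E2_def by (auto simp: ok2_def)
      consider "t' \<noteq> t" | "t' = t" "v' \<noteq> v" "w' \<noteq> w" | "t' = t" "v' \<noteq> v" "w' = w" | "t' = t" "v' = v" "w' \<noteq> w"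
        using tvw(1) by blast
      then show ?thesis
      proof cases
        case 1
        have "1 \<le> (\<Sum>c\<in>C1. of_bool (case c of (t', v', w') \<Rightarrow> b (CT t') = 0 \<and> b (CV t' v') = 0 \<and> b (CW t' w') = 0
            \<and> b (MV t' v') = b (MV t v) \<and> b (MW t' w') = b (MW t w)) :: real)"
          using tvw 1 by (intro of_bool_le_sum[OF fC1, of "(t', v', w')"]) (auto simp: C1_def ok2_def)
        also have "\<dots> = (\<Sum>c\<in>C1. h1 c b)" by (simp add: h1_def of_bool_conj case_prod_unfold)
        finally show ?thesis using nn by (auto simp: of_bool_def)
      next
        case 2
        have "1 \<le> (\<Sum>c\<in>C2. of_bool (case c of (v', w') \<Rightarrow> b (CV t v') = 0 \<and> b (CW t w') = 0
            \<and> b (MV t v') = b (MV t v) \<and> b (MW t w') = b (MW t w)) :: real)"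
          using tvw 2 by (intro of_bool_le_sum[OF fC2, of "(v', w')"]) (auto simp: C2_def ok2_def)
        also have "\<dots> = (\<Sum>c\<in>C2. h2 c b)" by (simp add: h2_def of_bool_conj case_prod_unfold)
        finally show ?thesis using nn by (auto simp: of_bool_def)
      next
        case 3
        have "1 \<le> (\<Sum>v'\<in>C3. of_bool (b (CV t v') = 0 \<and> b (MV t v') = b (MV t v)) :: real)"
          using tvw 3 by (intro of_bool_le_sum[OF fC3, of v']) (auto simp: C3_def ok2_def)
        also have "\<dots> = (\<Sum>c\<in>C3. h3 c b)" by (simp add: h3_def of_bool_conj)
        finally show ?thesis using nn by (auto simp: of_bool_def)
      next
        case 4
        have "1 \<le> (\<Sum>w'\<in>C4. of_bool (b (CW t w') = 0 \<and> b (MW t w') = b (MW t w)) :: real)"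
          using tvw 4 by (intro of_bool_le_sum[OF fC4, of w']) (auto simp: C4_def ok2_def)
        also have "\<dots> = (\<Sum>c\<in>C4. h4 c b)" by (simp add: h4_def of_bool_conj)
        finally show ?thesis using nn by (auto simp: of_bool_def)
      qed
    qed (use nn in \<open>auto simp: of_bool_def\<close>)
    then have "Xi b t u v w * of_bool (E2 A b t v w) \<le> Xi b t u v w * (of_bool ((t, v, w) \<notin> A)
        + ((\<Sum>c\<in>C1. h1 c b) + ((\<Sum>c\<in>C2. h2 c b) + ((\<Sum>c\<in>C3. h3 c b) + (\<Sum>c\<in>C4. h4 c b)))))"
      by (intro mult_left_mono Xi_nonneg)
    then show ?thesis
      by (simp only: distrib_left sum_distrib_left mult.commute[of "of_bool ((t, v, w) \<notin> A)"])
  qed simp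
  have one: "Exp (\<lambda>b. Xi b t u v w) = 1"
    using Exp_Xi[OF mem, of "\<lambda>_. 1"] by (simp add: indep_of_def Exp_const)
  \<comment> \<open>The collision in the W-bins does not read \<open>MV t' v'\<close>, so the two
    collision bounds multiply.\<close>
  have coll2: "Exp (\<lambda>b. of_bool (b (MV t' v') = b (MV t v)) * (of_bool (b (MW t' w') = b (MW t w)) * 1)) \<le> 1 / (real MX * real MY)"
    if "t' \<in> ST" "v' \<in> SV" "w' \<in> SW" "t' \<noteq> t \<or> (v' \<noteq> v \<and> w' \<noteq> w)" for t' v' w'
  proof -
    have "Exp (\<lambda>b. of_bool (b (MV t' v') = b (MV t v)) * (of_bool (b (MW t' w') = b (MW t w)) * 1))
        \<le> Exp (\<lambda>b. of_bool (b (MW t' w') = b (MW t w)) * 1) / real MX"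
      using Exp_collision[of "MV t' v'" "MV t v" "\<lambda>b. of_bool (b (MW t' w') = b (MW t w)) * 1"] that
      by (auto simp: indep_of_def)
    also have "\<dots> \<le> (Exp (\<lambda>_. 1) / real MY) / real MX"
      using Exp_collision[of "MW t' w'" "MW t w" "\<lambda>_. 1"] that
      by (intro divide_right_mono) (auto simp: indep_of_def)
    finally show ?thesis by (simp add: Exp_const mult_ac)
  qed
  have x1: "Exp (\<lambda>b. Xi b t u v w * h1 c b) \<le> 1 / (real KT * real KV * real KW * real MX * real MY)" if cC: "c \<in> C1" for c
  proof -
    obtain t' v' w' where c: "c = (t', v', w')" "t' \<in> ST" "v' \<in> SV" "w' \<in> SW" "t' \<noteq> t"
      using cC by (auto simp: C1_def)
    have "Exp (\<lambda>b. Xi b t u v w * h1 c b) = Exp (h1 c)"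
      using c by (intro Exp_Xi mem) (auto simp: indep_of_def h1_def)
    also have "\<dots> = Exp (\<lambda>b. of_bool (b (MV t' v') = b (MV t v)) * (of_bool (b (MW t' w') = b (MW t w)) * 1))
        / real KW / real KV / real KT"
      unfolding h1_def c prod.case
      by (subst Exp_member, use c in simp, use c in \<open>force simp: indep_of_def\<close>)+ simp
    also have "\<dots> \<le> (1 / (real MX * real MY)) / real KW / real KV / real KT"
      using c by (intro divide_right_mono coll2) auto
    finally show ?thesis by (simp add: mult_ac)
  qed
  have x2: "Exp (\<lambda>b. Xi b t u v w * h2 c b) \<le> 1 / (real KV * real KW * real MX * real MY)" if cC: "c \<in> C2" for c
  proof -
    obtain v' w' where c: "c = (v', w')" "v' \<in> SV" "w' \<in> SW" "v' \<noteq> v" "w' \<noteq> w"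
      using cC by (auto simp: C2_def)
    have "Exp (\<lambda>b. Xi b t u v w * h2 c b) = Exp (h2 c)"
      using c by (intro Exp_Xi mem) (auto simp: indep_of_def h2_def)
    also have "\<dots> = Exp (\<lambda>b. of_bool (b (MV t v') = b (MV t v)) * (of_bool (b (MW t w') = b (MW t w)) * 1))
        / real KW / real KV"
      unfolding h2_def c prod.case
      by (subst Exp_member, use c mem in simp, use c in \<open>force simp: indep_of_def\<close>)+ simp
    also have "\<dots> \<le> (1 / (real MX * real MY)) / real KW / real KV"
      using c mem by (intro divide_right_mono coll2) auto
    finally show ?thesis by (simp add: mult_ac)
  qed
  have x3: "Exp (\<lambda>b. Xi b t u v w * h3 v' b) \<le> 1 / (real KV * real MX)" if "v' \<in> C3" for v'
  proof -
    have c: "v' \<in> SV" "v' \<noteq> v" using that by (auto simp: C3_def)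
    have "Exp (\<lambda>b. Xi b t u v w * h3 v' b) = Exp (h3 v')"
      using c by (intro Exp_Xi mem) (auto simp: indep_of_def h3_def)
    also have "\<dots> = Exp (\<lambda>b. of_bool (b (MV t v') = b (MV t v)) * 1) / real KV"
      unfolding h3_def
      by (subst Exp_member, use c mem in simp, use c in \<open>force simp: indep_of_def\<close>)+ simp
    also have "\<dots> \<le> (Exp (\<lambda>_. 1) / real MX) / real KV"
      using Exp_collision[of "MV t v'" "MV t v" "\<lambda>_. 1"] c mem
      by (intro divide_right_mono) (auto simp: indep_of_def)
    finally show ?thesis by (simp add: Exp_const mult_ac)
  qed
  have x4: "Exp (\<lambda>b. Xi b t u v w * h4 w' b) \<le> 1 / (real KW * real MY)" if "w' \<in> C4" for w'
  proof -
    have c: "w' \<in> SW" "w' \<noteq> w" using that by (auto simp: C4_def)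
    have "Exp (\<lambda>b. Xi b t u v w * h4 w' b) = Exp (h4 w')"
      using c by (intro Exp_Xi mem) (auto simp: indep_of_def h4_def)
    also have "\<dots> = Exp (\<lambda>b. of_bool (b (MW t w') = b (MW t w)) * 1) / real KW"
      unfolding h4_def
      by (subst Exp_member, use c mem in simp, use c in \<open>force simp: indep_of_def\<close>)+ simp
    also have "\<dots> \<le> (Exp (\<lambda>_. 1) / real MY) / real KW"
      using Exp_collision[of "MW t w'" "MW t w" "\<lambda>_. 1"] c mem
      by (intro divide_right_mono) (auto simp: indep_of_def)
    finally show ?thesis by (simp add: Exp_const mult_ac)
  qed
  have "Exp (\<lambda>b. Xi b t u v w * of_bool (E2 A b t v w)) \<le> Exp (\<lambda>b. of_bool ((t, v, w) \<notin> A) * Xi b t u v w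
      + ((\<Sum>c\<in>C1. Xi b t u v w * h1 c b) + ((\<Sum>c\<in>C2. Xi b t u v w * h2 c b)
      + ((\<Sum>c\<in>C3. Xi b t u v w * h3 c b) + (\<Sum>c\<in>C4. Xi b t u v w * h4 c b)))))"
    by (intro Exp_mono pw)
  also have "\<dots> \<le> of_bool ((t, v, w) \<notin> A)
      + (N1 * (1 / (real KT * real KV * real KW * real MX * real MY))
      + (N2 * (1 / (real KV * real KW * real MX * real MY))
      + (N3 * (1 / (real KV * real MX)) + N4 * (1 / (real KW * real MY)))))"
    unfolding Exp_add Exp_cmult one mult_1_right
    by (intro add_mono order_refl Exp_sum_indicator_le fC1 c1 x1 fC2 c2 x2 fC3 c3 x3 fC4 c4 x4) auto
  finally show ?thesis by simp
qed

section \<open>From hash functions to deterministic codes\<close>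

definition cost where
  "cost A1 A2 b = (\<Sum>x\<in>SX. \<Sum>y\<in>SY. p x y * (\<Sum>t\<in>ST. tT b x t * (\<Sum>u\<in>SU. tU b x t u *
     (\<Sum>v\<in>SV. tV b x t v * (\<Sum>w\<in>SW. tW b t u y w * of_bool (E1 A1 b y t u \<or> E2 A2 b t v w))))))"

text \<open>In \<open>cost\<close> the variable w is drawn from the true (t, u), whereas the actual
  encoder uses its decoded pair. The two agree unless \<open>E1\<close> holds, and then
  \<open>cost\<close> already counts an error. \<open>derandomize\<close> finally replaces the
  random encoders.\<close>

lemma code_of_hash:
  fixes f :: "'x \<Rightarrow> 'y \<Rightarrow> 'f"
  assumes b: "b \<in> Fns"
    and fhat: "\<And>x y t u v w. x \<in> SX \<Longrightarrow> y \<in> SY \<Longrightarrow> t \<in> ST \<Longrightarrow> u \<in> SU \<Longrightarrow> v \<in> SV \<Longrightarrow> w \<in> SW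
      \<Longrightarrow> J x y t u v w \<noteq> 0 \<Longrightarrow> fhat t v w = f x y"
  shows "\<exists>phi0 phiX phiY psi. (\<forall>x\<in>SX. phi0 x < M0 \<and> phiX x < MX) \<and> (\<forall>y\<in>SY. \<forall>m. phiY y m < MY)
     \<and> (\<Sum>x\<in>SX. \<Sum>y\<in>SY. p x y * of_bool (psi (phiX x) (phiY y (phi0 x)) \<noteq> f x y)) \<le> cost A1 A2 b"
proof -
  obtain x0 where x0: "x0 \<in> SX" using p(2) by force
  obtain t0 where t0: "t0 \<in> ST" using kT(2)[OF x0] by force
  obtain u0 where u0: "u0 \<in> SU" using kU(2)[OF x0 t0] by force
  \<comment> \<open>The decoder of (t, u) is total, with default (t0, u0): the kernel for w must be
    a probability vector, and the bin of w must be in range, for every message.\<close>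
  have "\<exists>d. fst d \<in> ST \<and> snd d \<in> SU \<and> ((\<exists>t u. ok1 A1 b y m t u) \<longrightarrow> ok1 A1 b y m (fst d) (snd d))" for y m
  proof (cases "\<exists>t u. ok1 A1 b y m t u")
    case True
    then obtain t u where "ok1 A1 b y m t u" by blast
    then show ?thesis by (intro exI[of _ "(t, u)"]) (auto simp: ok1_def)
  next
    case False
    then show ?thesis using t0 u0 by (intro exI[of _ "(t0, u0)"]) auto
  qed
  then obtain dec1 where dec1: "\<And>y m. fst (dec1 y m) \<in> ST" "\<And>y m. snd (dec1 y m) \<in> SU"
      "\<And>y m t u. ok1 A1 b y m t u \<Longrightarrow> ok1 A1 b y m (fst (dec1 y m)) (snd (dec1 y m))" by metis
  define psi where "psi i j = (case (SOME (t, v, w). ok2 A2 b i j t v w) of (t, v, w) \<Rightarrow> fhat t v w)" for i j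
  define m where "m = (\<lambda>(t, u, v :: 'v). b (MU t u))"
  define c where "c = (\<lambda>x y (t, u :: 'u, v) w.
      of_bool (psi (b (MV t v)) (b (MW (fst (dec1 y (b (MU t u)))) w)) \<noteq> f x y) :: real)"
  define k1 where "k1 = (\<lambda>x (t, u, v). tT b x t * tU b x t u * tV b x t v)"
  define k2 where "k2 y j = tW b (fst (dec1 y j)) (snd (dec1 y j)) y" for y j
  \<comment> \<open>The first encoder chooses the triple (t, u, v), the second chooses w; what
    passes between them is the bin number of (t, u) alone.\<close>
  have "\<exists>g h. (\<forall>x\<in>SX. g x \<in> ST \<times> SU \<times> SV) \<and> (\<forall>y\<in>SY. \<forall>j. h y j \<in> SW) \<and>
      (\<Sum>x\<in>SX. \<Sum>y\<in>SY. p x y * c x y (g x) (h y (m (g x))))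
      \<le> (\<Sum>x\<in>SX. \<Sum>y\<in>SY. p x y * (\<Sum>a\<in>ST \<times> SU \<times> SV. k1 x a * (\<Sum>w\<in>SW. k2 y (m a) w * c x y a w)))"
  proof (rule derandomize)
    show "0 \<le> k1 x a" if "x \<in> SX" "a \<in> ST \<times> SU \<times> SV" for x a
      using that by (auto simp: k1_def intro!: mult_nonneg_nonneg tilted_nonneg)
    show "(\<Sum>a\<in>ST \<times> SU \<times> SV. k1 x a) = 1" if "x \<in> SX" for x
    proof -
      have "(\<Sum>a\<in>ST \<times> SU \<times> SV. k1 x a) = (\<Sum>t\<in>ST. \<Sum>u\<in>SU. \<Sum>v\<in>SV. tT b x t * tU b x t u * tV b x t v)"
        by (simp add: k1_def sum.cartesian_product case_prod_unfold)
      also have "\<dots> = 1" using that by (simp add: tilted_sum flip: sum_distrib_left)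
      finally show ?thesis .
    qed
    show "0 \<le> k2 y j w" if "y \<in> SY" "w \<in> SW" for y j w using that by (simp add: k2_def tilted_nonneg)
    show "(\<Sum>w\<in>SW. k2 y j w) = 1" if "y \<in> SY" for y j using that dec1 by (simp add: k2_def tilted_sum)
  qed (use fin in auto)
  then obtain g h where gh: "\<And>x. x \<in> SX \<Longrightarrow> g x \<in> ST \<times> SU \<times> SV" "\<And>y j. y \<in> SY \<Longrightarrow> h y j \<in> SW"
      and le: "(\<Sum>x\<in>SX. \<Sum>y\<in>SY. p x y * c x y (g x) (h y (m (g x))))
      \<le> (\<Sum>x\<in>SX. \<Sum>y\<in>SY. p x y * (\<Sum>a\<in>ST \<times> SU \<times> SV. k1 x a * (\<Sum>w\<in>SW. k2 y (m a) w * c x y a w)))"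
    by blast
  define phi0 where "phi0 x = m (g x)" for x
  define phiX where "phiX x = (case g x of (t, u, v) \<Rightarrow> b (MV t v))" for x
  define phiY where "phiY y j = b (MW (fst (dec1 y j)) (h y j))" for y j
  have key: "p x y * (tT b x t * tU b x t u * tV b x t v * (\<Sum>w\<in>SW. k2 y (b (MU t u)) w * c x y (t, u, v) w))
      \<le> p x y * (tT b x t * tU b x t u * tV b x t v *
         (\<Sum>w\<in>SW. tW b t u y w * of_bool (E1 A1 b y t u \<or> E2 A2 b t v w)))"
    if mem: "x \<in> SX" "y \<in> SY" "t \<in> ST" "u \<in> SU" "v \<in> SV" for x y t u v
  proof (cases "p x y = 0 \<or> tT b x t = 0 \<or> tU b x t u = 0 \<or> tV b x t v = 0")
    case False
    then have nz: "p x y \<noteq> 0" "kT x t \<noteq> 0" "kU x t u \<noteq> 0" "kV x t v \<noteq> 0"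
      by (auto simp: tT_def tU_def tV_def dest: tilt_neq_0)
    have "(\<Sum>w\<in>SW. k2 y (b (MU t u)) w * c x y (t, u, v) w)
       \<le> (\<Sum>w\<in>SW. tW b t u y w * of_bool (E1 A1 b y t u \<or> E2 A2 b t v w))"
    proof (cases "E1 A1 b y t u")
      case True
      \<comment> \<open>The kernels at the decoded and at the true pair may differ here, so both
        sides are compared with the total mass 1.\<close>
      have "(\<Sum>w\<in>SW. k2 y (b (MU t u)) w * c x y (t, u, v) w) \<le> (\<Sum>w\<in>SW. k2 y (b (MU t u)) w)"
        using mem(2) by (intro sum_mono) (auto simp: c_def k2_def tilted_nonneg)
      also have "\<dots> = 1" using mem dec1 by (simp add: k2_def tilted_sum)
      also have "1 = (\<Sum>w\<in>SW. tW b t u y w)" using mem by (simp add: tilted_sum)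
      finally show ?thesis using True by simp
    next
      case False
      then have "ok1 A1 b y (b (MU t u)) t u" by (auto simp: E1_def)
      from dec1(3)[OF this] have d: "dec1 y (b (MU t u)) = (t, u)"
        using False unfolding E1_def by (metis prod.collapse)
      show ?thesis
      proof (rule sum_mono)
        fix w assume w: "w \<in> SW"
        show "k2 y (b (MU t u)) w * c x y (t, u, v) w \<le> tW b t u y w * of_bool (E1 A1 b y t u \<or> E2 A2 b t v w)"
        proof (cases "E2 A2 b t v w \<or> tW b t u y w = 0")
          case True
          then show ?thesis using w by (auto simp: k2_def d c_def tilted_nonneg)
        next
          case nE: False
          then have ok: "ok2 A2 b (b (MV t v)) (b (MW t w)) t v w"
            and uniq: "\<And>t' v' w'. ok2 A2 b (b (MV t v)) (b (MW t w)) t' v' w' \<Longrightarrow> (t', v', w') = (t, v, w)"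
            unfolding E2_def by blast+
          have "(SOME (t', v', w'). ok2 A2 b (b (MV t v)) (b (MW t w)) t' v' w') = (t, v, w)"
            by (rule some_equality) (use ok uniq in auto)
          then have "psi (b (MV t v)) (b (MW t w)) = fhat t v w" by (simp add: psi_def)
          \<comment> \<open>Every factor of \<open>J\<close> is nonzero, because thinned kernels
            vanish wherever the ideal ones do.\<close>
          also have "\<dots> = f x y"
            using nz nE w mem by (intro fhat[of x y t u v w]) (auto simp: J_def tW_def dest: tilt_neq_0)
          finally have "c x y (t, u, v) w = 0" by (simp add: c_def d)
          then show ?thesis using w by (simp add: tilted_nonneg)
        qed
      qed
    qed
    then show ?thesis using mem p by (intro mult_left_mono mult_nonneg_nonneg tilted_nonneg) auto
  qed auto
  have "(\<Sum>x\<in>SX. \<Sum>y\<in>SY. p x y * of_bool (psi (phiX x) (phiY y (phi0 x)) \<noteq> f x y))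
      = (\<Sum>x\<in>SX. \<Sum>y\<in>SY. p x y * c x y (g x) (h y (m (g x))))"
    by (intro sum.cong refl) (simp add: c_def phiX_def phiY_def phi0_def m_def split: prod.splits)
  also note le
  also have "(\<Sum>x\<in>SX. \<Sum>y\<in>SY. p x y * (\<Sum>a\<in>ST \<times> SU \<times> SV. k1 x a * (\<Sum>w\<in>SW. k2 y (m a) w * c x y a w)))
     = (\<Sum>x\<in>SX. \<Sum>y\<in>SY. \<Sum>t\<in>ST. \<Sum>u\<in>SU. \<Sum>v\<in>SV. p x y * (tT b x t * tU b x t u * tV b x t v *
        (\<Sum>w\<in>SW. k2 y (b (MU t u)) w * c x y (t, u, v) w)))"
    unfolding sum.cartesian_product[symmetric] k1_def m_def prod.case sum_distrib_left[of "p _ _"]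
    by (simp add: sum.cartesian_product case_prod_unfold)
  also have "\<dots> \<le> (\<Sum>x\<in>SX. \<Sum>y\<in>SY. \<Sum>t\<in>ST. \<Sum>u\<in>SU. \<Sum>v\<in>SV. p x y * (tT b x t * tU b x t u * tV b x t v *
         (\<Sum>w\<in>SW. tW b t u y w * of_bool (E1 A1 b y t u \<or> E2 A2 b t v w))))"
    by (intro sum_mono key)
  also have "\<dots> = cost A1 A2 b"
    unfolding cost_def sum_distrib_left by (simp only: mult.assoc)
  finally have fin_le: "(\<Sum>x\<in>SX. \<Sum>y\<in>SY. p x y * of_bool (psi (phiX x) (phiY y (phi0 x)) \<noteq> f x y)) \<le> cost A1 A2 b" .
  have "phi0 x < M0 \<and> phiX x < MX" if "x \<in> SX" for x
    using gh(1)[OF that] Fns_less[OF b, of "MU _ _"] Fns_less[OF b, of "MV _ _"]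
    by (auto simp: phi0_def phiX_def m_def split: prod.splits)
  moreover have "phiY y j < MY" if "y \<in> SY" for y j
    using gh(2)[OF that, of j] dec1(1)[of y j] Fns_less[OF b, of "MW (fst (dec1 y j)) (h y j)"] by (simp add: phiY_def)
  ultimately show ?thesis using fin_le by blast
qed

text \<open>The mean of \<open>cost\<close> over all hash functions is bounded, and some hash
  function does not exceed the mean. Typical sets, competitor counts and heaviness thresholds are
  free parameters. The last four brackets are the price of thinning, the others the price of
  decoding.\<close>

theorem one_shot_code:
  fixes f :: "'x \<Rightarrow> 'y \<Rightarrow> 'f"
  assumes fhat: "\<And>x y t u v w. x \<in> SX \<Longrightarrow> y \<in> SY \<Longrightarrow> t \<in> ST \<Longrightarrow> u \<in> SU \<Longrightarrow> v \<in> SV \<Longrightarrow> w \<in> SW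
      \<Longrightarrow> J x y t u v w \<noteq> 0 \<Longrightarrow> fhat t v w = f x y"
    and tau: "0 \<le> \<tau>T" "0 \<le> \<tau>U" "0 \<le> \<tau>V" "0 \<le> \<tau>W"
    and NTU: "\<And>y. y \<in> SY \<Longrightarrow> real (card {(t', u'). t' \<in> ST \<and> u' \<in> SU \<and> (t', u', y) \<in> A1}) \<le> NTU"
    and NU: "\<And>t y. t \<in> ST \<Longrightarrow> y \<in> SY \<Longrightarrow> real (card {u'. u' \<in> SU \<and> (t, u', y) \<in> A1}) \<le> NU"
    and N1: "real (card {(t', v', w'). t' \<in> ST \<and> v' \<in> SV \<and> w' \<in> SW \<and> (t', v', w') \<in> A2}) \<le> N1"
    and N2: "\<And>t. t \<in> ST \<Longrightarrow> real (card {(v', w'). v' \<in> SV \<and> w' \<in> SW \<and> (t, v', w') \<in> A2}) \<le> N2"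
    and N3: "\<And>t w. t \<in> ST \<Longrightarrow> w \<in> SW \<Longrightarrow> real (card {v'. v' \<in> SV \<and> (t, v', w) \<in> A2}) \<le> N3"
    and N4: "\<And>t v. t \<in> ST \<Longrightarrow> v \<in> SV \<Longrightarrow> real (card {w'. w' \<in> SW \<and> (t, v, w') \<in> A2}) \<le> N4"
  shows "\<exists>phi0 phiX phiY psi. (\<forall>x\<in>SX. phi0 x < M0 \<and> phiX x < MX) \<and> (\<forall>y\<in>SY. \<forall>m. phiY y m < MY)
     \<and> (\<Sum>x\<in>SX. \<Sum>y\<in>SY. p x y * of_bool (psi (phiX x) (phiY y (phi0 x)) \<noteq> f x y))
      \<le> (Ex (\<lambda>x y t u v w. of_bool ((t, u, y) \<notin> A1))
          + NTU / (real KT * real KU * real M0) + NU / (real KU * real M0))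
        + (Ex (\<lambda>x y t u v w. of_bool ((t, v, w) \<notin> A2))
          + N1 / (real KT * real KV * real KW * real MX * real MY)
          + N2 / (real KV * real KW * real MX * real MY) + N3 / (real KV * real MX) + N4 / (real KW * real MY))
        + (2 * Ex (\<lambda>x y t u v w. of_bool (kW t u y w > \<tau>W)) + sqrt ((real KW - 1) * \<tau>W))
        + (2 * Ex (\<lambda>x y t u v w. of_bool (kV x t v > \<tau>V)) + sqrt ((real KV - 1) * \<tau>V))
        + (2 * Ex (\<lambda>x y t u v w. of_bool (kU x t u > \<tau>U)) + sqrt ((real KU - 1) * \<tau>U))
        + (2 * Ex (\<lambda>x y t u v w. of_bool (kT x t > \<tau>T)) + sqrt ((real KT - 1) * \<tau>T))"
    (is "\<exists>phi0 phiX phiY psi. _ \<and> _ \<and> _ \<le> (?A1 + ?e1 + ?e2) + (?A2 + ?e3 + ?e4 + ?e5 + ?e6) + ?dW + ?dV + ?dU + ?dT")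
proof -
  let ?B = "\<lambda>b y t u v w. of_bool (E1 A1 b y t u \<or> E2 A2 b t v w) :: real"
  have main: "Exp (\<lambda>b. Ex (\<lambda>x y t u v w. xi b (CT t) * (xi b (CU t u) * (xi b (CV t v) * (xi b (CW t w) * ?B b y t u v w)))))
     \<le> (?A1 + ?e1 + ?e2) + (?A2 + ?e3 + ?e4 + ?e5 + ?e6)"
  proof -
    have "Exp (\<lambda>b. xi b (CT t) * (xi b (CU t u) * (xi b (CV t v) * (xi b (CW t w) * ?B b y t u v w))))
       \<le> (of_bool ((t, u, y) \<notin> A1) + ?e1 + ?e2) + (of_bool ((t, v, w) \<notin> A2) + ?e3 + ?e4 + ?e5 + ?e6)"
      if "y \<in> SY" "t \<in> ST" "u \<in> SU" "v \<in> SV" "w \<in> SW" for y t u v w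
    proof -
      have "Exp (\<lambda>b. xi b (CT t) * (xi b (CU t u) * (xi b (CV t v) * (xi b (CW t w) * ?B b y t u v w))))
        \<le> Exp (\<lambda>b. Xi b t u v w * of_bool (E1 A1 b y t u) + Xi b t u v w * of_bool (E2 A2 b t v w))"
      proof (rule Exp_mono)
        fix b
        have "xi b (CT t) * (xi b (CU t u) * (xi b (CV t v) * (xi b (CW t w) * ?B b y t u v w)))
           = Xi b t u v w * ?B b y t u v w" by (simp add: Xi_def)
        also have "\<dots> \<le> Xi b t u v w * (of_bool (E1 A1 b y t u) + of_bool (E2 A2 b t v w))"
          by (intro mult_left_mono Xi_nonneg) auto
        finally show "xi b (CT t) * (xi b (CU t u) * (xi b (CV t v) * (xi b (CW t w) * ?B b y t u v w)))
          \<le> Xi b t u v w * of_bool (E1 A1 b y t u) + Xi b t u v w * of_bool (E2 A2 b t v w)"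
          by (simp only: distrib_left)
      qed
      also have "\<dots> \<le> (of_bool ((t, u, y) \<notin> A1) + ?e1 + ?e2) + (of_bool ((t, v, w) \<notin> A2) + ?e3 + ?e4 + ?e5 + ?e6)"
        unfolding Exp_add using that by (intro add_mono Exp_E1 Exp_E2 NTU NU N1 N2 N3 N4)
      finally show ?thesis .
    qed
    then have "Exp (\<lambda>b. Ex (\<lambda>x y t u v w. xi b (CT t) * (xi b (CU t u) * (xi b (CV t v) * (xi b (CW t w) * ?B b y t u v w)))))
       \<le> Ex (\<lambda>x y t u v w. (of_bool ((t, u, y) \<notin> A1) + ?e1 + ?e2) + (of_bool ((t, v, w) \<notin> A2) + ?e3 + ?e4 + ?e5 + ?e6))"
      unfolding Exp_Ex by (intro Ex_mono) blast
    then show ?thesis unfolding Ex_add Ex_const .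
  qed
  have "Exp (\<lambda>b. cost A1 A2 b) \<le> Exp (\<lambda>b.
      Ex (\<lambda>x y t u v w. xi b (CT t) * (xi b (CU t u) * (xi b (CV t v) * (xi b (CW t w) * ?B b y t u v w))))
    + (\<Sum>x\<in>SX. \<Sum>y\<in>SY. \<Sum>t\<in>ST. \<Sum>u\<in>SU. \<Sum>v\<in>SV. (p x y * kT x t * kU x t u * kV x t v)
         * (xi b (CT t) * (xi b (CU t u) * (xi b (CV t v) * dW b t u y))))
    + (\<Sum>x\<in>SX. \<Sum>y\<in>SY. \<Sum>t\<in>ST. \<Sum>u\<in>SU. (p x y * kT x t * kU x t u)
         * (xi b (CT t) * (xi b (CU t u) * dV b x t)))
    + (\<Sum>x\<in>SX. \<Sum>y\<in>SY. \<Sum>t\<in>ST. (p x y * kT x t) * (xi b (CT t) * dU b x t))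
    + (\<Sum>x\<in>SX. \<Sum>y\<in>SY. p x y * dT b x))"
    unfolding cost_def by (intro Exp_mono tilted_cost_le) auto
  also have "\<dots> \<le> (?A1 + ?e1 + ?e2) + (?A2 + ?e3 + ?e4 + ?e5 + ?e6) + ?dW + ?dV + ?dU + ?dT"
    unfolding Exp_add using tau
    by (intro add_mono main Exp_sum_dW[unfolded slack_def] Exp_sum_dV[unfolded slack_def]
        Exp_sum_dU[unfolded slack_def] Exp_sum_dT[unfolded slack_def])
  finally have le: "Exp (cost A1 A2) \<le> (?A1 + ?e1 + ?e2) + (?A2 + ?e3 + ?e4 + ?e5 + ?e6) + ?dW + ?dV + ?dU + ?dT" .
  obtain b where b: "b \<in> Fns" "cost A1 A2 b \<le> Exp (cost A1 A2)" using exists_le_Exp by blast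
  have "\<exists>phi0 phiX phiY psi. (\<forall>x\<in>SX. phi0 x < M0 \<and> phiX x < MX) \<and> (\<forall>y\<in>SY. \<forall>m. phiY y m < MY)
     \<and> (\<Sum>x\<in>SX. \<Sum>y\<in>SY. p x y * of_bool (psi (phiX x) (phiY y (phi0 x)) \<noteq> f x y)) \<le> cost A1 A2 b"
    by (rule code_of_hash[OF b(1), where fhat = fhat]) (rule fhat)
  then obtain phi0 phiX phiY psi where c: "\<forall>x\<in>SX. phi0 x < M0 \<and> phiX x < MX" "\<forall>y\<in>SY. \<forall>m. phiY y m < MY"
     "(\<Sum>x\<in>SX. \<Sum>y\<in>SY. p x y * of_bool (psi (phiX x) (phiY y (phi0 x)) \<noteq> f x y)) \<le> cost A1 A2 b"
    by blast
  show ?thesis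
    by (intro exI[of _ phi0] exI[of _ phiX] exI[of _ phiY] exI[of _ psi] conjI c(1,2))
      (use c(3) b(2) le in linarith)
qed

end

section \<open>Reweighting and the cardinality bounds\<close>

abbreviation pair_rv :: "('o \<Rightarrow> 'a) \<Rightarrow> ('o \<Rightarrow> 'b) \<Rightarrow> 'o \<Rightarrow> 'a \<times> 'b" (infixr "&&" 70) where
  "A && B \<equiv> (\<lambda>\<omega>. (A \<omega>, B \<omega>))"

section \<open>Linear algebra: underdetermined systems and small supports\<close>

lemma exists_nontrivial_kernel:
  fixes g :: "'j \<Rightarrow> 'i \<Rightarrow> real"
  assumes "finite J" "finite I" "card J < card I"
  shows "\<exists>d. (\<exists>i\<in>I. d i \<noteq> 0) \<and> (\<forall>j\<in>J. (\<Sum>i\<in>I. d i * g j i) = 0)"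
  using assms
proof (induction J arbitrary: I g rule: finite_induct)
  case empty
  then have "I \<noteq> {}" by auto
  then show ?case by (intro exI[of _ "\<lambda>_. 1"]) auto
next
  case (insert j0 J)
  show ?case
  proof (cases "\<forall>i\<in>I. g j0 i = 0")
    case True
    have "card J < card I" using insert by simp
    from insert.IH[OF insert.prems(1) this, of g] obtain d
      where "\<exists>i\<in>I. d i \<noteq> 0" "\<forall>j\<in>J. (\<Sum>i\<in>I. d i * g j i) = 0" by blast
    then show ?thesis using True by (intro exI[of _ d]) auto
  next
    case False
    then obtain i0 where i0: "i0 \<in> I" "g j0 i0 \<noteq> 0" by blast
    let ?I = "I - {i0}"
    \<comment> \<open>Gaussian elimination of the pivot \<open>i0\<close> from the other equations;
      its coordinate is restored afterwards so that equation \<open>j0\<close> holds as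
      well.\<close>
    let ?g = "\<lambda>j i. g j i - g j0 i * g j i0 / g j0 i0"
    have "finite ?I" "card J < card ?I" using insert i0 by auto
    from insert.IH[OF this, of ?g] obtain d
      where d: "\<exists>i\<in>?I. d i \<noteq> 0" "\<forall>j\<in>J. (\<Sum>i\<in>?I. d i * ?g j i) = 0" by blast
    define s where "s = (\<Sum>i\<in>?I. d i * g j0 i)"
    define d' where "d' i = (if i = i0 then - s / g j0 i0 else d i)" for i
    have sum: "(\<Sum>i\<in>I. d' i * g j i) = - s / g j0 i0 * g j i0 + (\<Sum>i\<in>?I. d i * g j i)" for j
      using sum.remove[OF insert.prems(1) i0(1), of "\<lambda>i. d' i * g j i"] by (simp add: d'_def)
    have "(\<Sum>i\<in>I. d' i * g j i) = 0" if "j \<in> insert j0 J" for j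
    proof (cases "j = j0")
      case True
      then show ?thesis unfolding sum using i0 by (simp add: s_def)
    next
      case False
      then have "(\<Sum>i\<in>?I. d i * ?g j i) = 0" using that d by blast
      moreover have "(\<Sum>i\<in>?I. d i * ?g j i) = (\<Sum>i\<in>?I. d i * g j i) - s * (g j i0 / g j0 i0)"
        unfolding s_def sum_distrib_right by (simp add: algebra_simps sum_subtractf)
      ultimately show ?thesis unfolding sum by simp
    qed
    moreover have "\<exists>i\<in>I. d' i \<noteq> 0" using d(1) by (auto simp: d'_def)
    ultimately show ?thesis by blast
  qed
qed

text \<open>Vertices of a bounded polytope: the extra functional \<open>h\<close> is minimised rather than
  preserved, which is why it does not count towards the size of the support.\<close>
lemma caratheodory_min:
  fixes g :: "'j \<Rightarrow> 'i \<Rightarrow> real" and h q :: "'i \<Rightarrow> real"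
  assumes J: "finite J" and I: "finite I"
    and c: "\<And>i. i \<in> I \<Longrightarrow> (\<Sum>j\<in>J. c j * g j i) > 0"
    and q: "\<And>i. 0 \<le> q i"
  shows "\<exists>q'. (\<forall>i. 0 \<le> q' i) \<and> (\<forall>j\<in>J. (\<Sum>i\<in>I. q' i * g j i) = (\<Sum>i\<in>I. q i * g j i))
     \<and> (\<Sum>i\<in>I. q' i * h i) \<le> (\<Sum>i\<in>I. q i * h i) \<and> card {i\<in>I. q' i > 0} \<le> card J"
  using q
proof (induction "card {i\<in>I. q i > 0}" arbitrary: q rule: less_induct)
  case less
  show ?case
  proof (cases "card {i\<in>I. q i > 0} \<le> card J")
    case True
    then show ?thesis using less.prems by (intro exI[of _ q]) auto
  next
    case False
    define S where "S = {i\<in>I. q i > 0}"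
    have S: "finite S" "card J < card S" using I False by (auto simp: S_def)
    from exists_nontrivial_kernel[OF J S, of g] obtain d0 where
      d0: "\<exists>i\<in>S. d0 i \<noteq> 0" "\<forall>j\<in>J. (\<Sum>i\<in>S. d0 i * g j i) = 0" by blast
    \<comment> \<open>The sign orients the direction so that moving along it does not increase
      \<open>h\<close>.\<close>
    define \<sigma> :: real where "\<sigma> = (if (\<Sum>i\<in>S. d0 i * h i) \<le> 0 then 1 else -1)"
    define d where "d i = \<sigma> * d0 i" for i
    have sg: "(\<Sum>i\<in>S. d i * k i) = \<sigma> * (\<Sum>i\<in>S. d0 i * k i)" for k
      by (simp add: d_def sum_distrib_left mult.assoc)
    have dh: "(\<Sum>i\<in>S. d i * h i) \<le> 0" unfolding sg by (auto simp: \<sigma>_def)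
    have dg: "(\<Sum>i\<in>S. d i * g j i) = 0" if "j \<in> J" for j unfolding sg using d0 that by auto
    have dn: "\<exists>i\<in>S. d i \<noteq> 0" using d0(1) by (auto simp: d_def \<sigma>_def)
    \<comment> \<open>Hypothesis \<open>c\<close> bounds the polytope: a nonzero direction without
      negative entries would have a positive value under the combination \<open>c\<close>, yet the
      preserved functionals all vanish on it.\<close>
    have "\<exists>i\<in>S. d i < 0"
    proof (rule ccontr)
      assume "\<not> ?thesis"
      then have nn: "\<And>i. i \<in> S \<Longrightarrow> 0 \<le> d i" by force
      have cpos: "(\<Sum>j\<in>J. c j * g j i) > 0" if "i \<in> S" for i using c that by (auto simp: S_def)
      obtain i1 where i1: "i1 \<in> S" "d i1 > 0" using dn nn by force
      have "0 < (\<Sum>i\<in>S. d i * (\<Sum>j\<in>J. c j * g j i))"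
        using S(1) i1(1)
      proof (rule sum_pos2)
        show "0 < d i1 * (\<Sum>j\<in>J. c j * g j i1)" using i1 cpos by simp
        show "0 \<le> d i * (\<Sum>j\<in>J. c j * g j i)" if "i \<in> S" for i
          using that nn cpos by (intro mult_nonneg_nonneg) (auto intro: less_imp_le)
      qed
      also have "\<dots> = (\<Sum>j\<in>J. c j * (\<Sum>i\<in>S. d i * g j i))"
        unfolding sum_distrib_left by (subst sum.swap) (simp add: mult_ac)
      also have "\<dots> = 0" using dg by simp
      finally show False by simp
    qed
    then have ne: "{i\<in>S. d i < 0} \<noteq> {}" by blast
    \<comment> \<open>The longest step that keeps all weights nonnegative. It brings the weight at
      \<open>i2\<close> to zero, and no weight outside \<open>S\<close> is touched, so the support
      shrinks strictly.\<close>
    define \<theta> where "\<theta> = Min ((\<lambda>i. q i / - d i) ` {i\<in>S. d i < 0})"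
    have "\<theta> \<in> (\<lambda>i. q i / - d i) ` {i\<in>S. d i < 0}"
      unfolding \<theta>_def using S ne by (intro Min_in) auto
    then obtain i2 where i2: "i2 \<in> S" "d i2 < 0" "\<theta> = q i2 / - d i2" by blast
    have \<theta>0: "0 \<le> \<theta>" using i2 less.prems by (simp add: divide_nonneg_neg)
    have \<theta>le: "\<theta> \<le> q i / - d i" if "i \<in> S" "d i < 0" for i
      unfolding \<theta>_def using S that by (intro Min_le) auto
    define q1 where "q1 i = (if i \<in> S then q i + \<theta> * d i else q i)" for i
    have q1: "0 \<le> q1 i" for i
    proof (cases "i \<in> S \<and> d i < 0")
      case True
      then show ?thesis using \<theta>le[of i] by (simp add: q1_def field_simps)
    next
      case False
      then show ?thesis using less.prems[of i] \<theta>0 by (auto simp: q1_def intro!: add_nonneg_nonneg mult_nonneg_nonneg)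
    qed
    have q1sum: "(\<Sum>i\<in>I. q1 i * k i) = (\<Sum>i\<in>I. q i * k i) + \<theta> * (\<Sum>i\<in>S. d i * k i)" for k
    proof -
      have "(\<Sum>i\<in>I. q1 i * k i) = (\<Sum>i\<in>I. q i * k i + (if i \<in> S then \<theta> * (d i * k i) else 0))"
        by (intro sum.cong) (auto simp: q1_def algebra_simps)
      also have "\<dots> = (\<Sum>i\<in>I. q i * k i) + (\<Sum>i\<in>S. \<theta> * (d i * k i))"
        unfolding sum.distrib using I by (subst sum.inter_restrict[symmetric]) (auto simp: S_def intro!: sum.cong)
      finally show ?thesis by (simp add: sum_distrib_left)
    qed
    have "{i\<in>I. q1 i > 0} \<subset> {i\<in>I. q i > 0}"
    proof
      show "{i\<in>I. q1 i > 0} \<subseteq> {i\<in>I. q i > 0}"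
        using less.prems by (auto simp: q1_def S_def order_le_less split: if_splits)
      have "q1 i2 = 0" using i2 by (simp add: q1_def field_simps)
      then show "{i\<in>I. q1 i > 0} \<noteq> {i\<in>I. q i > 0}" using i2 unfolding S_def by force
    qed
    then have "card {i\<in>I. q1 i > 0} < card {i\<in>I. q i > 0}" using I by (intro psubset_card_mono) auto
    from less.hyps[OF this q1] obtain q' where q': "\<forall>i. 0 \<le> q' i"
      "\<forall>j\<in>J. (\<Sum>i\<in>I. q' i * g j i) = (\<Sum>i\<in>I. q1 i * g j i)"
      "(\<Sum>i\<in>I. q' i * h i) \<le> (\<Sum>i\<in>I. q1 i * h i)" "card {i\<in>I. q' i > 0} \<le> card J" by blast
    have "(\<Sum>i\<in>I. q1 i * h i) \<le> (\<Sum>i\<in>I. q i * h i)"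
      unfolding q1sum using dh \<theta>0 by (simp add: mult_nonneg_nonpos)
    then show ?thesis using q' dg q1sum by (intro exI[of _ q']) auto
  qed
qed

section \<open>Marginals, entropies and Markov chains of finitely supported laws\<close>

lemma pmf_map_sum:
  assumes "finite (set_pmf Q)"
  shows "pmf (map_pmf g Q) z = (\<Sum>\<omega>\<in>set_pmf Q. pmf Q \<omega> * of_bool (g \<omega> = z))"
proof -
  have "pmf (map_pmf g Q) z = measure_pmf.prob Q ((g -` {z}) \<inter> set_pmf Q)"
    by (simp add: pmf_map measure_Int_set_pmf)
  also have "\<dots> = (\<Sum>\<omega>\<in>(g -` {z}) \<inter> set_pmf Q. pmf Q \<omega>)"
    using assms by (intro measure_measure_pmf_finite) auto
  also have "\<dots> = (\<Sum>\<omega>\<in>set_pmf Q. pmf Q \<omega> * of_bool (g \<omega> = z))"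
    using assms by (intro sum.mono_neutral_cong_left) auto
  finally show ?thesis .
qed

lemma prob_eq_pmf_map: "measure_pmf.prob Q {\<omega>. g \<omega> = z} = pmf (map_pmf g Q) z"
  by (simp add: pmf_map vimage_def)

lemma sum_pmf_map:
  assumes "finite (set_pmf Q)"
  shows "(\<Sum>\<omega>\<in>set_pmf Q. pmf Q \<omega> * h (g \<omega>)) = (\<Sum>z\<in>set_pmf (map_pmf g Q). pmf (map_pmf g Q) z * (h z :: real))"
proof -
  have "(\<Sum>\<omega>\<in>set_pmf Q. pmf Q \<omega> * h (g \<omega>))
      = (\<Sum>z\<in>g ` set_pmf Q. \<Sum>\<omega>\<in>{\<omega>\<in>set_pmf Q. g \<omega> = z}. pmf Q \<omega> * h (g \<omega>))"
    by (rule sum.image_gen[OF assms])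
  also have "\<dots> = (\<Sum>z\<in>g ` set_pmf Q. pmf (map_pmf g Q) z * h z)"
  proof (intro sum.cong refl)
    fix z
    have "pmf (map_pmf g Q) z * h z = (\<Sum>\<omega>\<in>set_pmf Q. if g \<omega> = z then pmf Q \<omega> * h z else 0)"
      unfolding pmf_map_sum[OF assms] sum_distrib_right by (intro sum.cong) auto
    also have "\<dots> = (\<Sum>\<omega>\<in>{\<omega>\<in>set_pmf Q. g \<omega> = z}. pmf Q \<omega> * h z)"
      using assms by (simp add: sum.inter_filter)
    finally show "(\<Sum>\<omega>\<in>{\<omega>\<in>set_pmf Q. g \<omega> = z}. pmf Q \<omega> * h (g \<omega>)) = pmf (map_pmf g Q) z * h z" by simp
  qed
  finally show ?thesis by simp
qed

text \<open>Log-likelihood pulled back to the sample space, so that entropies of different variables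
  become sums over one support and can be subtracted term by term.\<close>

definition lp :: "'o pmf \<Rightarrow> ('o \<Rightarrow> 'a) \<Rightarrow> 'o \<Rightarrow> real" where
  "lp Q g \<omega> = log 2 (pmf (map_pmf g Q) (g \<omega>))"

lemma ent_eq_sum_lp:
  assumes "finite (set_pmf Q)"
  shows "ent Q g = - (\<Sum>\<omega>\<in>set_pmf Q. pmf Q \<omega> * lp Q g \<omega>)"
  unfolding ent_def lp_def sum_pmf_map[OF assms, of "\<lambda>z. log 2 (pmf (map_pmf g Q) z)"] ..

lemma pmf_map_pos: "\<omega> \<in> set_pmf Q \<Longrightarrow> 0 < pmf (map_pmf g Q) (g \<omega>)"
  by (simp add: pmf_positive)

text \<open>Entropy depends only on the partition of the support into fibres. This serves to
  reorder, regroup and pad tuples.\<close>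

lemma ent_cong:
  assumes "finite (set_pmf Q)"
    and "\<And>\<omega> \<omega>'. \<omega> \<in> set_pmf Q \<Longrightarrow> \<omega>' \<in> set_pmf Q \<Longrightarrow> g \<omega> = g \<omega>' \<longleftrightarrow> k \<omega> = k \<omega>'"
  shows "ent Q g = ent Q k"
proof -
  have "lp Q g \<omega> = lp Q k \<omega>" if "\<omega> \<in> set_pmf Q" for \<omega>
    unfolding lp_def pmf_map_sum[OF assms(1)]
    using assms(2)[OF _ that] by (intro arg_cong[where f = "log 2"] sum.cong) auto
  then show ?thesis unfolding ent_eq_sum_lp[OF assms(1)] by simp
qed

lemma markov_pmf:
  "markov Q A B C \<longleftrightarrow> (\<forall>a b c.
      pmf (map_pmf (A && B && C) Q) (a, b, c) * pmf (map_pmf B Q) b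
    = pmf (map_pmf (A && B) Q) (a, b) * pmf (map_pmf (B && C) Q) (b, c))"
  unfolding markov_def prob_eq_pmf_map[symmetric] by simp

lemma markov_commute: "markov Q A B C \<longleftrightarrow> markov Q C B A"
  unfolding markov_def by (auto simp: conj_ac mult.commute)

text \<open>The average of the logarithm of the Markov identity; on the support all four
  probabilities are positive.\<close>

lemma ent_markov:
  assumes "finite (set_pmf Q)" "markov Q A B C"
  shows "ent Q (A && B && C) + ent Q B = ent Q (A && B) + ent Q (B && C)"
proof -
  have "lp Q (A && B && C) \<omega> + lp Q B \<omega> = lp Q (A && B) \<omega> + lp Q (B && C) \<omega>"
    if "\<omega> \<in> set_pmf Q" for \<omega>
    unfolding lp_def
    using assms(2)[unfolded markov_pmf, rule_format, of "A \<omega>" "B \<omega>" "C \<omega>"]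
      pmf_map_pos[OF that, of "A && B && C"] pmf_map_pos[OF that, of B]
      pmf_map_pos[OF that, of "A && B"] pmf_map_pos[OF that, of "B && C"]
    by (simp flip: log_mult_pos)
  then have "(\<Sum>\<omega>\<in>set_pmf Q. pmf Q \<omega> * (lp Q (A && B && C) \<omega> + lp Q B \<omega>))
      = (\<Sum>\<omega>\<in>set_pmf Q. pmf Q \<omega> * (lp Q (A && B) \<omega> + lp Q (B && C) \<omega>))" by simp
  then show ?thesis
    unfolding ent_eq_sum_lp[OF assms(1)] distrib_left sum.distrib by simp
qed

lemma pmf_map_image_sum:
  assumes f: "finite (set_pmf R)"
  shows "pmf (map_pmf (\<lambda>\<omega>. (h (B \<omega>), C \<omega>)) R) (b, c)
     = (\<Sum>a\<in>B ` set_pmf R. of_bool (h a = b) * pmf (map_pmf (B && C) R) (a, c))"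
proof -
  have "(\<Sum>a\<in>B ` set_pmf R. of_bool (h a = b) * pmf (map_pmf (B && C) R) (a, c))
     = (\<Sum>\<omega>\<in>set_pmf R. \<Sum>a\<in>B ` set_pmf R. of_bool (h a = b) * (pmf R \<omega> * of_bool ((B \<omega>, C \<omega>) = (a, c))))"
    unfolding pmf_map_sum[OF f] sum_distrib_left by (rule sum.swap)
  also have "\<dots> = (\<Sum>\<omega>\<in>set_pmf R. pmf R \<omega> * of_bool ((h (B \<omega>), C \<omega>) = (b, c)))"
  proof (intro sum.cong refl)
    fix \<omega> assume w: "\<omega> \<in> set_pmf R"
    have "(\<Sum>a\<in>B ` set_pmf R. of_bool (h a = b) * (pmf R \<omega> * of_bool ((B \<omega>, C \<omega>) = (a, c))))
       = (\<Sum>a\<in>B ` set_pmf R. if a = B \<omega> then pmf R \<omega> * of_bool ((h (B \<omega>), C \<omega>) = (b, c)) else 0)"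
      by (intro sum.cong) auto
    then show "(\<Sum>a\<in>B ` set_pmf R. of_bool (h a = b) * (pmf R \<omega> * of_bool ((B \<omega>, C \<omega>) = (a, c))))
        = pmf R \<omega> * of_bool ((h (B \<omega>), C \<omega>) = (b, c))"
      using f w by (simp add: sum.delta)
  qed
  finally show ?thesis by (simp add: pmf_map_sum[OF f])
qed

lemma pmf_map_fst_sum:
  assumes f: "finite (set_pmf R)"
  shows "pmf (map_pmf C R) c = (\<Sum>a\<in>B ` set_pmf R. pmf (map_pmf (B && C) R) (a, c))"
  using pmf_map_image_sum[OF f, of "\<lambda>_. ()" B C "()" c] by (simp add: pmf_map_sum[OF f])

text \<open>Both sides of the Markov identity are linear in the probabilities involving the left
  variable, so the identity may be summed over a fibre of \<open>h\<close>.\<close>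

lemma markov_map_left:
  assumes f: "finite (set_pmf Q)" and m: "markov Q A B C"
  shows "markov Q (\<lambda>\<omega>. h (A \<omega>)) B C"
  unfolding markov_pmf pmf_map_image_sum[OF f, of h A] sum_distrib_right mult.assoc
  using m unfolding markov_pmf by simp

lemma markov_map:
  assumes f: "finite (set_pmf Q)" and m: "markov Q A B C"
  shows "markov Q (\<lambda>\<omega>. h (A \<omega>)) B (\<lambda>\<omega>. k (C \<omega>))"
proof -
  have "markov Q C B (\<lambda>\<omega>. h (A \<omega>))"
    by (rule iffD1[OF markov_commute markov_map_left[OF f m]])
  from markov_map_left[OF f this, of k] show ?thesis by (rule iffD1[OF markov_commute])
qed

section \<open>Laws reweighted by a function of one variable\<close>

lemma reweight_exists:
  assumes fin: "finite (set_pmf Q)" and r: "\<And>a. 0 \<le> r a"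
    and one: "(\<Sum>\<omega>\<in>set_pmf Q. pmf Q \<omega> * r (A \<omega>)) = 1"
  shows "\<exists>Q'. \<forall>\<omega>. pmf Q' \<omega> = pmf Q \<omega> * r (A \<omega>)"
proof -
  have "(\<integral>\<^sup>+ \<omega>. ennreal (pmf Q \<omega> * r (A \<omega>)) \<partial>count_space UNIV)
      = (\<Sum>\<omega>\<in>set_pmf Q. ennreal (pmf Q \<omega> * r (A \<omega>)))"
    using fin by (intro nn_integral_count_space') (auto simp: set_pmf_iff)
  also have "\<dots> = 1" using r one by (simp add: sum_ennreal)
  finally show ?thesis
    using r by (intro exI[of _ "embed_pmf (\<lambda>\<omega>. pmf Q \<omega> * r (A \<omega>))"]) (simp add: pmf_embed_pmf)
qed

locale reweighting =
  fixes Q Q' :: "'o pmf" and A :: "'o \<Rightarrow> 'a" and r :: "'a \<Rightarrow> real"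
  assumes fin: "finite (set_pmf Q)" and r: "\<And>a. 0 \<le> r a"
    and pmf': "\<And>\<omega>. pmf Q' \<omega> = pmf Q \<omega> * r (A \<omega>)"
begin

lemma set_subset: "set_pmf Q' \<subseteq> set_pmf Q"
  using pmf' by (auto simp: set_pmf_iff)

lemma fin': "finite (set_pmf Q')"
  using fin set_subset by (rule finite_subset[rotated])

lemma sum': "(\<Sum>\<omega>\<in>set_pmf Q'. pmf Q' \<omega> * h \<omega>) = (\<Sum>\<omega>\<in>set_pmf Q. pmf Q' \<omega> * (h \<omega> :: real))"
  using fin set_subset by (intro sum.mono_neutral_left) (auto simp: set_pmf_iff)

lemma pmf_map':
  assumes "\<And>\<omega>. A \<omega> = \<pi> (g \<omega>)"
  shows "pmf (map_pmf g Q') z = pmf (map_pmf g Q) z * r (\<pi> z)"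
  unfolding pmf_map_sum[OF fin'] sum' pmf_map_sum[OF fin] sum_distrib_right
  by (intro sum.cong) (auto simp: pmf' assms)

text \<open>Both \<open>g\<close> and \<open>k\<close> determine \<open>A\<close>, so at every
  outcome both marginals acquire the same factor, which cancels in the log-ratio. The entropy
  difference becomes linear in \<open>Q'\<close>, with coefficients taken from
  \<open>Q\<close>.\<close>

lemma ent_diff':
  assumes "\<And>\<omega>. A \<omega> = \<pi> (g \<omega>)" "\<And>\<omega>. A \<omega> = \<pi>' (k \<omega>)"
  shows "ent Q' g - ent Q' k = (\<Sum>\<omega>\<in>set_pmf Q. pmf Q' \<omega> * (lp Q k \<omega> - lp Q g \<omega>))"
proof -
  have "lp Q' k \<omega> - lp Q' g \<omega> = lp Q k \<omega> - lp Q g \<omega>" if "\<omega> \<in> set_pmf Q'" for \<omega>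
  proof -
    have "\<omega> \<in> set_pmf Q" using that set_subset by auto
    note pos = pmf_map_pos[OF this, of g] pmf_map_pos[OF this, of k]
    have "0 < r (A \<omega>)"
      using that pmf'[of \<omega>] r[of "A \<omega>"] by (auto simp: set_pmf_iff order_le_less)
    then show ?thesis
      unfolding lp_def pmf_map'[where g = g and \<pi> = \<pi>, OF assms(1)] pmf_map'[where g = k and \<pi> = \<pi>', OF assms(2)] assms(1)[symmetric] assms(2)[symmetric]
      using pos by (simp add: log_mult_pos)
  qed
  then have "(\<Sum>\<omega>\<in>set_pmf Q'. pmf Q' \<omega> * (lp Q' k \<omega> - lp Q' g \<omega>)) = (\<Sum>\<omega>\<in>set_pmf Q'. pmf Q' \<omega> * (lp Q k \<omega> - lp Q g \<omega>))"
    by simp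
  then show ?thesis
    unfolding ent_eq_sum_lp[OF fin'] by (simp add: sum' right_diff_distrib sum_subtractf)
qed

text \<open>A density that depends on (B, C) alone does not change the kernel from C to D when B - C
  - D. Cross products replace the quotients, so that c may have probability zero.\<close>

lemma markov_marginal:
  assumes m: "markov Q B C D" and A: "\<And>\<omega>. A \<omega> = \<pi> (B \<omega>, C \<omega>)"
  shows "pmf (map_pmf (C && D) Q') (c, d) * pmf (map_pmf C Q) c
       = pmf (map_pmf C Q') c * pmf (map_pmf (C && D) Q) (c, d)"
proof -
  have e: "pmf (map_pmf (B && C && D) Q') (b, c, d) * pmf (map_pmf C Q) c
     = pmf (map_pmf (B && C) Q') (b, c) * pmf (map_pmf (C && D) Q) (c, d)" for b
  proof -
    have "pmf (map_pmf (B && C && D) Q') (b, c, d) = pmf (map_pmf (B && C && D) Q) (b, c, d) * r (\<pi> (b, c))"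
      using pmf_map'[of "\<lambda>(b, c, d). \<pi> (b, c)" "B && C && D" "(b, c, d)"] A by simp
    moreover have "pmf (map_pmf (B && C) Q') (b, c) = pmf (map_pmf (B && C) Q) (b, c) * r (\<pi> (b, c))"
      using pmf_map'[of \<pi> "B && C" "(b, c)"] A by simp
    ultimately show ?thesis using m[unfolded markov_pmf, rule_format, of b c d] by simp
  qed
  have "pmf (map_pmf (C && D) Q') (c, d) * pmf (map_pmf C Q) c
     = (\<Sum>b\<in>B ` set_pmf Q'. pmf (map_pmf (B && C && D) Q') (b, c, d) * pmf (map_pmf C Q) c)"
    unfolding sum_distrib_right[symmetric] using pmf_map_fst_sum[OF fin', of "C && D" "(c, d)" B] by simp
  also have "\<dots> = pmf (map_pmf C Q') c * pmf (map_pmf (C && D) Q) (c, d)"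
    unfolding e sum_distrib_right[symmetric] using pmf_map_fst_sum[OF fin', of C c B] by simp
  finally show ?thesis .
qed

lemma markov':
  assumes m: "markov Q B C D" and A: "\<And>\<omega>. A \<omega> = \<pi> (B \<omega>, C \<omega>)"
  shows "markov Q' B C D"
  unfolding markov_pmf
proof (intro allI)
  fix b c d
  have abc: "pmf (map_pmf (B && C && D) Q') (b, c, d) = pmf (map_pmf (B && C && D) Q) (b, c, d) * r (\<pi> (b, c))"
    using pmf_map'[of "\<lambda>(b, c, d). \<pi> (b, c)" "B && C && D" "(b, c, d)"] A by simp
  have ab: "pmf (map_pmf (B && C) Q') (b, c) = pmf (map_pmf (B && C) Q) (b, c) * r (\<pi> (b, c))"
    using pmf_map'[of \<pi> "B && C" "(b, c)"] A by simp
  show "pmf (map_pmf (B && C && D) Q') (b, c, d) * pmf (map_pmf C Q') c =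
       pmf (map_pmf (B && C) Q') (b, c) * pmf (map_pmf (C && D) Q') (c, d)"
  proof (cases "pmf (map_pmf C Q) c = 0")
    case True
    then have "c \<notin> C ` set_pmf Q" by (auto simp: pmf_eq_0_set_pmf)
    then have "c \<notin> C ` set_pmf Q'" using set_subset by blast
    then have "pmf (map_pmf C Q') c = 0" "pmf (map_pmf (C && D) Q') (c, d) = 0"
      by (auto simp: pmf_eq_0_set_pmf)
    then show ?thesis by simp
  next
    case False
    have "pmf (map_pmf (B && C && D) Q') (b, c, d) * pmf (map_pmf C Q') c * pmf (map_pmf C Q) c
       = (pmf (map_pmf (B && C && D) Q) (b, c, d) * pmf (map_pmf C Q) c) * r (\<pi> (b, c)) * pmf (map_pmf C Q') c"
      by (simp add: abc)
    also have "\<dots> = pmf (map_pmf (B && C) Q') (b, c) *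
        (pmf (map_pmf C Q') c * pmf (map_pmf (C && D) Q) (c, d))"
      unfolding m[unfolded markov_pmf, rule_format] ab by simp
    also have "\<dots> = pmf (map_pmf (B && C) Q') (b, c) * pmf (map_pmf (C && D) Q') (c, d) * pmf (map_pmf C Q) c"
      unfolding markov_marginal[OF m A, symmetric] by simp
    finally show ?thesis using False by simp
  qed
qed

text \<open>The kernel from C to D is unchanged, so fixing the law of C fixes that of (C, D). In
  this way few constraints preserve a large joint law.\<close>

lemma map_pmf_preserved:
  fixes C :: "'o \<Rightarrow> 'c" and D :: "'o \<Rightarrow> 'd"
  assumes m: "markov Q B C D" and A: "\<And>\<omega>. A \<omega> = \<pi> (B \<omega>, C \<omega>)" and C: "map_pmf C Q' = map_pmf C Q"
  shows "map_pmf (C && D) Q' = map_pmf (C && D) Q"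
proof (rule pmf_eqI)
  fix z :: "'c \<times> 'd"
  obtain c d where z: "z = (c, d)" by (cases z)
  show "pmf (map_pmf (C && D) Q') z = pmf (map_pmf (C && D) Q) z"
  proof (cases "pmf (map_pmf C Q) c = 0")
    case True
    then have "c \<notin> C ` set_pmf Q" by (auto simp: pmf_eq_0_set_pmf)
    moreover from this have "c \<notin> C ` set_pmf Q'" using set_subset by blast
    ultimately have "pmf (map_pmf (C && D) Q') (c, d) = 0" "pmf (map_pmf (C && D) Q) (c, d) = 0"
      by (auto simp: pmf_eq_0_set_pmf)
    then show ?thesis by (simp add: z)
  next
    case False
    then show ?thesis using markov_marginal[OF m A, of c d] by (simp add: z C)
  qed
qed

end

text \<open>\<open>caratheodory_min\<close> on the values of \<open>A\<close>, starting from the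
  constant weight 1. One functional is preserved for each value of \<open>B\<close> and one for each
  \<open>\<phi> j\<close>; \<open>h\<close> must merely not grow.\<close>

lemma reweight_reduce:
  fixes Q :: "'o pmf" and A :: "'o \<Rightarrow> 'a" and B :: "'o \<Rightarrow> 'b" and \<phi> :: "nat \<Rightarrow> 'o \<Rightarrow> real"
  assumes fin: "finite (set_pmf Q)"
  shows "\<exists>Q' r. reweighting Q Q' A r \<and> map_pmf B Q' = map_pmf B Q
     \<and> (\<forall>j<m. (\<Sum>\<omega>\<in>set_pmf Q. pmf Q' \<omega> * \<phi> j \<omega>) = (\<Sum>\<omega>\<in>set_pmf Q. pmf Q \<omega> * \<phi> j \<omega>))
     \<and> (\<Sum>\<omega>\<in>set_pmf Q. pmf Q' \<omega> * h \<omega>) \<le> (\<Sum>\<omega>\<in>set_pmf Q. pmf Q \<omega> * h \<omega>)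
     \<and> card (A ` set_pmf Q') \<le> card (B ` set_pmf Q) + m"
proof -
  let ?I = "A ` set_pmf Q"
  let ?J = "B ` set_pmf Q <+> {..<m}"
  define F where "F \<psi> a = (\<Sum>\<omega>\<in>{\<omega>\<in>set_pmf Q. A \<omega> = a}. pmf Q \<omega> * \<psi> \<omega>)" for \<psi> :: "'o \<Rightarrow> real" and a
  define \<Psi> where "\<Psi> j = (case j of Inl b \<Rightarrow> (\<lambda>\<omega>. of_bool (B \<omega> = b)) | Inr i \<Rightarrow> \<phi> i)" for j
  have FI: "(\<Sum>a\<in>?I. s a * F \<psi> a) = (\<Sum>\<omega>\<in>set_pmf Q. pmf Q \<omega> * s (A \<omega>) * \<psi> \<omega>)" for s \<psi>
    unfolding sum.image_gen[OF fin, of _ A] F_def sum_distrib_left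
    by (intro sum.cong refl) auto
  have finB: "finite (B ` set_pmf Q)" using fin by simp
  have J: "finite ?J" using fin by (simp add: finite_Plus)
  \<comment> \<open>The functionals belonging to the law of \<open>B\<close> add up to the
    probability of A = a, which is the positive combination that bounds the polytope.\<close>
  have pos: "(\<Sum>j\<in>?J. (case j of Inl _ \<Rightarrow> 1 | Inr _ \<Rightarrow> 0) * F (\<Psi> j) a) > 0" if aI: "a \<in> ?I" for a
  proof -
    have "(\<Sum>j\<in>?J. (case j of Inl _ \<Rightarrow> 1 | Inr _ \<Rightarrow> 0) * F (\<Psi> j) a) = (\<Sum>b\<in>B ` set_pmf Q. F (\<lambda>\<omega>. of_bool (B \<omega> = b)) a)"
      using finB by (simp add: sum.Plus \<Psi>_def)
    also have "\<dots> = (\<Sum>\<omega>\<in>{\<omega>\<in>set_pmf Q. A \<omega> = a}. \<Sum>b\<in>B ` set_pmf Q. pmf Q \<omega> * of_bool (B \<omega> = b))"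
      unfolding F_def by (rule sum.swap)
    also have "\<dots> = (\<Sum>\<omega>\<in>{\<omega>\<in>set_pmf Q. A \<omega> = a}. pmf Q \<omega>)"
    proof (intro sum.cong refl)
      fix \<omega> assume "\<omega> \<in> {\<omega>\<in>set_pmf Q. A \<omega> = a}"
      moreover have "(\<Sum>b\<in>B ` set_pmf Q. pmf Q \<omega> * of_bool (B \<omega> = b)) = (\<Sum>b\<in>B ` set_pmf Q. if b = B \<omega> then pmf Q \<omega> else 0)"
        by (intro sum.cong) auto
      ultimately show "(\<Sum>b\<in>B ` set_pmf Q. pmf Q \<omega> * of_bool (B \<omega> = b)) = pmf Q \<omega>"
        using finB by (simp add: sum.delta)
    qed
    also have "\<dots> > 0"
    proof -
      obtain \<omega> where "\<omega> \<in> set_pmf Q" "a = A \<omega>" using aI by blast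
      then show ?thesis using fin by (intro sum_pos) (auto simp: pmf_positive)
    qed
    finally show ?thesis .
  qed
  have "\<exists>r. (\<forall>a. 0 \<le> r a) \<and> (\<forall>j\<in>?J. (\<Sum>a\<in>?I. r a * F (\<Psi> j) a) = (\<Sum>a\<in>?I. 1 * F (\<Psi> j) a))
      \<and> (\<Sum>a\<in>?I. r a * F h a) \<le> (\<Sum>a\<in>?I. 1 * F h a) \<and> card {a\<in>?I. r a > 0} \<le> card ?J"
    by (rule caratheodory_min[OF J finite_imageI[OF fin] pos]) auto
  then obtain r where rr: "\<forall>a. 0 \<le> r a" "\<forall>j\<in>?J. (\<Sum>a\<in>?I. r a * F (\<Psi> j) a) = (\<Sum>a\<in>?I. 1 * F (\<Psi> j) a)"
      "(\<Sum>a\<in>?I. r a * F h a) \<le> (\<Sum>a\<in>?I. 1 * F h a)" "card {a\<in>?I. r a > 0} \<le> card ?J"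
    by blast
  note r' = rr(2,3)[unfolded FI]
  have rB: "(\<Sum>\<omega>\<in>set_pmf Q. pmf Q \<omega> * r (A \<omega>) * of_bool (B \<omega> = b)) = pmf (map_pmf B Q) b" for b
  proof (cases "b \<in> B ` set_pmf Q")
    case True
    then show ?thesis
      using r'(1)[rule_format, OF InlI[OF True]] by (simp add: \<Psi>_def pmf_map_sum[OF fin])
  next
    case False
    then have "pmf (map_pmf B Q) b = 0" by (simp add: pmf_eq_0_set_pmf)
    moreover have "(\<Sum>\<omega>\<in>set_pmf Q. pmf Q \<omega> * r (A \<omega>) * of_bool (B \<omega> = b)) = 0"
      using False by (intro sum.neutral) auto
    ultimately show ?thesis by simp
  qed
  \<comment> \<open>Total mass is not a separate constraint; it is the sum of the preserved
    probabilities of \<open>B\<close>.\<close>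
  have "(\<Sum>\<omega>\<in>set_pmf Q. pmf Q \<omega> * r (A \<omega>)) = 1"
  proof -
    have "(\<Sum>\<omega>\<in>set_pmf Q. pmf Q \<omega> * r (A \<omega>))
       = (\<Sum>b\<in>B ` set_pmf Q. \<Sum>\<omega>\<in>{\<omega>\<in>set_pmf Q. B \<omega> = b}. pmf Q \<omega> * r (A \<omega>))"
      by (rule sum.image_gen[OF fin])
    also have "\<dots> = (\<Sum>b\<in>B ` set_pmf Q. \<Sum>\<omega>\<in>set_pmf Q. pmf Q \<omega> * r (A \<omega>) * of_bool (B \<omega> = b))"
      using fin by (intro sum.cong refl sum.mono_neutral_cong_left) auto
    also have "\<dots> = (\<Sum>b\<in>set_pmf (map_pmf B Q). pmf (map_pmf B Q) b)" unfolding rB by simp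
    also have "\<dots> = 1" using fin by (intro sum_pmf_eq_1) auto
    finally show ?thesis .
  qed
  from reweight_exists[where r = r and A = A, OF fin _ this] rr(1) obtain Q' where Q': "\<And>\<omega>. pmf Q' \<omega> = pmf Q \<omega> * r (A \<omega>)" by blast
  interpret reweighting Q Q' A r using fin rr Q' by unfold_locales auto
  have "map_pmf B Q' = map_pmf B Q"
    by (rule pmf_eqI) (unfold pmf_map_sum[OF fin'] sum', simp add: pmf' rB)
  moreover have "(\<Sum>\<omega>\<in>set_pmf Q. pmf Q' \<omega> * \<phi> j \<omega>) = (\<Sum>\<omega>\<in>set_pmf Q. pmf Q \<omega> * \<phi> j \<omega>)" if "j < m" for j
    using r'(1)[rule_format, OF InrI, of j] that by (simp add: \<Psi>_def pmf')
  moreover have "(\<Sum>\<omega>\<in>set_pmf Q. pmf Q' \<omega> * h \<omega>) \<le> (\<Sum>\<omega>\<in>set_pmf Q. pmf Q \<omega> * h \<omega>)"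
    using r'(2) by (simp add: pmf')
  moreover have "card (A ` set_pmf Q') \<le> card (B ` set_pmf Q) + m"
  proof -
    have "r (A \<omega>) > 0" if "\<omega> \<in> set_pmf Q'" for \<omega>
    proof -
      have "pmf Q \<omega> * r (A \<omega>) \<noteq> 0" using that pmf'[of \<omega>] by (simp add: set_pmf_iff)
      then show ?thesis using rr(1)[rule_format, of "A \<omega>"] by (simp add: order_le_less)
    qed
    then have "A ` set_pmf Q' \<subseteq> {a\<in>?I. r a > 0}" using set_subset by blast
    then have "card (A ` set_pmf Q') \<le> card {a\<in>?I. r a > 0}" using fin by (intro card_mono) auto
    also have "\<dots> \<le> card ?J" by (rule rr(4))
    also have "\<dots> = card (B ` set_pmf Q) + m" using finB by (simp add: card_Plus)
    finally show ?thesis .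
  qed
  ultimately show ?thesis
    using reweighting_axioms by (intro exI[of _ Q'] exI[of _ r] conjI allI impI)
qed

section \<open>Rates and admissibility under a change of law\<close>

lemma map_pmf_factor:
  assumes "map_pmf g Q' = map_pmf g Q" "\<And>\<omega>. k \<omega> = h (g \<omega>)"
  shows "map_pmf k Q' = map_pmf k Q"
proof -
  have k: "k = (\<lambda>\<omega>. h (g \<omega>))" using assms(2) by auto
  have "map_pmf h (map_pmf g Q') = map_pmf h (map_pmf g Q)" using assms(1) by simp
  then show ?thesis by (simp add: map_pmf_comp k)
qed

lemma ent_factor:
  assumes "map_pmf g Q' = map_pmf g Q" "\<And>\<omega>. k \<omega> = h (g \<omega>)"
  shows "ent Q' k = ent Q k"
  using map_pmf_factor[where g = g and k = k and h = h, OF assms] by (simp add: ent_def)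

lemma markov_factor:
  assumes g: "map_pmf g Q' = map_pmf g Q" and "\<And>\<omega>. A \<omega> = a (g \<omega>)" "\<And>\<omega>. B \<omega> = b (g \<omega>)" "\<And>\<omega>. C \<omega> = c (g \<omega>)"
    and "markov Q A B C"
  shows "markov Q' A B C"
proof -
  have "map_pmf (A && B && C) Q' = map_pmf (A && B && C) Q"
    by (rule map_pmf_factor[OF g, where h = "\<lambda>z. (a z, b z, c z)"]) (simp add: assms)
  moreover have "map_pmf (A && B) Q' = map_pmf (A && B) Q"
    by (rule map_pmf_factor[OF g, where h = "\<lambda>z. (a z, b z)"]) (simp add: assms)
  moreover have "map_pmf (B && C) Q' = map_pmf (B && C) Q"
    by (rule map_pmf_factor[OF g, where h = "\<lambda>z. (b z, c z)"]) (simp add: assms)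
  moreover have "map_pmf B Q' = map_pmf B Q"
    by (rule map_pmf_factor[OF g, where h = b]) (simp add: assms)
  ultimately show ?thesis using assms(5) by (simp add: markov_pmf)
qed

lemma admissibleD:
  assumes "admissible p f Q sV sW"
  shows "finite (set_pmf Q)"
    and "map_pmf (rX && rY) Q = p"
    and "markov Q rT rU (rX && rY)"
    and "markov Q (rT && rU) rX rY"
    and "markov Q rV (rX && rT) (rU && rY && rW)"
    and "markov Q (rV && rX && rT) (rU && rY) rW"
    and "\<And>\<omega>. \<omega> \<in> set_pmf Q \<Longrightarrow> (rT \<omega>, rX \<omega>) \<in> sV (rV \<omega>)"
    and "\<And>\<omega>. \<omega> \<in> set_pmf Q \<Longrightarrow> indep_set Q (rT && rX) (rT && rU && rY)
                  (\<lambda>\<omega>. f (rX \<omega>) (rY \<omega>)) (sV (rV \<omega>))"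
    and "\<And>\<omega>. \<omega> \<in> set_pmf Q \<Longrightarrow> (rT \<omega>, rU \<omega>, rY \<omega>) \<in> sW (rW \<omega>)"
    and "\<And>\<omega>. \<omega> \<in> set_pmf Q \<Longrightarrow> indep_set Q (rT && rU && rY) (rT && rV)
                  (\<lambda>\<omega>. f (rX \<omega>) (rY \<omega>)) (sW (rW \<omega>))"
  using assms unfolding admissible_def by auto

text \<open>The entropies are arranged for \<open>ent_diff'\<close>: whichever of T, V, W is
  reweighted, they pair up into differences with that variable in both members, or their law is
  preserved. For V, R_X and the sum rate share H(V,T,W) - H(V,T,X); for W, R_Y and the sum rate
  share H(V,T,W) - H(T,W,U,Y). The second form of the first rate is the one met in coding.\<close>

lemma admissible_rates:
  assumes "admissible p f Q sV sW"
  shows "cmi Q rX rU rY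
      = ent Q (rX && rY) - ent Q rY + (ent Q (rT && rU && rY) - ent Q (rT && rX && rU && rY))" (is ?f1)
    and "cmi Q rX rU rY
      = (ent Q (rT && rU && rY) - ent Q rY) - (ent Q (rT && rX && rU) - ent Q rX)" (is ?f2)
    and "cmi Q rV rX (rT && rW)
      = (ent Q (rV && rT && rW) - ent Q (rT && rW))
        + (ent Q (rT && rX) - ent Q (rV && rT && rX))" (is ?f3)
    and "cmi Q (rU && rY) rW (rV && rT)
      = (ent Q (rV && rT && rW) - ent Q (rV && rT))
        + (ent Q (rT && rU && rY) - ent Q (rT && rW && rU && rY))" (is ?f4)
    and "cmi Q (rX && rY) (rV && rT && rW) (\<lambda>_. ())
       + cmi Q rU rW (rV && rX && rT && rY)
      = (ent Q (rV && rT && rW) - ent Q (rV && rT && rX)) + ent Q rX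
        + (ent Q (rT && rU && rY) - ent Q (rT && rW && rU && rY))" (is ?f5)
proof -
  have fin: "finite (set_pmf Q)"
    and m1: "markov Q rT rU (rX && rY)"
    and m2: "markov Q (rT && rU) rX rY"
    and m3: "markov Q rV (rX && rT) (rU && rY && rW)"
    and m4: "markov Q (rV && rX && rT) (rU && rY) rW"
    by (fact admissibleD[OF assms])+
  note em = ent_markov[OF fin] and mm = markov_map[OF fin]
  note ec = ent_cong[OF fin]
  have i1: "ent Q (rT && rU && rX && rY) + ent Q rU = ent Q (rT && rU) + ent Q (rU && rX && rY)"
    by (rule em[OF m1])
  have i1': "ent Q (rT && rU && rY) + ent Q rU = ent Q (rT && rU) + ent Q (rU && rY)"
    using mm[OF m1, of "\<lambda>t. t" snd] by (intro em) simp
  have i2: "ent Q ((rT && rU) && rX && rY) + ent Q rX = ent Q ((rT && rU) && rX) + ent Q (rX && rY)"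
    by (rule em[OF m2])
  have i2': "ent Q (rT && rX && rY) + ent Q rX = ent Q (rT && rX) + ent Q (rX && rY)"
    using mm[OF m2, of fst "\<lambda>y. y"] by (intro em) simp
  have i3: "ent Q (rV && (rX && rT) && rW) + ent Q (rX && rT)
      = ent Q (rV && rX && rT) + ent Q ((rX && rT) && rW)"
    using mm[OF m3, of "\<lambda>v. v" "\<lambda>(u, y, w). w"] by (intro em) simp
  have i3': "ent Q (rV && (rX && rT) && rY) + ent Q (rX && rT)
      = ent Q (rV && rX && rT) + ent Q ((rX && rT) && rY)"
    using mm[OF m3, of "\<lambda>v. v" "\<lambda>(u, y, w). y"] by (intro em) simp
  have i4: "ent Q ((rV && rX && rT) && (rU && rY) && rW) + ent Q (rU && rY)
      = ent Q ((rV && rX && rT) && rU && rY) + ent Q ((rU && rY) && rW)"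
    by (rule em[OF m4])
  have i4': "ent Q (rT && (rU && rY) && rW) + ent Q (rU && rY)
      = ent Q (rT && rU && rY) + ent Q ((rU && rY) && rW)"
    using mm[OF m4, of "\<lambda>(v, x, t). t" "\<lambda>w. w"] by (intro em) simp
  have i4'': "ent Q ((rV && rT) && (rU && rY) && rW) + ent Q (rU && rY)
      = ent Q ((rV && rT) && rU && rY) + ent Q ((rU && rY) && rW)"
    using mm[OF m4, of "\<lambda>(v, x, t). (v, t)" "\<lambda>w. w"] by (intro em) simp
  have n1: "ent Q (rT && rU && rX && rY) = ent Q (rT && rX && rU && rY)" by (rule ec) auto
  have n2: "ent Q (rX && rU && rY) = ent Q (rU && rX && rY)" by (rule ec) auto
  have n3: "ent Q ((rT && rU) && rX && rY) = ent Q (rT && rX && rU && rY)" by (rule ec) auto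
  have n4: "ent Q ((rT && rU) && rX) = ent Q (rT && rX && rU)" by (rule ec) auto
  have n5: "ent Q (rX && rT) = ent Q (rT && rX)" by (rule ec) auto
  have n6: "ent Q (rV && rX && rT) = ent Q (rV && rT && rX)" by (rule ec) auto
  have n7: "ent Q (rV && (rX && rT) && rW) = ent Q (rV && rX && rT && rW)" by (rule ec) auto
  have n8: "ent Q ((rX && rT) && rW) = ent Q (rX && rT && rW)" by (rule ec) auto
  have n9: "ent Q ((rX && rT) && rY) = ent Q (rT && rX && rY)" by (rule ec) auto
  have n10: "ent Q (rV && (rX && rT) && rY) = ent Q (rV && rX && rT && rY)" by (rule ec) auto
  have n11: "ent Q (rT && (rU && rY) && rW) = ent Q (rT && rW && rU && rY)" by (rule ec) auto
  have n12: "ent Q ((rU && rY) && rW && rV && rT) = ent Q ((rV && rT) && (rU && rY) && rW)" by (rule ec) auto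
  have n13: "ent Q ((rU && rY) && rV && rT) = ent Q ((rV && rT) && rU && rY)" by (rule ec) auto
  have n14: "ent Q (rW && rV && rT) = ent Q (rV && rT && rW)" by (rule ec) auto
  have n15: "ent Q (\<lambda>\<omega>. ((rX \<omega>, rY \<omega>), ())) = ent Q (rX && rY)" by (rule ec) auto
  have n16: "ent Q (\<lambda>\<omega>. ((rV \<omega>, rT \<omega>, rW \<omega>), ())) = ent Q (rV && rT && rW)" by (rule ec) auto
  have n17: "ent Q (\<lambda>\<omega>. ((rX \<omega>, rY \<omega>), (rV \<omega>, rT \<omega>, rW \<omega>), ())) = ent Q (rW && rV && rX && rT && rY)" by (rule ec) auto
  have n18: "ent Q (\<lambda>_. ()) = 0" by (simp add: ent_def)
  have n19: "ent Q (rU && rW && rV && rX && rT && rY) = ent Q ((rV && rX && rT) && (rU && rY) && rW)" by (rule ec) auto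
  have n20: "ent Q (rU && rV && rX && rT && rY) = ent Q ((rV && rX && rT) && rU && rY)" by (rule ec) auto
  \<comment> \<open>By T - U - (X,Y), joining T to U raises H(U,Y) and H(X,U,Y) by the same
    amount.\<close>
  show ?f1
    unfolding cmi_def using i1 i1' n1 n2 by linarith
  then show ?f2
    using i2 n3 n4 by linarith
  show ?f3
    unfolding cmi_def using i3 n5 n6 n7 n8 by linarith
  show ?f4
    unfolding cmi_def using i4' i4'' n11 n12 n13 n14 by linarith
  show ?f5
    unfolding cmi_def using i4 i4' i3' i2' n5 n6 n9 n10 n11 n15 n16 n17 n18 n19 n20 by linarith
qed

lemma char_adj_mono:
  "set_pmf Q' \<subseteq> set_pmf Q \<Longrightarrow> char_adj Q' L K F l1 l2 \<Longrightarrow> char_adj Q L K F l1 l2"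
  unfolding char_adj_def by blast

text \<open>A smaller support has fewer edges but also fewer vertices, hence the intersection with
  the new vertex set.\<close>

lemma indep_set_Int:
  assumes "set_pmf Q' \<subseteq> set_pmf Q" "indep_set Q L K F A"
  shows "indep_set Q' L K F (A \<inter> L ` set_pmf Q')"
  unfolding indep_set_def
proof (intro conjI ballI impI)
  fix l1 l2 assume "l1 \<in> A \<inter> L ` set_pmf Q'" "l2 \<in> A \<inter> L ` set_pmf Q'" "l1 \<noteq> l2"
  then have "\<not> char_adj Q L K F l1 l2" using assms(2) unfolding indep_set_def by simp
  then show "\<not> char_adj Q' L K F l1 l2" using char_adj_mono[OF assms(1)] by (rule contrapos_nn)
qed simp

text \<open>Finiteness and the conditions on independent sets are inherited by any law with smaller
  support, once the label sets are cut down; the source law and the Markov chains have to be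
  supplied.\<close>

lemma admissible_subset:
  assumes adm: "admissible p f Q sV sW" and sub: "set_pmf Q' \<subseteq> set_pmf Q"
    and "map_pmf (rX && rY) Q' = p"
    and "markov Q' rT rU (rX && rY)"
    and "markov Q' (rT && rU) rX rY"
    and "markov Q' rV (rX && rT) (rU && rY && rW)"
    and "markov Q' (rV && rX && rT) (rU && rY) rW"
  shows "\<exists>sV' sW'. admissible p f Q' sV' sW'"
proof -
  have "admissible p f Q' (\<lambda>v. sV v \<inter> (rT && rX) ` set_pmf Q') (\<lambda>w. sW w \<inter> (rT && rU && rY) ` set_pmf Q')"
    unfolding admissible_def
  proof (intro conjI ballI assms(3-))
    show "finite (set_pmf Q')" using admissibleD(1)[OF adm] sub by (rule finite_subset[rotated])
  next
    fix \<omega> assume w: "\<omega> \<in> set_pmf Q'"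
    then have wQ: "\<omega> \<in> set_pmf Q" using sub by blast
    show "(rT \<omega>, rX \<omega>) \<in> sV (rV \<omega>) \<inter> (rT && rX) ` set_pmf Q'"
      by (intro IntI admissibleD(7)[OF adm wQ] image_eqI[OF refl w])
    show "(rT \<omega>, rU \<omega>, rY \<omega>) \<in> sW (rW \<omega>) \<inter> (rT && rU && rY) ` set_pmf Q'"
      by (intro IntI admissibleD(9)[OF adm wQ] image_eqI[OF refl w])
    show "indep_set Q' (rT && rX) (rT && rU && rY) (\<lambda>\<omega>. f (rX \<omega>) (rY \<omega>))
        (sV (rV \<omega>) \<inter> (rT && rX) ` set_pmf Q')"
      by (rule indep_set_Int[OF sub admissibleD(8)[OF adm wQ]])
    show "indep_set Q' (rT && rU && rY) (rT && rV) (\<lambda>\<omega>. f (rX \<omega>) (rY \<omega>))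
        (sW (rW \<omega>) \<inter> (rT && rU && rY) ` set_pmf Q')"
      by (rule indep_set_Int[OF sub admissibleD(10)[OF adm wQ]])
  qed
  then show ?thesis by blast
qed

lemma aux_region_mono:
  assumes "cmi Q' rX rU rY \<le> cmi Q rX rU rY"
    and "cmi Q' rV rX (rT && rW) \<le> cmi Q rV rX (rT && rW)"
    and "cmi Q' (rU && rY) rW (rV && rT) \<le> cmi Q (rU && rY) rW (rV && rT)"
    and "cmi Q' (rX && rY) (rV && rT && rW) (\<lambda>_. ())
        + cmi Q' rU rW (rV && rX && rT && rY)
      \<le> cmi Q (rX && rY) (rV && rT && rW) (\<lambda>_. ())
        + cmi Q rU rW (rV && rX && rT && rY)"
  shows "aux_region Q \<subseteq> aux_region Q'"
  unfolding aux_region_def using assms by (auto intro: le_less_trans)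

section \<open>Reducing the alphabets of T, V and W\<close>

lemma ent_diff:
  assumes "finite (set_pmf Q)"
  shows "ent Q g - ent Q k = (\<Sum>\<omega>\<in>set_pmf Q. pmf Q \<omega> * (lp Q k \<omega> - lp Q g \<omega>))"
  unfolding ent_eq_sum_lp[OF assms] by (simp add: right_diff_distrib sum_subtractf)

text \<open>The law of X accounts for |X| constraints and the four rates for one each. Fixing the
  law of X fixes p, because T influences Y only through X by the chain (T,U) - X - Y.\<close>

lemma reduce_T:
  fixes p :: "('x::finite \<times> 'y::finite) pmf"
  assumes adm: "admissible p f Q sV sW"
  shows "\<exists>Q' sV' sW'. admissible p f Q' sV' sW' \<and> aux_region Q \<subseteq> aux_region Q'
     \<and> card (rT ` set_pmf Q') \<le> CARD('x) + 4"
proof -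
  note ad = admissibleD[OF adm]
  note fin = ad(1)
  let ?VTW = "\<lambda>\<omega>::('x,'y) jnt. (rV \<omega>, rT \<omega>, rW \<omega>)" and ?TW = "\<lambda>\<omega>::('x,'y) jnt. (rT \<omega>, rW \<omega>)"
    and ?TX = "\<lambda>\<omega>::('x,'y) jnt. (rT \<omega>, rX \<omega>)" and ?VTX = "\<lambda>\<omega>::('x,'y) jnt. (rV \<omega>, rT \<omega>, rX \<omega>)"
    and ?VT = "\<lambda>\<omega>::('x,'y) jnt. (rV \<omega>, rT \<omega>)" and ?TUY = "\<lambda>\<omega>::('x,'y) jnt. (rT \<omega>, rU \<omega>, rY \<omega>)"
    and ?TWUY = "\<lambda>\<omega>::('x,'y) jnt. (rT \<omega>, rW \<omega>, rU \<omega>, rY \<omega>)" and ?TXUY = "\<lambda>\<omega>::('x,'y) jnt. (rT \<omega>, rX \<omega>, rU \<omega>, rY \<omega>)"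
  \<comment> \<open>The T-dependent parts of the four rates. The order in each difference is
    reversed because entropy is minus the mean of \<open>lp\<close>.\<close>
  define \<phi> where "\<phi> j = [\<lambda>\<omega>. lp Q ?TXUY \<omega> - lp Q ?TUY \<omega>,
      \<lambda>\<omega>. (lp Q ?TW \<omega> - lp Q ?VTW \<omega>) + (lp Q ?VTX \<omega> - lp Q ?TX \<omega>),
      \<lambda>\<omega>. (lp Q ?VT \<omega> - lp Q ?VTW \<omega>) + (lp Q ?TWUY \<omega> - lp Q ?TUY \<omega>),
      \<lambda>\<omega>. (lp Q ?VTX \<omega> - lp Q ?VTW \<omega>) + (lp Q ?TWUY \<omega> - lp Q ?TUY \<omega>)] ! j" for j
  obtain Q' r where rw: "reweighting Q Q' rT r" and mX: "map_pmf rX Q' = map_pmf rX Q"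
    and eq: "\<And>j. j < 4 \<Longrightarrow> (\<Sum>\<omega>\<in>set_pmf Q. pmf Q' \<omega> * \<phi> j \<omega>) = (\<Sum>\<omega>\<in>set_pmf Q. pmf Q \<omega> * \<phi> j \<omega>)"
    and crd: "card (rT ` set_pmf Q') \<le> card (rX ` set_pmf Q) + 4"
    using reweight_reduce[OF fin, of rT rX 4 \<phi> "\<lambda>_. 0"] by blast
  interpret reweighting Q Q' rT r by (rule rw)
  have mXY: "map_pmf (rX && rY) Q' = map_pmf (rX && rY) Q"
    by (rule map_pmf_preserved[OF ad(4), where \<pi> = "\<lambda>((t, u), x). t", OF _ mX]) simp
  have "\<exists>sV' sW'. admissible p f Q' sV' sW'"
  proof (rule admissible_subset[OF adm set_subset])
    show "map_pmf (rX && rY) Q' = p" using mXY ad(2) by simp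
    show "markov Q' rT rU (rX && rY)" by (rule markov'[OF ad(3), where \<pi> = fst]) simp
    show "markov Q' (rT && rU) rX rY" by (rule markov'[OF ad(4), where \<pi> = "\<lambda>((t, u), x). t"]) simp
    show "markov Q' rV (rX && rT) (rU && rY && rW)"
      by (rule markov'[OF ad(5), where \<pi> = "\<lambda>(v, x, t). t"]) simp
    show "markov Q' (rV && rX && rT) (rU && rY) rW"
      by (rule markov'[OF ad(6), where \<pi> = "\<lambda>((v, x, t), u, y). t"]) simp
  qed
  then obtain sV' sW' where adm': "admissible p f Q' sV' sW'" by blast
  have e: "ent Q' (rX && rY) = ent Q (rX && rY)" "ent Q' rY = ent Q rY" "ent Q' rX = ent Q rX"
    using ent_factor[OF mXY, of _ "\<lambda>z. z"] ent_factor[OF mXY, of rY snd] ent_factor[OF mXY, of rX fst] by auto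
  have d1: "ent Q' ?TUY - ent Q' ?TXUY = (\<Sum>\<omega>\<in>set_pmf Q. pmf Q' \<omega> * (lp Q ?TXUY \<omega> - lp Q ?TUY \<omega>))"
    by (rule ent_diff'[where \<pi> = fst and \<pi>' = fst]) auto
  have d2: "ent Q' ?VTW - ent Q' ?TW = (\<Sum>\<omega>\<in>set_pmf Q. pmf Q' \<omega> * (lp Q ?TW \<omega> - lp Q ?VTW \<omega>))"
    by (rule ent_diff'[where \<pi> = "\<lambda>(v, t, w). t" and \<pi>' = fst]) auto
  have d3: "ent Q' ?TX - ent Q' ?VTX = (\<Sum>\<omega>\<in>set_pmf Q. pmf Q' \<omega> * (lp Q ?VTX \<omega> - lp Q ?TX \<omega>))"
    by (rule ent_diff'[where \<pi> = fst and \<pi>' = "\<lambda>(v, t, w). t"]) auto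
  have d4: "ent Q' ?VTW - ent Q' ?VT = (\<Sum>\<omega>\<in>set_pmf Q. pmf Q' \<omega> * (lp Q ?VT \<omega> - lp Q ?VTW \<omega>))"
    by (rule ent_diff'[where \<pi> = "\<lambda>(v, t, w). t" and \<pi>' = snd]) auto
  have d5: "ent Q' ?TUY - ent Q' ?TWUY = (\<Sum>\<omega>\<in>set_pmf Q. pmf Q' \<omega> * (lp Q ?TWUY \<omega> - lp Q ?TUY \<omega>))"
    by (rule ent_diff'[where \<pi> = fst and \<pi>' = fst]) auto
  have d6: "ent Q' ?VTW - ent Q' ?VTX = (\<Sum>\<omega>\<in>set_pmf Q. pmf Q' \<omega> * (lp Q ?VTX \<omega> - lp Q ?VTW \<omega>))"
    by (rule ent_diff'[where \<pi> = "\<lambda>(v, t, w). t" and \<pi>' = "\<lambda>(v, t, w). t"]) auto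
  note eqs = eq[of 0] eq[of 1] eq[of 2] eq[of 3]
  note eqs' = eqs[unfolded \<phi>_def, simplified, unfolded distrib_left sum.distrib]
  have "aux_region Q \<subseteq> aux_region Q'"
  proof (rule aux_region_mono)
    show "cmi Q' rX rU rY \<le> cmi Q rX rU rY"
      unfolding admissible_rates(1)[OF adm] admissible_rates(1)[OF adm'] e d1 ent_diff[OF fin] eqs'(1) by simp
    show "cmi Q' rV rX (rT && rW) \<le> cmi Q rV rX (rT && rW)"
      unfolding admissible_rates(3)[OF adm] admissible_rates(3)[OF adm'] d2 d3 ent_diff[OF fin]
      using eqs'(2) by simp
    show "cmi Q' (rU && rY) rW (rV && rT) \<le> cmi Q (rU && rY) rW (rV && rT)"
      unfolding admissible_rates(4)[OF adm] admissible_rates(4)[OF adm'] d4 d5 ent_diff[OF fin]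
      using eqs'(3) by simp
    show "cmi Q' (rX && rY) (rV && rT && rW) (\<lambda>_. ())
        + cmi Q' rU rW (rV && rX && rT && rY)
      \<le> cmi Q (rX && rY) (rV && rT && rW) (\<lambda>_. ())
        + cmi Q rU rW (rV && rX && rT && rY)"
      unfolding admissible_rates(5)[OF adm] admissible_rates(5)[OF adm'] d6 d5 e ent_diff[OF fin]
      using eqs'(4) by simp
  qed
  moreover have "card (rX ` set_pmf Q) \<le> CARD('x)" by (rule card_mono) auto
  then have "card (rT ` set_pmf Q') \<le> CARD('x) + 4" using crd by linarith
  ultimately show ?thesis using adm' by (intro exI[of _ Q'] exI[of _ sV'] exI[of _ sW'] conjI)
qed

text \<open>With the law of (X,T) fixed, V - (X,T) - (U,Y,W) keeps the joint law of everything but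
  V. The difference H(V,T,W) - H(V,T) is preserved for R_Y, which accounts for the 1 in the bound.
  The difference H(V,T,W) - H(V,T,X) may drop, to the benefit of R_X and the sum rate.\<close>

lemma reduce_V:
  fixes p :: "('x::finite \<times> 'y::finite) pmf"
  assumes adm: "admissible p f Q sV sW"
  shows "\<exists>Q' sV' sW'. admissible p f Q' sV' sW' \<and> aux_region Q \<subseteq> aux_region Q' \<and> set_pmf Q' \<subseteq> set_pmf Q
     \<and> card (rV ` set_pmf Q') \<le> card (rT ` set_pmf Q) * CARD('x) + 1"
proof -
  note ad = admissibleD[OF adm]
  note fin = ad(1)
  let ?VTW = "\<lambda>\<omega>::('x,'y) jnt. (rV \<omega>, rT \<omega>, rW \<omega>)" and ?VTX = "\<lambda>\<omega>::('x,'y) jnt. (rV \<omega>, rT \<omega>, rX \<omega>)"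
    and ?VT = "\<lambda>\<omega>::('x,'y) jnt. (rV \<omega>, rT \<omega>)" and ?XT = "\<lambda>\<omega>::('x,'y) jnt. (rX \<omega>, rT \<omega>)"
    and ?R = "\<lambda>\<omega>::('x,'y) jnt. ((rX \<omega>, rT \<omega>), rU \<omega>, rY \<omega>, rW \<omega>)"
  obtain Q' r where rw: "reweighting Q Q' rV r" and mXT: "map_pmf ?XT Q' = map_pmf ?XT Q"
    and eq: "\<And>j::nat. j < 1 \<Longrightarrow> (\<Sum>\<omega>\<in>set_pmf Q. pmf Q' \<omega> * (lp Q ?VT \<omega> - lp Q ?VTW \<omega>))
        = (\<Sum>\<omega>\<in>set_pmf Q. pmf Q \<omega> * (lp Q ?VT \<omega> - lp Q ?VTW \<omega>))"
    and le: "(\<Sum>\<omega>\<in>set_pmf Q. pmf Q' \<omega> * (lp Q ?VTX \<omega> - lp Q ?VTW \<omega>))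
        \<le> (\<Sum>\<omega>\<in>set_pmf Q. pmf Q \<omega> * (lp Q ?VTX \<omega> - lp Q ?VTW \<omega>))"
    and crd: "card (rV ` set_pmf Q') \<le> card (?XT ` set_pmf Q) + 1"
    using reweight_reduce[OF fin, of rV ?XT 1 "\<lambda>_ \<omega>. lp Q ?VT \<omega> - lp Q ?VTW \<omega>" "\<lambda>\<omega>. lp Q ?VTX \<omega> - lp Q ?VTW \<omega>"]
    by (elim exE conjE) blast
  interpret reweighting Q Q' rV r by (rule rw)
  have mR: "map_pmf ?R Q' = map_pmf ?R Q"
    by (rule map_pmf_preserved[OF ad(5), where \<pi> = "\<lambda>(v, x). v", OF _ mXT]) simp
  have "\<exists>sV' sW'. admissible p f Q' sV' sW'"
  proof (rule admissible_subset[OF adm set_subset])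
    show "map_pmf (rX && rY) Q' = p"
      unfolding ad(2)[symmetric] by (rule map_pmf_factor[OF mR, where h = "\<lambda>((x, t), u, y, w). (x, y)"]) simp
    show "markov Q' rT rU (rX && rY)"
      by (rule markov_factor[OF mR _ _ _ ad(3), where a = "\<lambda>((x, t), u, y, w). t" and b = "\<lambda>((x, t), u, y, w). u"
          and c = "\<lambda>((x, t), u, y, w). (x, y)"]) simp_all
    show "markov Q' (rT && rU) rX rY"
      by (rule markov_factor[OF mR _ _ _ ad(4), where a = "\<lambda>((x, t), u, y, w). (t, u)" and b = "\<lambda>((x, t), u, y, w). x"
          and c = "\<lambda>((x, t), u, y, w). y"]) simp_all
    show "markov Q' rV (rX && rT) (rU && rY && rW)"
      by (rule markov'[OF ad(5), where \<pi> = "\<lambda>(v, x). v"]) simp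
    show "markov Q' (rV && rX && rT) (rU && rY) rW"
      by (rule markov'[OF ad(6), where \<pi> = "\<lambda>((v, x, t), u, y). v"]) simp
  qed
  then obtain sV' sW' where adm': "admissible p f Q' sV' sW'" by blast
  have e: "ent Q' rY = ent Q rY" "ent Q' rX = ent Q rX"
    "ent Q' (rX && rY) = ent Q (rX && rY)"
    "ent Q' (rT && rU && rY) = ent Q (rT && rU && rY)"
    "ent Q' (rT && rX && rU && rY) = ent Q (rT && rX && rU && rY)"
    "ent Q' (rT && rW && rU && rY) = ent Q (rT && rW && rU && rY)"
    "ent Q' (rT && rW) = ent Q (rT && rW)"
    "ent Q' (rT && rX) = ent Q (rT && rX)"
    by (rule ent_factor[OF mR, where h = "\<lambda>((x, t), u, y, w). y"], simp)
      (rule ent_factor[OF mR, where h = "\<lambda>((x, t), u, y, w). x"], simp,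
       rule ent_factor[OF mR, where h = "\<lambda>((x, t), u, y, w). (x, y)"], simp,
       rule ent_factor[OF mR, where h = "\<lambda>((x, t), u, y, w). (t, u, y)"], simp,
       rule ent_factor[OF mR, where h = "\<lambda>((x, t), u, y, w). (t, x, u, y)"], simp,
       rule ent_factor[OF mR, where h = "\<lambda>((x, t), u, y, w). (t, w, u, y)"], simp,
       rule ent_factor[OF mR, where h = "\<lambda>((x, t), u, y, w). (t, w)"], simp,
       rule ent_factor[OF mR, where h = "\<lambda>((x, t), u, y, w). (t, x)"], simp)
  have d1: "ent Q' ?VTW - ent Q' ?VT = (\<Sum>\<omega>\<in>set_pmf Q. pmf Q' \<omega> * (lp Q ?VT \<omega> - lp Q ?VTW \<omega>))"
    by (rule ent_diff'[where \<pi> = fst and \<pi>' = fst]) auto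
  have d2: "ent Q' ?VTW - ent Q' ?VTX = (\<Sum>\<omega>\<in>set_pmf Q. pmf Q' \<omega> * (lp Q ?VTX \<omega> - lp Q ?VTW \<omega>))"
    by (rule ent_diff'[where \<pi> = fst and \<pi>' = fst]) auto
  have eq': "ent Q' ?VTW - ent Q' ?VT = ent Q ?VTW - ent Q ?VT"
    unfolding d1 ent_diff[OF fin] by (rule eq[OF zero_less_one])
  have le': "ent Q' ?VTW - ent Q' ?VTX \<le> ent Q ?VTW - ent Q ?VTX"
    unfolding d2 ent_diff[OF fin] by (rule le)
  have "aux_region Q \<subseteq> aux_region Q'"
    by (rule aux_region_mono; unfold admissible_rates(1,3,4,5)[OF adm] admissible_rates(1,3,4,5)[OF adm'] e)
      (use eq' le' in linarith)+
  moreover have "card (?XT ` set_pmf Q) \<le> card (rT ` set_pmf Q) * CARD('x)"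
  proof -
    have "?XT ` set_pmf Q \<subseteq> UNIV \<times> rT ` set_pmf Q" by auto
    then have "card (?XT ` set_pmf Q) \<le> card ((UNIV :: 'x set) \<times> rT ` set_pmf Q)"
      using fin by (intro card_mono) auto
    then show ?thesis by (simp add: card_cartesian_product mult.commute)
  qed
  then have "card (rV ` set_pmf Q') \<le> card (rT ` set_pmf Q) * CARD('x) + 1" using crd by linarith
  ultimately show ?thesis using adm' set_subset by (intro exI[of _ Q'] exI[of _ sV'] exI[of _ sW'] conjI)
qed

text \<open>The mirror image, with (U,Y) in place of (X,T). H(V,T,W) - H(T,W) is preserved for R_X,
  and H(V,T,W) - H(T,W,U,Y) may drop. Both chains that involve W are reversed, since
  \<open>markov'\<close> expects the reweighted variable among the left and middle ones.\<close>

lemma reduce_W: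
  fixes p :: "('x::finite \<times> 'y::finite) pmf"
  assumes adm: "admissible p f Q sV sW"
  shows "\<exists>Q' sV' sW'. admissible p f Q' sV' sW' \<and> aux_region Q \<subseteq> aux_region Q' \<and> set_pmf Q' \<subseteq> set_pmf Q
     \<and> card (rW ` set_pmf Q') \<le> card (rU ` set_pmf Q') * CARD('y) + 1"
proof -
  note ad = admissibleD[OF adm]
  note fin = ad(1)
  let ?VTW = "\<lambda>\<omega>::('x,'y) jnt. (rV \<omega>, rT \<omega>, rW \<omega>)" and ?TW = "\<lambda>\<omega>::('x,'y) jnt. (rT \<omega>, rW \<omega>)"
    and ?TWUY = "\<lambda>\<omega>::('x,'y) jnt. (rT \<omega>, rW \<omega>, rU \<omega>, rY \<omega>)" and ?UY = "\<lambda>\<omega>::('x,'y) jnt. (rU \<omega>, rY \<omega>)"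
    and ?R = "\<lambda>\<omega>::('x,'y) jnt. ((rU \<omega>, rY \<omega>), rV \<omega>, rX \<omega>, rT \<omega>)"
  obtain Q' r where rw: "reweighting Q Q' rW r" and mUY: "map_pmf ?UY Q' = map_pmf ?UY Q"
    and eq: "\<And>j::nat. j < 1 \<Longrightarrow> (\<Sum>\<omega>\<in>set_pmf Q. pmf Q' \<omega> * (lp Q ?TW \<omega> - lp Q ?VTW \<omega>))
        = (\<Sum>\<omega>\<in>set_pmf Q. pmf Q \<omega> * (lp Q ?TW \<omega> - lp Q ?VTW \<omega>))"
    and le: "(\<Sum>\<omega>\<in>set_pmf Q. pmf Q' \<omega> * (lp Q ?TWUY \<omega> - lp Q ?VTW \<omega>))
        \<le> (\<Sum>\<omega>\<in>set_pmf Q. pmf Q \<omega> * (lp Q ?TWUY \<omega> - lp Q ?VTW \<omega>))"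
    and crd: "card (rW ` set_pmf Q') \<le> card (?UY ` set_pmf Q) + 1"
    using reweight_reduce[OF fin, of rW ?UY 1 "\<lambda>_ \<omega>. lp Q ?TW \<omega> - lp Q ?VTW \<omega>" "\<lambda>\<omega>. lp Q ?TWUY \<omega> - lp Q ?VTW \<omega>"]
    by (elim exE conjE) blast
  interpret reweighting Q Q' rW r by (rule rw)
  have m4: "markov Q rW (rU && rY) (rV && rX && rT)"
    by (rule iffD1[OF markov_commute ad(6)])
  have m3: "markov Q (rU && rY && rW) (rX && rT) rV"
    by (rule iffD1[OF markov_commute ad(5)])
  have mR: "map_pmf ?R Q' = map_pmf ?R Q"
    by (rule map_pmf_preserved[OF m4, where \<pi> = "\<lambda>(w, x). w", OF _ mUY]) simp
  have "\<exists>sV' sW'. admissible p f Q' sV' sW'"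
  proof (rule admissible_subset[OF adm set_subset])
    show "map_pmf (rX && rY) Q' = p"
      unfolding ad(2)[symmetric] by (rule map_pmf_factor[OF mR, where h = "\<lambda>((u, y), v, x, t). (x, y)"]) simp
    show "markov Q' rT rU (rX && rY)"
      by (rule markov_factor[OF mR _ _ _ ad(3), where a = "\<lambda>((u, y), v, x, t). t" and b = "\<lambda>((u, y), v, x, t). u"
          and c = "\<lambda>((u, y), v, x, t). (x, y)"]) simp_all
    show "markov Q' (rT && rU) rX rY"
      by (rule markov_factor[OF mR _ _ _ ad(4), where a = "\<lambda>((u, y), v, x, t). (t, u)" and b = "\<lambda>((u, y), v, x, t). x"
          and c = "\<lambda>((u, y), v, x, t). y"]) simp_all
    show "markov Q' rV (rX && rT) (rU && rY && rW)"
      by (rule iffD1[OF markov_commute], rule markov'[OF m3, where \<pi> = "\<lambda>((u, y, w), x). w"]) simp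
    show "markov Q' (rV && rX && rT) (rU && rY) rW"
      by (rule iffD1[OF markov_commute], rule markov'[OF m4, where \<pi> = "\<lambda>(w, x). w"]) simp
  qed
  then obtain sV' sW' where adm': "admissible p f Q' sV' sW'" by blast
  have e: "ent Q' rY = ent Q rY" "ent Q' rX = ent Q rX"
    "ent Q' (rX && rY) = ent Q (rX && rY)"
    "ent Q' (rT && rU && rY) = ent Q (rT && rU && rY)"
    "ent Q' (rT && rX && rU && rY) = ent Q (rT && rX && rU && rY)"
    "ent Q' (rV && rT && rX) = ent Q (rV && rT && rX)"
    "ent Q' (rV && rT) = ent Q (rV && rT)"
    "ent Q' (rT && rX) = ent Q (rT && rX)"
    by (rule ent_factor[OF mR, where h = "\<lambda>((u, y), v, x, t). y"], simp)
      (rule ent_factor[OF mR, where h = "\<lambda>((u, y), v, x, t). x"], simp,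
       rule ent_factor[OF mR, where h = "\<lambda>((u, y), v, x, t). (x, y)"], simp,
       rule ent_factor[OF mR, where h = "\<lambda>((u, y), v, x, t). (t, u, y)"], simp,
       rule ent_factor[OF mR, where h = "\<lambda>((u, y), v, x, t). (t, x, u, y)"], simp,
       rule ent_factor[OF mR, where h = "\<lambda>((u, y), v, x, t). (v, t, x)"], simp,
       rule ent_factor[OF mR, where h = "\<lambda>((u, y), v, x, t). (v, t)"], simp,
       rule ent_factor[OF mR, where h = "\<lambda>((u, y), v, x, t). (t, x)"], simp)
  have d1: "ent Q' ?VTW - ent Q' ?TW = (\<Sum>\<omega>\<in>set_pmf Q. pmf Q' \<omega> * (lp Q ?TW \<omega> - lp Q ?VTW \<omega>))"
    by (rule ent_diff'[where \<pi> = "\<lambda>(v, t, w). w" and \<pi>' = snd]) auto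
  have d2: "ent Q' ?VTW - ent Q' ?TWUY = (\<Sum>\<omega>\<in>set_pmf Q. pmf Q' \<omega> * (lp Q ?TWUY \<omega> - lp Q ?VTW \<omega>))"
    by (rule ent_diff'[where \<pi> = "\<lambda>(v, t, w). w" and \<pi>' = "\<lambda>(t, w, u). w"]) auto
  have eq': "ent Q' ?VTW - ent Q' ?TW = ent Q ?VTW - ent Q ?TW"
    unfolding d1 ent_diff[OF fin] by (rule eq[OF zero_less_one])
  have le': "ent Q' ?VTW - ent Q' ?TWUY \<le> ent Q ?VTW - ent Q ?TWUY"
    unfolding d2 ent_diff[OF fin] by (rule le)
  have "aux_region Q \<subseteq> aux_region Q'"
    by (rule aux_region_mono; unfold admissible_rates(1,3,4,5)[OF adm] admissible_rates(1,3,4,5)[OF adm'] e)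
      (use eq' le' in linarith)+
  moreover have "card (?UY ` set_pmf Q) \<le> card (rU ` set_pmf Q') * CARD('y)"
  proof -
    \<comment> \<open>The law of (U,Y) is unchanged, so its support can be read off from
      \<open>Q'\<close>: the bound must refer to the U of the final law.\<close>
    have "?UY ` set_pmf Q = ?UY ` set_pmf Q'" using arg_cong[OF mUY, of set_pmf] by simp
    also have "\<dots> \<subseteq> rU ` set_pmf Q' \<times> UNIV" by auto
    finally have "card (?UY ` set_pmf Q) \<le> card (rU ` set_pmf Q' \<times> (UNIV :: 'y set))"
      using fin' by (intro card_mono) auto
    then show ?thesis by (simp add: card_cartesian_product)
  qed
  then have "card (rW ` set_pmf Q') \<le> card (rU ` set_pmf Q') * CARD('y) + 1" using crd by linarith
  ultimately show ?thesis using adm' set_subset by (intro exI[of _ Q'] exI[of _ sV'] exI[of _ sW'] conjI)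
qed

text \<open>T precedes V because the bound for V multiplies the number of values of T. The
  reductions of V and W only shrink the support, so bounds already reached persist.\<close>

lemma bounded_auxiliaries:
  fixes p :: "('x::finite \<times> 'y::finite) pmf"
  assumes "admissible p f Q sV sW"
  shows "\<exists>Q' sV' sW'. admissible p f Q' sV' sW' \<and> aux_region Q \<subseteq> aux_region Q'
     \<and> card (rT ` set_pmf Q') \<le> CARD('x) + 4
     \<and> card (rV ` set_pmf Q') \<le> (CARD('x) + 4) * CARD('x) + 1
     \<and> card (rW ` set_pmf Q') \<le> card (rU ` set_pmf Q') * CARD('y) + 1"
proof -
  obtain Q1 sV1 sW1 where 1: "admissible p f Q1 sV1 sW1" "aux_region Q \<subseteq> aux_region Q1"
    "card (rT ` set_pmf Q1) \<le> CARD('x) + 4"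
    using reduce_T[OF assms] by blast
  obtain Q2 sV2 sW2 where 2: "admissible p f Q2 sV2 sW2" "aux_region Q1 \<subseteq> aux_region Q2" "set_pmf Q2 \<subseteq> set_pmf Q1"
    "card (rV ` set_pmf Q2) \<le> card (rT ` set_pmf Q1) * CARD('x) + 1"
    using reduce_V[OF 1(1)] by blast
  obtain Q3 sV3 sW3 where 3: "admissible p f Q3 sV3 sW3" "aux_region Q2 \<subseteq> aux_region Q3" "set_pmf Q3 \<subseteq> set_pmf Q2"
    "card (rW ` set_pmf Q3) \<le> card (rU ` set_pmf Q3) * CARD('y) + 1"
    using reduce_W[OF 2(1)] by blast
  note fin = admissibleD(1)[OF 1(1)] admissibleD(1)[OF 2(1)]
  have "card (rT ` set_pmf Q3) \<le> card (rT ` set_pmf Q1)"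
    using fin 2(3) 3(3) by (intro card_mono) auto
  moreover have "card (rV ` set_pmf Q3) \<le> card (rV ` set_pmf Q2)"
    using fin 3(3) by (intro card_mono) auto
  moreover have "card (rT ` set_pmf Q1) * CARD('x) + 1 \<le> (CARD('x) + 4) * CARD('x) + 1"
    using mult_le_mono1[OF 1(3), of "CARD('x)"] by simp
  ultimately have "card (rT ` set_pmf Q3) \<le> CARD('x) + 4" "card (rV ` set_pmf Q3) \<le> (CARD('x) + 4) * CARD('x) + 1"
    using 1(3) 2(4) by linarith+
  moreover have "aux_region Q \<subseteq> aux_region Q3" by (rule subset_trans[OF 1(2) subset_trans[OF 2(2) 3(2)]])
  ultimately show ?thesis
    using 3(1,4) by (intro exI[of _ Q3] exI[of _ sV3] exI[of _ sW3] conjI)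
qed

section \<open>Block codes\<close>

text \<open>Gibbs' inequality. \<open>\<rho>\<close> is the ratio of p(a,c) p(b,c) / p(c) to
  p(a,b,c); its mean is at most 1, and ln r \<le> r - 1.\<close>

lemma cmi_nonneg:
  assumes fin: "finite (set_pmf Q)"
  shows "0 \<le> cmi Q A B C"
proof -
  let ?AC = "A && C" and ?BC = "B && C" and ?ABC = "A && B && C"
  let ?P = "\<lambda>g. pmf (map_pmf g Q)"
  define \<rho> where "\<rho> = (\<lambda>(a, b, c). ?P ?AC (a, c) * ?P ?BC (b, c) / (?P ?ABC (a, b, c) * ?P C c))"
  have lg: "lp Q ?AC \<omega> + lp Q ?BC \<omega> - lp Q ?ABC \<omega> - lp Q C \<omega> \<le> (\<rho> (?ABC \<omega>) - 1) / ln 2" if w: "\<omega> \<in> set_pmf Q" for \<omega>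
  proof -
    have pos: "0 < ?P ?AC (?AC \<omega>)" "0 < ?P ?BC (?BC \<omega>)" "0 < ?P ?ABC (?ABC \<omega>)" "0 < ?P C (C \<omega>)"
      by (rule pmf_map_pos[OF w])+
    have "lp Q ?AC \<omega> + lp Q ?BC \<omega> - lp Q ?ABC \<omega> - lp Q C \<omega> = log 2 (\<rho> (?ABC \<omega>))"
      unfolding lp_def \<rho>_def using pos by (simp add: log_mult_pos log_divide_pos)
    also have "\<dots> = ln (\<rho> (?ABC \<omega>)) / ln 2" by (simp add: log_def)
    also have "\<dots> \<le> (\<rho> (?ABC \<omega>) - 1) / ln 2"
      using pos by (intro divide_right_mono ln_le_minus_one) (auto simp: \<rho>_def)
    finally show ?thesis .
  qed
  let ?SA = "A ` set_pmf Q" and ?SB = "B ` set_pmf Q" and ?SC = "C ` set_pmf Q"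
  have finS: "finite ?SA" "finite ?SB" "finite ?SC" using fin by auto
  have "(\<Sum>\<omega>\<in>set_pmf Q. pmf Q \<omega> * \<rho> (?ABC \<omega>)) = (\<Sum>z\<in>set_pmf (map_pmf ?ABC Q). ?P ?ABC z * \<rho> z)"
    by (rule sum_pmf_map[OF fin])
  also have "\<dots> = (\<Sum>z\<in>set_pmf (map_pmf ?ABC Q). (\<lambda>(a, b, c). ?P ?AC (a, c) * ?P ?BC (b, c) / ?P C c) z)"
  proof (intro sum.cong refl)
    fix z assume "z \<in> set_pmf (map_pmf ?ABC Q)"
    then have "?P ?ABC z \<noteq> 0" unfolding set_pmf_iff .
    then show "?P ?ABC z * \<rho> z = (\<lambda>(a, b, c). ?P ?AC (a, c) * ?P ?BC (b, c) / ?P C c) z"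
      by (cases z) (simp add: \<rho>_def)
  qed
  also have "\<dots> \<le> (\<Sum>z\<in>?SA \<times> ?SB \<times> ?SC. (\<lambda>(a, b, c). ?P ?AC (a, c) * ?P ?BC (b, c) / ?P C c) z)"
    using finS by (intro sum_mono2) auto
  also have "\<dots> = (\<Sum>c\<in>?SC. \<Sum>a\<in>?SA. \<Sum>b\<in>?SB. ?P ?AC (a, c) * ?P ?BC (b, c) / ?P C c)"
    unfolding sum.cartesian_product[symmetric] by (subst (2) sum.swap, subst sum.swap) simp
  also have "\<dots> = (\<Sum>c\<in>?SC. ?P C c)"
  proof (intro sum.cong refl)
    fix c assume "c \<in> ?SC"
    then have "?P C c \<noteq> 0" by (auto simp: pmf_eq_0_set_pmf)
    moreover have "(\<Sum>a\<in>?SA. \<Sum>b\<in>?SB. ?P ?AC (a, c) * ?P ?BC (b, c) / ?P C c)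
       = (\<Sum>a\<in>?SA. ?P ?AC (a, c)) * (\<Sum>b\<in>?SB. ?P ?BC (b, c)) / ?P C c"
      by (simp add: sum_product sum_divide_distrib)
    ultimately show "(\<Sum>a\<in>?SA. \<Sum>b\<in>?SB. ?P ?AC (a, c) * ?P ?BC (b, c) / ?P C c) = ?P C c"
      by (simp flip: pmf_map_fst_sum[OF fin])
  qed
  also have "\<dots> = 1" using fin sum_pmf_eq_1[of ?SC "map_pmf C Q"] by simp
  finally have le1: "(\<Sum>\<omega>\<in>set_pmf Q. pmf Q \<omega> * \<rho> (?ABC \<omega>)) \<le> 1" .
  have "- cmi Q A B C = (\<Sum>\<omega>\<in>set_pmf Q. pmf Q \<omega> * (lp Q ?AC \<omega> + lp Q ?BC \<omega> - lp Q ?ABC \<omega> - lp Q C \<omega>))"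
    unfolding cmi_def ent_eq_sum_lp[OF fin] by (simp add: algebra_simps sum.distrib sum_subtractf)
  also have "\<dots> \<le> (\<Sum>\<omega>\<in>set_pmf Q. pmf Q \<omega> * ((\<rho> (?ABC \<omega>) - 1) / ln 2))"
    by (intro sum_mono mult_left_mono lg) auto
  also have "\<dots> = ((\<Sum>\<omega>\<in>set_pmf Q. pmf Q \<omega> * \<rho> (?ABC \<omega>)) - (\<Sum>\<omega>\<in>set_pmf Q. pmf Q \<omega>)) / ln 2"
    by (simp add: right_diff_distrib sum_subtractf diff_divide_distrib sum_divide_distrib)
  also have "\<dots> \<le> 0" using le1 sum_pmf_eq_1[OF fin order_refl] by (simp add: divide_nonpos_pos)
  finally show ?thesis by simp
qed

text \<open>The conditional law of A given C, completed by a point mass at \<open>a0\<close> where C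
  has probability zero. Normalisation is required for all c, because product kernels are evaluated
  along arbitrary blocks.\<close>

lemma kernel_exists:
  assumes fin: "finite (set_pmf Q)" "finite S" "A ` set_pmf Q \<subseteq> S"
  shows "\<exists>k. (\<forall>c a. 0 \<le> k c a) \<and> (\<forall>c. (\<Sum>a\<in>S. k c a) = (1::real))
     \<and> (\<forall>c a. pmf (map_pmf (C && A) Q) (c, a) = pmf (map_pmf C Q) c * k c a)"
proof -
  obtain \<omega>0 where "\<omega>0 \<in> set_pmf Q" using set_pmf_not_empty[of Q] by blast
  then obtain a0 where a0: "a0 \<in> S" using fin by blast
  let ?P = "pmf (map_pmf C Q)" and ?PA = "pmf (map_pmf (A && C) Q)"
  define k where "k c a = (if ?P c = 0 then of_bool (a = a0) else ?PA (a, c) / ?P c)" for c a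
  have sw: "pmf (map_pmf (C && A) Q) (c, a) = ?PA (a, c)" for c a
    unfolding pmf_map_sum[OF fin(1)] by (intro sum.cong) auto
  have S: "(\<Sum>a\<in>S. ?PA (a, c)) = ?P c" for c
    unfolding pmf_map_fst_sum[OF fin(1), of C c A]
    by (rule sum.mono_neutral_right) (use fin in \<open>auto simp: pmf_eq_0_set_pmf\<close>)
  have "(\<Sum>a\<in>S. k c a) = 1" for c
  proof (cases "?P c = 0")
    case True
    then have "(\<Sum>a\<in>S. k c a) = (\<Sum>a\<in>S. if a = a0 then 1 else 0)"
      by (intro sum.cong) (auto simp: k_def)
    then show ?thesis using a0 fin by (simp add: sum.delta)
  next
    case False
    then show ?thesis by (simp add: k_def S flip: sum_divide_distrib)
  qed
  moreover have "?PA (a, c) = ?P c * k c a" for c a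
  proof (cases "?P c = 0")
    case True
    then have "c \<notin> C ` set_pmf Q" by (auto simp: pmf_eq_0_set_pmf)
    then have "?PA (a, c) = 0" by (auto simp: pmf_eq_0_set_pmf)
    then show ?thesis using True by simp
  qed (simp add: k_def)
  ultimately show ?thesis unfolding sw by (intro exI[of _ k]) (auto simp: k_def)
qed

section \<open>Sums over blocks and second moments\<close>

definition lists_n :: "'a set \<Rightarrow> nat \<Rightarrow> 'a list set" where
  "lists_n A n = {xs. set xs \<subseteq> A \<and> length xs = n}"

lemma finite_lists_n: "finite A \<Longrightarrow> finite (lists_n A n)"
  unfolding lists_n_def by (rule finite_lists_length_eq)

lemma lists_n_0: "lists_n A 0 = {[]}"
  by (auto simp: lists_n_def)

lemma sum_lists_n_Suc:
  "(\<Sum>xs\<in>lists_n A (Suc n). F xs) = (\<Sum>a\<in>A. \<Sum>xs\<in>lists_n A n. F (a # xs))"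
proof -
  have e: "lists_n A (Suc n) = (\<lambda>(a, xs). a # xs) ` (A \<times> lists_n A n)"
    by (auto simp: lists_n_def length_Suc_conv image_iff)
  have "inj_on (\<lambda>(a, xs). a # xs) (A \<times> lists_n A n)" by (auto simp: inj_on_def)
  then show ?thesis
    unfolding e by (simp add: sum.reindex sum.cartesian_product case_prod_unfold)
qed

text \<open>The distributive law. The factors may depend on the position, as they do for a
  conditional kernel along a fixed block.\<close>

lemma sum_prod_lists_n:
  fixes g :: "nat \<Rightarrow> 'a \<Rightarrow> real"
  shows "(\<Sum>xs\<in>lists_n A n. \<Prod>i<n. g i (xs ! i)) = (\<Prod>i<n. \<Sum>a\<in>A. g i a)"
proof (induction n arbitrary: g)
  case 0
  then show ?case by (simp add: lists_n_0)
next
  case (Suc n)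
  have "(\<Sum>xs\<in>lists_n A (Suc n). \<Prod>i<Suc n. g i (xs ! i))
      = (\<Sum>a\<in>A. g 0 a * (\<Sum>xs\<in>lists_n A n. \<Prod>i<n. g (Suc i) (xs ! i)))"
    unfolding sum_lists_n_Suc prod.lessThan_Suc_shift by (simp add: sum_distrib_left)
  also have "\<dots> = (\<Sum>a\<in>A. g 0 a) * (\<Prod>i<n. \<Sum>a\<in>A. g (Suc i) a)"
    unfolding Suc.IH[of "\<lambda>i. g (Suc i)"] by (simp add: sum_distrib_right)
  also have "\<dots> = (\<Prod>i<Suc n. \<Sum>a\<in>A. g i a)" unfolding prod.lessThan_Suc_shift by simp
  finally show ?case .
qed

lemma sum_lists_n_Times:
  "(\<Sum>zs\<in>lists_n (A \<times> B) n. F (map fst zs) (map snd zs)) = (\<Sum>xs\<in>lists_n A n. \<Sum>ys\<in>lists_n B n. F xs ys)"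
proof -
  have "(\<Sum>zs\<in>lists_n (A \<times> B) n. F (map fst zs) (map snd zs)) = (\<Sum>(xs, ys)\<in>lists_n A n \<times> lists_n B n. F xs ys)"
  proof (rule sum.reindex_bij_witness[where i = "\<lambda>(xs, ys). zip xs ys" and j = "\<lambda>zs. (map fst zs, map snd zs)"])
    fix zs assume "zs \<in> lists_n (A \<times> B) n"
    then show "(map fst zs, map snd zs) \<in> lists_n A n \<times> lists_n B n" by (auto simp: lists_n_def)
  next
    fix q assume "q \<in> lists_n A n \<times> lists_n B n"
    then show "(case q of (xs, ys) \<Rightarrow> zip xs ys) \<in> lists_n (A \<times> B) n"
      by (auto simp: lists_n_def dest: set_zip_leftD set_zip_rightD)
  qed (auto simp: lists_n_def zip_map_fst_snd)
  then show ?thesis by (simp add: sum.cartesian_product)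
qed

text \<open>Both moments are proved in one induction: in the square for n + 1 letters the cross term
  vanishes by the first moment for n letters.\<close>

lemma lists_n_moments:
  fixes q h :: "'a \<Rightarrow> real"
  assumes q: "(\<Sum>a\<in>A. q a) = 1" and h: "(\<Sum>a\<in>A. q a * h a) = 0"
  shows "(\<Sum>zs\<in>lists_n A n. (\<Prod>i<n. q (zs ! i)) * (\<Sum>i<n. h (zs ! i))) = 0"
    and "(\<Sum>zs\<in>lists_n A n. (\<Prod>i<n. q (zs ! i)) * (\<Sum>i<n. h (zs ! i))\<^sup>2) = real n * (\<Sum>a\<in>A. q a * (h a)\<^sup>2)"
proof (induction n)
  case 0
  {
    case 1
    then show ?case by simp
  next
    case 2
    then show ?case by (simp add: lists_n_0)
  }
next
  case (Suc n)
  let ?w = "\<lambda>zs. \<Prod>i<n. q (zs ! i)" and ?s = "\<lambda>zs. \<Sum>i<n. h (zs ! i)"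
  have w1: "(\<Sum>zs\<in>lists_n A n. ?w zs) = 1" unfolding sum_prod_lists_n[of "\<lambda>_. q"] using q by simp
  {
    case 1
    have "(\<Sum>zs\<in>lists_n A (Suc n). (\<Prod>i<Suc n. q (zs ! i)) * (\<Sum>i<Suc n. h (zs ! i)))
      = (\<Sum>a\<in>A. \<Sum>zs\<in>lists_n A n. q a * h a * ?w zs + q a * (?w zs * ?s zs))"
      unfolding sum_lists_n_Suc prod.lessThan_Suc_shift sum.lessThan_Suc_shift
      by (intro sum.cong refl) (simp add: algebra_simps)
    also have "\<dots> = (\<Sum>a\<in>A. q a * h a)"
      unfolding sum.distrib sum_distrib_left[symmetric] using Suc.IH(1) w1 by simp
    finally show ?case using h by simp
  next
    case 2
    have "(\<Sum>zs\<in>lists_n A (Suc n). (\<Prod>i<Suc n. q (zs ! i)) * (\<Sum>i<Suc n. h (zs ! i))\<^sup>2)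
      = (\<Sum>a\<in>A. \<Sum>zs\<in>lists_n A n. q a * (h a)\<^sup>2 * ?w zs + 2 * (q a * h a) * (?w zs * ?s zs) + q a * (?w zs * (?s zs)\<^sup>2))"
      unfolding sum_lists_n_Suc prod.lessThan_Suc_shift sum.lessThan_Suc_shift
      by (intro sum.cong refl) (simp add: algebra_simps power2_sum)
    also have "\<dots> = (\<Sum>a\<in>A. q a * (h a)\<^sup>2) + (\<Sum>a\<in>A. q a) * (real n * (\<Sum>a\<in>A. q a * (h a)\<^sup>2))"
      unfolding sum.distrib sum_distrib_left[symmetric] Suc.IH w1 by (simp add: sum_distrib_right)
    finally show ?case using q by (simp add: algebra_simps)
  }
qed

lemma lists_n_chebyshev:
  fixes q h :: "'a \<Rightarrow> real"
  assumes q: "(\<Sum>a\<in>A. q a) = 1" "\<And>a. 0 \<le> q a" and h: "(\<Sum>a\<in>A. q a * h a) = 0"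
    and d: "\<delta> > 0" and n: "n > 0"
  shows "(\<Sum>zs\<in>lists_n A n. (\<Prod>i<n. q (zs ! i)) * of_bool (\<bar>\<Sum>i<n. h (zs ! i)\<bar> \<ge> real n * \<delta>))
     \<le> (\<Sum>a\<in>A. q a * (h a)\<^sup>2) / (real n * \<delta>\<^sup>2)"
proof -
  have nd: "0 < real n * \<delta>" using d n by simp
  have pw: "of_bool (\<bar>s\<bar> \<ge> real n * \<delta>) \<le> s\<^sup>2 / (real n * \<delta>)\<^sup>2" for s :: real
  proof (cases "\<bar>s\<bar> \<ge> real n * \<delta>")
    case True
    then have "(real n * \<delta>)\<^sup>2 \<le> \<bar>s\<bar>\<^sup>2" using nd by (intro power_mono) auto
    moreover have "0 < (real n * \<delta>)\<^sup>2" using nd by (rule zero_less_power)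
    ultimately have "1 \<le> s\<^sup>2 / (real n * \<delta>)\<^sup>2" by (subst le_divide_eq_1_pos) auto
    then show ?thesis using True by simp
  qed simp
  have "(\<Sum>zs\<in>lists_n A n. (\<Prod>i<n. q (zs ! i)) * of_bool (\<bar>\<Sum>i<n. h (zs ! i)\<bar> \<ge> real n * \<delta>))
      \<le> (\<Sum>zs\<in>lists_n A n. (\<Prod>i<n. q (zs ! i)) * ((\<Sum>i<n. h (zs ! i))\<^sup>2 / (real n * \<delta>)\<^sup>2))"
    using q(2) by (intro sum_mono mult_left_mono pw prod_nonneg) auto
  also have "\<dots> = (real n * (\<Sum>a\<in>A. q a * (h a)\<^sup>2)) / (real n * \<delta>)\<^sup>2"
    unfolding lists_n_moments(2)[OF q(1) h, symmetric] by (simp add: sum_divide_distrib)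
  also have "\<dots> = (\<Sum>a\<in>A. q a * (h a)\<^sup>2) / (real n * \<delta>\<^sup>2)"
    using n by (simp add: power2_eq_square)
  finally show ?thesis .
qed

section \<open>Typical sequences: counting and concentration\<close>

lemma card_heavy_le:
  fixes w :: "'a \<Rightarrow> real"
  assumes "finite S" "\<And>s. s \<in> S \<Longrightarrow> 0 \<le> w s" "(\<Sum>s\<in>S. w s) \<le> 1" "\<theta> > 0"
  shows "real (card {s\<in>S. w s \<ge> \<theta>}) \<le> 1 / \<theta>"
proof -
  have "real (card {s\<in>S. w s \<ge> \<theta>}) * \<theta> = (\<Sum>s\<in>{s\<in>S. w s \<ge> \<theta>}. \<theta>)" by simp
  also have "\<dots> \<le> (\<Sum>s\<in>{s\<in>S. w s \<ge> \<theta>}. w s)" by (intro sum_mono) auto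
  also have "\<dots> \<le> (\<Sum>s\<in>S. w s)" using assms by (intro sum_mono2) auto
  finally show ?thesis using assms by (simp add: field_simps)
qed

text \<open>A weak law for the exponent of a product kernel, with \<open>B\<close> uniform in n and
  \<delta>. The upper tail measures conditional atoms too heavy for thinning, the lower tail the
  sequences missing from a typical set; the strictness of the inequalities fits these two
  uses.\<close>

definition dev_bound :: "'o pmf \<Rightarrow> 'o set \<Rightarrow> ('o \<Rightarrow> real) \<Rightarrow> real \<Rightarrow> real \<Rightarrow> bool" where
  "dev_bound Q \<Omega> \<kappa> \<mu> B \<longleftrightarrow> (\<forall>n \<delta>. n > 0 \<longrightarrow> \<delta> > 0 \<longrightarrow>
     (\<Sum>zs\<in>lists_n \<Omega> n. (\<Prod>i<n. pmf Q (zs ! i)) * of_bool ((\<Prod>i<n. \<kappa> (zs ! i)) > 2 powr - (real n * (\<mu> - \<delta>))))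
       \<le> B / (real n * \<delta>\<^sup>2)
   \<and> (\<Sum>zs\<in>lists_n \<Omega> n. (\<Prod>i<n. pmf Q (zs ! i)) * of_bool (\<not> (\<Prod>i<n. \<kappa> (zs ! i)) \<ge> 2 powr - (real n * (\<mu> + \<delta>))))
       \<le> B / (real n * \<delta>\<^sup>2))"

lemma dev_bound_mono:
  assumes "dev_bound Q \<Omega> \<kappa> \<mu> B" "B \<le> B'"
  shows "dev_bound Q \<Omega> \<kappa> \<mu> B'"
proof -
  have "B / (real n * \<delta>\<^sup>2) \<le> B' / (real n * \<delta>\<^sup>2)" for n \<delta>
    using assms(2) by (intro divide_right_mono) auto
  then show ?thesis using assms(1) unfolding dev_bound_def by (blast intro: order_trans)
qed

text \<open>Chebyshev's inequality for the centred logarithms of \<open>\<kappa>\<close>. Blocks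
  that leave the support, where \<open>\<kappa>\<close> may vanish, have weight zero.\<close>

lemma dev_bound_exists:
  assumes \<Omega>: "finite \<Omega>" "set_pmf Q \<subseteq> \<Omega>" and pos: "\<And>\<omega>. \<omega> \<in> set_pmf Q \<Longrightarrow> \<kappa> \<omega> > 0"
    and \<mu>: "\<mu> = - (\<Sum>\<omega>\<in>set_pmf Q. pmf Q \<omega> * log 2 (\<kappa> \<omega>))"
  shows "\<exists>B. dev_bound Q \<Omega> \<kappa> \<mu> B"
proof -
  define h where "h \<omega> = log 2 (\<kappa> \<omega>) + \<mu>" for \<omega>
  have ext: "(\<Sum>\<omega>\<in>\<Omega>. pmf Q \<omega> * g \<omega>) = (\<Sum>\<omega>\<in>set_pmf Q. pmf Q \<omega> * g \<omega>)" for g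
    using \<Omega> by (intro sum.mono_neutral_right) (auto simp: set_pmf_iff)
  have fin: "finite (set_pmf Q)" using \<Omega> by (rule finite_subset[rotated])
  have q1: "(\<Sum>\<omega>\<in>\<Omega>. pmf Q \<omega>) = 1" using \<Omega> by (rule sum_pmf_eq_1)
  have q1': "(\<Sum>\<omega>\<in>set_pmf Q. pmf Q \<omega>) = 1" using fin by (rule sum_pmf_eq_1) simp
  have h0: "(\<Sum>\<omega>\<in>\<Omega>. pmf Q \<omega> * h \<omega>) = 0"
    unfolding ext h_def distrib_left sum.distrib sum_distrib_right[symmetric] q1' using \<mu> q1 by simp
  define B where "B = (\<Sum>\<omega>\<in>\<Omega>. pmf Q \<omega> * (h \<omega>)\<^sup>2)"
  have "dev_bound Q \<Omega> \<kappa> \<mu> B"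
    unfolding dev_bound_def
  proof (intro allI impI)
    fix n :: nat and \<delta> :: real assume n: "n > 0" and d: "\<delta> > 0"
    have prod: "(\<Prod>i<n. \<kappa> (zs ! i)) = 2 powr ((\<Sum>i<n. h (zs ! i)) - real n * \<mu>)" if "\<And>i. i < n \<Longrightarrow> zs ! i \<in> set_pmf Q" for zs
    proof -
      have "(\<Prod>i<n. \<kappa> (zs ! i)) = (\<Prod>i<n. 2 powr (log 2 (\<kappa> (zs ! i))))"
        using that pos by (intro prod.cong) auto
      also have "\<dots> = 2 powr (\<Sum>i<n. log 2 (\<kappa> (zs ! i)))" by (subst powr_sum) auto
      also have "(\<Sum>i<n. log 2 (\<kappa> (zs ! i))) = (\<Sum>i<n. h (zs ! i)) - real n * \<mu>"
        by (simp add: h_def sum.distrib)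
      finally show ?thesis .
    qed
    have gen: "(\<Sum>zs\<in>lists_n \<Omega> n. (\<Prod>i<n. pmf Q (zs ! i)) * of_bool (R zs)) \<le> B / (real n * \<delta>\<^sup>2)"
      if R: "\<And>zs. (\<And>i. i < n \<Longrightarrow> zs ! i \<in> set_pmf Q) \<Longrightarrow> R zs \<Longrightarrow> \<bar>\<Sum>i<n. h (zs ! i)\<bar> \<ge> real n * \<delta>" for R
    proof -
      have "(\<Sum>zs\<in>lists_n \<Omega> n. (\<Prod>i<n. pmf Q (zs ! i)) * of_bool (R zs))
          \<le> (\<Sum>zs\<in>lists_n \<Omega> n. (\<Prod>i<n. pmf Q (zs ! i)) * of_bool (\<bar>\<Sum>i<n. h (zs ! i)\<bar> \<ge> real n * \<delta>))"
      proof (rule sum_mono)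
        fix zs
        show "(\<Prod>i<n. pmf Q (zs ! i)) * of_bool (R zs) \<le> (\<Prod>i<n. pmf Q (zs ! i)) * of_bool (\<bar>\<Sum>i<n. h (zs ! i)\<bar> \<ge> real n * \<delta>)"
        proof (cases "\<forall>i<n. zs ! i \<in> set_pmf Q")
          case True
          then show ?thesis using R[of zs] by (intro mult_left_mono prod_nonneg) auto
        next
          case False
          then have z: "(\<Prod>i<n. pmf Q (zs ! i)) = 0" by (auto simp: set_pmf_iff)
          show ?thesis unfolding z by simp
        qed
      qed
      also have "\<dots> \<le> B / (real n * \<delta>\<^sup>2)"
        unfolding B_def by (rule lists_n_chebyshev[OF q1 _ h0 d n]) simp
      finally show ?thesis .
    qed
    show "(\<Sum>zs\<in>lists_n \<Omega> n. (\<Prod>i<n. pmf Q (zs ! i)) * of_bool ((\<Prod>i<n. \<kappa> (zs ! i)) > 2 powr - (real n * (\<mu> - \<delta>))))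
          \<le> B / (real n * \<delta>\<^sup>2)
      \<and> (\<Sum>zs\<in>lists_n \<Omega> n. (\<Prod>i<n. pmf Q (zs ! i)) * of_bool (\<not> (\<Prod>i<n. \<kappa> (zs ! i)) \<ge> 2 powr - (real n * (\<mu> + \<delta>))))
          \<le> B / (real n * \<delta>\<^sup>2)"
    proof (intro conjI gen)
      fix zs assume s: "\<And>i. i < n \<Longrightarrow> zs ! i \<in> set_pmf Q" and "(\<Prod>i<n. \<kappa> (zs ! i)) > 2 powr - (real n * (\<mu> - \<delta>))"
      then have "(\<Sum>i<n. h (zs ! i)) - real n * \<mu> > - (real n * (\<mu> - \<delta>))" by (simp add: prod)
      then show "\<bar>\<Sum>i<n. h (zs ! i)\<bar> \<ge> real n * \<delta>" by (simp add: algebra_simps)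
    next
      fix zs assume s: "\<And>i. i < n \<Longrightarrow> zs ! i \<in> set_pmf Q" and "\<not> (\<Prod>i<n. \<kappa> (zs ! i)) \<ge> 2 powr - (real n * (\<mu> + \<delta>))"
      then have "(\<Sum>i<n. h (zs ! i)) - real n * \<mu> < - (real n * (\<mu> + \<delta>))" by (simp add: prod)
      then show "\<bar>\<Sum>i<n. h (zs ! i)\<bar> \<ge> real n * \<delta>" by (simp add: algebra_simps)
    qed
  qed
  then show ?thesis by blast
qed

text \<open>Minus the logarithm of the kernel has mean H(A|C), the exponent of the equipartition
  property. The lemma serves both the kernels of the encoders and those by which competitors are
  counted.\<close>

lemma typical_kernel_exists:
  assumes \<Omega>: "finite \<Omega>" "set_pmf Q \<subseteq> \<Omega>" and S: "finite S" "A ` set_pmf Q \<subseteq> S"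
  shows "\<exists>k B. (\<forall>c a. 0 \<le> k c a) \<and> (\<forall>c. (\<Sum>a\<in>S. k c a) = (1::real))
     \<and> (\<forall>c a. pmf (map_pmf (C && A) Q) (c, a) = pmf (map_pmf C Q) c * k c a)
     \<and> dev_bound Q \<Omega> (\<lambda>\<omega>. k (C \<omega>) (A \<omega>)) (ent Q (C && A) - ent Q C) B"
proof -
  have fin: "finite (set_pmf Q)" using \<Omega> by (rule finite_subset[rotated])
  obtain k where k: "\<forall>c a. 0 \<le> k c a" "\<forall>c. (\<Sum>a\<in>S. k c a) = 1"
    "\<forall>c a. pmf (map_pmf (C && A) Q) (c, a) = pmf (map_pmf C Q) c * k c a"
    using kernel_exists[OF fin S, of C] by blast
  have pos: "k (C \<omega>) (A \<omega>) > 0" and lg: "log 2 (k (C \<omega>) (A \<omega>)) = lp Q (C && A) \<omega> - lp Q C \<omega>"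
    if w: "\<omega> \<in> set_pmf Q" for \<omega>
  proof -
    note p1 = pmf_map_pos[OF w, of "C && A"] and p2 = pmf_map_pos[OF w, of C]
    have e: "pmf (map_pmf (C && A) Q) (C \<omega>, A \<omega>) = pmf (map_pmf C Q) (C \<omega>) * k (C \<omega>) (A \<omega>)" using k(3) by blast
    show "k (C \<omega>) (A \<omega>) > 0" using p1 p2 unfolding e by (simp add: zero_less_mult_iff)
    then show "log 2 (k (C \<omega>) (A \<omega>)) = lp Q (C && A) \<omega> - lp Q C \<omega>"
      unfolding lp_def e using p2 by (simp add: log_mult_pos)
  qed
  have "ent Q (C && A) - ent Q C = - (\<Sum>\<omega>\<in>set_pmf Q. pmf Q \<omega> * log 2 (k (C \<omega>) (A \<omega>)))"
    unfolding ent_eq_sum_lp[OF fin] using lg by (simp add: right_diff_distrib sum_subtractf)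
  from dev_bound_exists[where \<kappa> = "\<lambda>\<omega>. k (C \<omega>) (A \<omega>)", OF \<Omega> pos this] obtain B
    where "dev_bound Q \<Omega> (\<lambda>\<omega>. k (C \<omega>) (A \<omega>)) (ent Q (C && A) - ent Q C) B" by blast
  with k show ?thesis by blast
qed

lemma sum_six_lists:
  fixes G :: "'x list \<Rightarrow> 'y list \<Rightarrow> nat list \<Rightarrow> nat list \<Rightarrow> nat list \<Rightarrow> nat list \<Rightarrow> real"
  shows "(\<Sum>xs\<in>lists_n SX n. \<Sum>ys\<in>lists_n SY n. \<Sum>ts\<in>lists_n ST n. \<Sum>us\<in>lists_n SU n. \<Sum>vs\<in>lists_n SV n. \<Sum>ws\<in>lists_n SW n.
      G xs ys ts us vs ws)
    = (\<Sum>zs\<in>lists_n (SX \<times> SY \<times> ST \<times> SU \<times> SV \<times> SW) n.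
        G (map rX zs) (map rY zs) (map rT zs) (map rU zs) (map rV zs) (map rW zs))"
proof -
  have r: "rX = fst" "rY = (\<lambda>\<omega>. fst (snd \<omega>))" "rT = (\<lambda>\<omega>. fst (snd (snd \<omega>)))" "rU = (\<lambda>\<omega>. fst (snd (snd (snd \<omega>))))"
    "rV = (\<lambda>\<omega>. fst (snd (snd (snd (snd \<omega>)))))" "rW = (\<lambda>\<omega>. snd (snd (snd (snd (snd \<omega>)))))"
    by (auto simp: rX_def rY_def rT_def rU_def rV_def rW_def)
  show ?thesis
    unfolding sum_lists_n_Times[symmetric] r by (simp add: o_def)
qed

text \<open>One inequality for each kind of competitor: the exponent of the number of typical
  competitors against thinning exponents plus bin rates. Four of them are the rate bounds rewritten.
  The second follows from the first by H(T|X) \<le> H(T|Y), due to T - X - Y, and the fourth from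
  the third by H(T|X) \<le> H(T).\<close>

lemma rate_conditions:
  assumes adm: "admissible p f Q sV sW" and R: "(R0, RX, RY) \<in> aux_region Q"
  defines "hT \<equiv> ent Q (rX && rT) - ent Q rX"
    and "hU \<equiv> ent Q ((rX && rT) && rU) - ent Q (rX && rT)"
    and "hV \<equiv> ent Q ((rX && rT) && rV) - ent Q (rX && rT)"
    and "hW \<equiv> ent Q ((rT && rU && rY) && rW) - ent Q (rT && rU && rY)"
  shows "ent Q (rY && rT && rU) - ent Q rY < hT + hU + R0" (is ?g1)
    and "ent Q ((rT && rY) && rU) - ent Q (rT && rY) < hU + R0" (is ?g2)
    and "ent Q (\<lambda>\<omega>. ((), rT \<omega>, rV \<omega>, rW \<omega>)) - ent Q (\<lambda>_. ()) < hT + hV + hW + RX + RY" (is ?g3)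
    and "ent Q (rT && rV && rW) - ent Q rT < hV + hW + RX + RY" (is ?g4)
    and "ent Q ((rT && rW) && rV) - ent Q (rT && rW) < hV + RX" (is ?g5)
    and "ent Q ((rT && rV) && rW) - ent Q (rT && rV) < hW + RY" (is ?g6)
    and "0 \<le> R0" "0 \<le> RX" "0 \<le> RY"
proof -
  note ad = admissibleD[OF adm]
  note fin = ad(1)
  note ec = ent_cong[OF fin]
  note rates = admissible_rates[OF adm]
  have R0: "R0 > cmi Q rX rU rY"
    and RX: "RX > cmi Q rV rX (rT && rW)"
    and RY: "RY > cmi Q (rU && rY) rW (rV && rT)"
    and RXY: "RX + RY > cmi Q (rX && rY) (rV && rT && rW) (\<lambda>_. ())
               + cmi Q rU rW (rV && rX && rT && rY)"
    using R by (auto simp: aux_region_def)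
  show "0 \<le> R0" "0 \<le> RX" "0 \<le> RY"
    using R0 RX RY cmi_nonneg[OF fin, of rX rU rY] cmi_nonneg[OF fin, of rV rX "rT && rW"]
      cmi_nonneg[OF fin, of "rU && rY" rW "rV && rT"] by linarith+
  have e1: "ent Q (rX && rT) = ent Q (rT && rX)" by (rule ec) auto
  have e2: "ent Q ((rX && rT) && rU) = ent Q (rT && rX && rU)" by (rule ec) auto
  have e3: "ent Q ((rX && rT) && rV) = ent Q (rV && rT && rX)" by (rule ec) auto
  have e4: "ent Q ((rT && rU && rY) && rW) = ent Q (rT && rW && rU && rY)" by (rule ec) auto
  have e5: "ent Q (rY && rT && rU) = ent Q (rT && rU && rY)" by (rule ec) auto
  have e6: "ent Q ((rT && rY) && rU) = ent Q (rT && rU && rY)" by (rule ec) auto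
  have e7: "ent Q (\<lambda>\<omega>. ((), rT \<omega>, rV \<omega>, rW \<omega>)) = ent Q (rV && rT && rW)" by (rule ec) auto
  have e8: "ent Q (rT && rV && rW) = ent Q (rV && rT && rW)" by (rule ec) auto
  have e9: "ent Q ((rT && rW) && rV) = ent Q (rV && rT && rW)" by (rule ec) auto
  have e10: "ent Q ((rT && rV) && rW) = ent Q (rV && rT && rW)" by (rule ec) auto
  have e11: "ent Q (rT && rV) = ent Q (rV && rT)" by (rule ec) auto
  have e12: "ent Q (\<lambda>_. ()) = 0" by (simp add: ent_def)
  have e13: "ent Q (\<lambda>\<omega>. (rT \<omega>, ())) = ent Q rT" by (rule ec) auto
  have e14: "ent Q (\<lambda>\<omega>. (rX \<omega>, ())) = ent Q rX" by (rule ec) auto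
  have e15: "ent Q (\<lambda>\<omega>. (rT \<omega>, rX \<omega>, ())) = ent Q (rT && rX)" by (rule ec) auto
  have TX: "ent Q (rT && rX) \<le> ent Q rT + ent Q rX"
    using cmi_nonneg[OF fin, of rT rX "\<lambda>_. ()"] unfolding cmi_def e12 e13 e14 e15 by simp
  have "ent Q (rT && rX && rY) + ent Q rX = ent Q (rT && rX) + ent Q (rX && rY)"
    using markov_map[OF fin ad(4), of fst "\<lambda>y. y"] by (intro ent_markov[OF fin]) simp
  then have TXY: "ent Q (rT && rX) - ent Q rX \<le> ent Q (rT && rY) - ent Q rY"
    using cmi_nonneg[OF fin, of rT rX rY] unfolding cmi_def by linarith
  show ?g1
    unfolding hT_def hU_def e1 e2 e5 using R0 rates(2) by linarith
  then show ?g2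
    unfolding hT_def hU_def e1 e2 e5 e6 using TXY by linarith
  show ?g3
    unfolding hT_def hV_def hW_def e1 e3 e4 e7 e12 using RXY rates(5) by linarith
  then show ?g4
    unfolding hT_def hV_def hW_def e1 e3 e4 e7 e8 e12 using TX by linarith
  show ?g5
    unfolding hV_def e1 e3 e9 using RX rates(3) by linarith
  show ?g6
    unfolding hW_def e4 e10 e11 using RY rates(4) by linarith
qed

section \<open>Factorisation of the joint law and recovery of the function\<close>

lemma pmf_map_le:
  assumes "finite (set_pmf Q)"
  shows "pmf (map_pmf g Q) z \<le> pmf (map_pmf (\<lambda>\<omega>. h (g \<omega>)) Q) (h z)"
  unfolding pmf_map_sum[OF assms] by (intro sum_mono mult_left_mono) auto

lemma pmf_map_relabel:
  assumes "finite (set_pmf Q)" "\<And>\<omega>. g \<omega> = z \<longleftrightarrow> g' \<omega> = z'"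
  shows "pmf (map_pmf g Q) z = pmf (map_pmf g' Q) z'"
  unfolding pmf_map_sum[OF assms(1)] using assms(2) by simp

text \<open>The variables are adjoined one chain at a time: (T,U) - X - Y, then V - (X,T) - (U,Y),
  then W. Where a conditioning event has probability zero the kernel is arbitrary, but both sides
  vanish because a joint probability is at most a marginal one.\<close>

lemma admissible_factorization:
  assumes adm: "admissible p f Q sV sW"
    and kT: "\<And>c a. pmf (map_pmf (rX && rT) Q) (c, a) = pmf (map_pmf rX Q) c * kT c a"
    and kU: "\<And>c a. pmf (map_pmf ((rX && rT) && rU) Q) (c, a) = pmf (map_pmf (rX && rT) Q) c * kU c a"
    and kV: "\<And>c a. pmf (map_pmf ((rX && rT) && rV) Q) (c, a) = pmf (map_pmf (rX && rT) Q) c * kV c a"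
    and kW: "\<And>c a. pmf (map_pmf ((rT && rU && rY) && rW) Q) (c, a) = pmf (map_pmf (rT && rU && rY) Q) c * kW c a"
  shows "pmf Q (x, y, t, u, v, w) = pmf p (x, y) * kT x t * kU (x, t) u * kV (x, t) v * kW (t, u, y) w"
proof -
  note ad = admissibleD[OF adm]
  note fin = ad(1)
  note rl = pmf_map_relabel[OF fin]
  let ?P = "\<lambda>g. pmf (map_pmf g Q)"
  define pxtuy where "pxtuy = ?P ((rT && rU) && rX && rY) ((t, u), x, y)"
  define pvxtuy where "pvxtuy = ?P ((rV && rX && rT) && rU && rY) ((v, x, t), u, y)"
  define pxt where "pxt = ?P (rX && rT) (x, t)"
  define ptuy where "ptuy = ?P (rT && rU && rY) (t, u, y)"
  have nn: "0 \<le> pxtuy" "0 \<le> pvxtuy" by (auto simp: pxtuy_def pvxtuy_def)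
  have step1: "pxtuy = pmf p (x, y) * kT x t * kU (x, t) u"
  proof (cases "?P rX x = 0")
    case True
    have "pxtuy \<le> ?P rX x"
      using pmf_map_le[OF fin, of "(rT && rU) && rX && rY" "((t, u), x, y)" "\<lambda>(_, x, _). x"] by (simp add: pxtuy_def)
    moreover have "pmf p (x, y) \<le> ?P rX x"
      using pmf_map_le[OF fin, of "rX && rY" "(x, y)" fst] by (simp add: ad(2))
    ultimately show ?thesis using True nn pmf_nonneg[of p "(x, y)"] by (metis mult_zero_left nle_le)
  next
    case False
    have "pxtuy * ?P rX x = ?P ((rT && rU) && rX) ((t, u), x) * pmf p (x, y)"
      using ad(4)[unfolded markov_pmf, rule_format, of "(t, u)" x y] by (simp add: pxtuy_def ad(2))
    also have "?P ((rT && rU) && rX) ((t, u), x) = ?P ((rX && rT) && rU) ((x, t), u)"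
      by (rule rl) auto
    also have "\<dots> = ?P rX x * kT x t * kU (x, t) u" unfolding kU kT ..
    finally show ?thesis using False by simp
  qed
  have step2: "pvxtuy = pxtuy * kV (x, t) v"
  proof (cases "pxt = 0")
    case True
    have "pxtuy \<le> pxt"
      using pmf_map_le[OF fin, of "(rT && rU) && rX && rY" "((t, u), x, y)" "\<lambda>((t, _), x, _). (x, t)"]
      by (simp add: pxtuy_def pxt_def)
    moreover have "pvxtuy \<le> pxt"
      using pmf_map_le[OF fin, of "(rV && rX && rT) && rU && rY" "((v, x, t), u, y)" "\<lambda>((_, x, t), _). (x, t)"]
      by (simp add: pvxtuy_def pxt_def)
    ultimately show ?thesis using True nn by simp
  next
    case False
    have "markov Q rV (rX && rT) (rU && rY)"
      using markov_map[OF fin ad(5), of "\<lambda>v. v" "\<lambda>(u, y, w). (u, y)"] by simp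
    from this[unfolded markov_pmf, rule_format, of v "(x, t)" "(u, y)"]
    have "?P (rV && (rX && rT) && rU && rY) (v, (x, t), u, y) * pxt
       = ?P (rV && rX && rT) (v, x, t) * ?P ((rX && rT) && rU && rY) ((x, t), u, y)"
      by (simp add: pxt_def)
    also have "?P (rV && (rX && rT) && rU && rY) (v, (x, t), u, y) = pvxtuy"
      unfolding pvxtuy_def by (rule rl) auto
    also have "?P (rV && rX && rT) (v, x, t) = ?P ((rX && rT) && rV) ((x, t), v)"
      by (rule rl) auto
    also have "\<dots> = pxt * kV (x, t) v" by (simp add: kV pxt_def)
    also have "?P ((rX && rT) && rU && rY) ((x, t), u, y) = pxtuy"
      unfolding pxtuy_def by (rule rl) auto
    finally show ?thesis using False by simp
  qed
  have q: "pmf Q (x, y, t, u, v, w) = ?P ((rV && rX && rT) && (rU && rY) && rW) ((v, x, t), (u, y), w)"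
    using rl[of "\<lambda>\<omega>. \<omega>" "(x, y, t, u, v, w)" "(rV && rX && rT) && (rU && rY) && rW" "((v, x, t), (u, y), w)"]
    by (auto simp: rX_def rY_def rT_def rU_def rV_def rW_def)
  have step3: "pmf Q (x, y, t, u, v, w) = pvxtuy * kW (t, u, y) w"
  proof (cases "ptuy = 0")
    case True
    have "pvxtuy \<le> ptuy"
      using pmf_map_le[OF fin, of "(rV && rX && rT) && rU && rY" "((v, x, t), u, y)" "\<lambda>((_, x, t), u, y). (t, u, y)"]
      by (simp add: pvxtuy_def ptuy_def)
    moreover have "pmf Q (x, y, t, u, v, w) \<le> ptuy"
      using pmf_map_le[OF fin, of "(rV && rX && rT) && (rU && rY) && rW" "((v, x, t), (u, y), w)"
          "\<lambda>((_, x, t), (u, y), _). (t, u, y)"]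
      unfolding q by (simp add: ptuy_def)
    ultimately show ?thesis using True nn pmf_nonneg[of Q "(x, y, t, u, v, w)"] by simp
  next
    case False
    let ?puy = "?P (rU && rY) (u, y)" and ?puyw = "?P ((rU && rY) && rW) ((u, y), w)"
    have "ptuy \<le> ?puy"
      using pmf_map_le[OF fin, of "rT && rU && rY" "(t, u, y)" snd] by (simp add: ptuy_def)
    moreover have "0 < ptuy" using False by (simp add: ptuy_def order_less_le)
    ultimately have puy: "?puy > 0" by simp
    have m1: "pmf Q (x, y, t, u, v, w) * ?puy = pvxtuy * ?puyw"
      using ad(6)[unfolded markov_pmf, rule_format, of "(v, x, t)" "(u, y)" w] unfolding q pvxtuy_def .
    \<comment> \<open>The chain yields the kernel of W given (U,Y), whereas \<open>kW\<close>
      conditions on (T,U,Y); T - (U,Y) - W identifies the two.\<close>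
    have "markov Q rT (rU && rY) rW"
      using markov_map[OF fin ad(6), of "\<lambda>(v, x, t). t" "\<lambda>w. w"] by simp
    from this[unfolded markov_pmf, rule_format, of t "(u, y)" w]
    have "?P (rT && (rU && rY) && rW) (t, (u, y), w) * ?puy = ptuy * ?puyw" by (simp add: ptuy_def)
    also have "?P (rT && (rU && rY) && rW) (t, (u, y), w) = ?P ((rT && rU && rY) && rW) ((t, u, y), w)"
      by (rule rl) auto
    also have "\<dots> = ptuy * kW (t, u, y) w" by (simp add: kW ptuy_def)
    finally have "kW (t, u, y) w * ?puy = ?puyw" using False by simp
    with m1 have "pmf Q (x, y, t, u, v, w) * ?puy = pvxtuy * kW (t, u, y) w * ?puy" by (simp add: mult_ac)
    then show ?thesis using puy by simp
  qed
  show ?thesis unfolding step3 step2 step1 ..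
qed

lemma indep_setD:
  "indep_set Q L K F A \<Longrightarrow> l1 \<in> A \<Longrightarrow> l2 \<in> A \<Longrightarrow> char_adj Q L K F l1 l2 \<Longrightarrow> l1 = l2"
  unfolding indep_set_def by blast

text \<open>The receiver only needs \<open>(T,V,W)\<close>: two pairs \<open>(U,Y)\<close> compatible with the same \<open>W\<close> are
  non-adjacent or equal, and in the latter case two values of \<open>X\<close> compatible with the same \<open>V\<close>
  are non-adjacent or equal.\<close>
lemma function_determined:
  assumes adm: "admissible p f Q sV sW" and w: "\<omega> \<in> set_pmf Q" "\<omega>' \<in> set_pmf Q"
    and e: "rT \<omega> = rT \<omega>'" "rV \<omega> = rV \<omega>'" "rW \<omega> = rW \<omega>'"
  shows "f (rX \<omega>) (rY \<omega>) = f (rX \<omega>') (rY \<omega>')"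
proof (rule ccontr)
  assume ne: "f (rX \<omega>) (rY \<omega>) \<noteq> f (rX \<omega>') (rY \<omega>')"
  note ad = admissibleD[OF adm]
  have "char_adj Q (rT && rU && rY) (rT && rV) (\<lambda>\<omega>. f (rX \<omega>) (rY \<omega>))
      (rT \<omega>, rU \<omega>, rY \<omega>) (rT \<omega>', rU \<omega>', rY \<omega>')"
    unfolding char_adj_def using w e ne by (intro bexI[of _ \<omega>] bexI[of _ \<omega>']) auto
  then have "(rT \<omega>, rU \<omega>, rY \<omega>) = (rT \<omega>', rU \<omega>', rY \<omega>')"
    by (rule indep_setD[OF ad(10)[OF w(1)] ad(9)[OF w(1)] ad(9)[OF w(2), folded e(3)]])
  then have uy: "rU \<omega> = rU \<omega>'" "rY \<omega> = rY \<omega>'" by auto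
  have "char_adj Q (rT && rX) (rT && rU && rY) (\<lambda>\<omega>. f (rX \<omega>) (rY \<omega>))
      (rT \<omega>, rX \<omega>) (rT \<omega>', rX \<omega>')"
    unfolding char_adj_def using w e uy ne by (intro bexI[of _ \<omega>] bexI[of _ \<omega>']) auto
  then have "(rT \<omega>, rX \<omega>) = (rT \<omega>', rX \<omega>')"
    by (rule indep_setD[OF ad(8)[OF w(1)] ad(7)[OF w(1)] ad(7)[OF w(2), folded e(2)]])
  then show False using ne uy by simp
qed

lemma jnt_eta: "(rX \<omega>, rY \<omega>, rT \<omega>, rU \<omega>, rV \<omega>, rW \<omega>) = \<omega>"
  by (cases \<omega>) (simp add: rX_def rY_def rT_def rU_def rV_def rW_def)

section \<open>Block codes from product kernels\<close>

lemma card_typical_le: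
  fixes w :: "'a \<Rightarrow> real"
  assumes S: "finite S" "\<And>s. s \<in> S \<Longrightarrow> 0 \<le> w s" "(\<Sum>s\<in>S. w s) = 1"
    and C: "C \<subseteq> {s\<in>S. w s \<ge> 2 powr - a}"
  shows "real (card C) \<le> 2 powr a"
proof -
  have "card C \<le> card {s\<in>S. w s \<ge> 2 powr - a}" using C S(1) by (intro card_mono) auto
  also have "real \<dots> \<le> 1 / 2 powr - a" using S by (intro card_heavy_le) auto
  also have "\<dots> = 2 powr a" by (simp add: powr_minus_divide)
  finally show ?thesis by simp
qed

text \<open>The kernels named k drive the encoders, with exponents h. Those named j define and count
  typical competitors, with exponents g. The exponents enter through \<open>dev\<close> alone.
  \<open>jTVW\<close> is conditioned on \<open>unit\<close>, so that an unconditional law has the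
  shape of a kernel.\<close>

locale block_source =
  fixes p :: "('x::finite \<times> 'y::finite) pmf" and f :: "'x \<Rightarrow> 'y \<Rightarrow> 'f" and Q :: "('x,'y) jnt pmf"
    and AT AU AV AW :: "nat set" and fh :: "nat \<Rightarrow> nat \<Rightarrow> nat \<Rightarrow> 'f"
    and kT :: "'x \<Rightarrow> nat \<Rightarrow> real" and kU kV :: "'x \<times> nat \<Rightarrow> nat \<Rightarrow> real" and kW :: "nat \<times> nat \<times> 'y \<Rightarrow> nat \<Rightarrow> real"
    and jTU :: "'y \<Rightarrow> nat \<times> nat \<Rightarrow> real" and jU :: "nat \<times> 'y \<Rightarrow> nat \<Rightarrow> real"
    and jTVW :: "unit \<Rightarrow> nat \<times> nat \<times> nat \<Rightarrow> real" and jVW :: "nat \<Rightarrow> nat \<times> nat \<Rightarrow> real"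
    and jV jW :: "nat \<times> nat \<Rightarrow> nat \<Rightarrow> real"
    and hT hU hV hW gTU gU gTVW gVW gV gW B :: real and \<Omega> :: "('x,'y) jnt set"
  assumes finA: "finite AT" "finite AU" "finite AV" "finite AW"
    and \<Omega>: "\<Omega> = UNIV \<times> UNIV \<times> AT \<times> AU \<times> AV \<times> AW"
    and nonneg: "\<And>c a. 0 \<le> kT c a" "\<And>c a. 0 \<le> kU c a" "\<And>c a. 0 \<le> kV c a" "\<And>c a. 0 \<le> kW c a"
      "\<And>c a. 0 \<le> jTU c a" "\<And>c a. 0 \<le> jU c a" "\<And>c a. 0 \<le> jTVW c a" "\<And>c a. 0 \<le> jVW c a"
      "\<And>c a. 0 \<le> jV c a" "\<And>c a. 0 \<le> jW c a"
    and sums: "\<And>c. (\<Sum>a\<in>AT. kT c a) = 1" "\<And>c. (\<Sum>a\<in>AU. kU c a) = 1" "\<And>c. (\<Sum>a\<in>AV. kV c a) = 1" "\<And>c. (\<Sum>a\<in>AW. kW c a) = 1"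
      "\<And>c. (\<Sum>a\<in>AT \<times> AU. jTU c a) = 1" "\<And>c. (\<Sum>a\<in>AU. jU c a) = 1" "\<And>c. (\<Sum>a\<in>AT \<times> AV \<times> AW. jTVW c a) = 1"
      "\<And>c. (\<Sum>a\<in>AV \<times> AW. jVW c a) = 1" "\<And>c. (\<Sum>a\<in>AV. jV c a) = 1" "\<And>c. (\<Sum>a\<in>AW. jW c a) = 1"
    and factor: "\<And>x y t u v w. pmf Q (x, y, t, u, v, w) = pmf p (x, y) * kT x t * kU (x, t) u * kV (x, t) v * kW (t, u, y) w"
    and fh: "\<And>x y t u v w. pmf Q (x, y, t, u, v, w) \<noteq> 0 \<Longrightarrow> fh t v w = f x y"
    and dev: "dev_bound Q \<Omega> (\<lambda>\<omega>. kT (rX \<omega>) (rT \<omega>)) hT B"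
      "dev_bound Q \<Omega> (\<lambda>\<omega>. kU (rX \<omega>, rT \<omega>) (rU \<omega>)) hU B"
      "dev_bound Q \<Omega> (\<lambda>\<omega>. kV (rX \<omega>, rT \<omega>) (rV \<omega>)) hV B"
      "dev_bound Q \<Omega> (\<lambda>\<omega>. kW (rT \<omega>, rU \<omega>, rY \<omega>) (rW \<omega>)) hW B"
      "dev_bound Q \<Omega> (\<lambda>\<omega>. jTU (rY \<omega>) (rT \<omega>, rU \<omega>)) gTU B"
      "dev_bound Q \<Omega> (\<lambda>\<omega>. jU (rT \<omega>, rY \<omega>) (rU \<omega>)) gU B"
      "dev_bound Q \<Omega> (\<lambda>\<omega>. jTVW () (rT \<omega>, rV \<omega>, rW \<omega>)) gTVW B"
      "dev_bound Q \<Omega> (\<lambda>\<omega>. jVW (rT \<omega>) (rV \<omega>, rW \<omega>)) gVW B"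
      "dev_bound Q \<Omega> (\<lambda>\<omega>. jV (rT \<omega>, rW \<omega>) (rV \<omega>)) gV B"
      "dev_bound Q \<Omega> (\<lambda>\<omega>. jW (rT \<omega>, rV \<omega>) (rW \<omega>)) gW B"
begin

text \<open>\<open>one_shot_code\<close> with thresholds 2^(-n(h - \<delta>)) and competitor counts
  2^(n(g + \<delta>)). The set \<open>A1\<close> imposes two typicality tests and \<open>A2\<close>
  four, one for each kind of competitor, whence 2b and 4b. Each later 2b is twice the mass of the
  heavy atoms of one encoder kernel.\<close>

lemma block_code:
  fixes n KT KU KV KW M0 MX MY :: nat
  assumes n: "n > 0" and d: "\<delta> > 0"
    and pos: "KT > 0" "KU > 0" "KV > 0" "KW > 0" "M0 > 0" "MX > 0" "MY > 0"
  defines "b \<equiv> B / (real n * \<delta>\<^sup>2)"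
  shows "\<exists>phi0 phiX phiY psi. (\<forall>xs::'x list. length xs = n \<longrightarrow> phi0 xs < M0 \<and> phiX xs < MX)
      \<and> (\<forall>ys::'y list. length ys = n \<longrightarrow> (\<forall>m::nat. phiY ys m < MY))
      \<and> (\<Sum>xs\<in>lists_n UNIV n. \<Sum>ys\<in>lists_n UNIV n. (\<Prod>i<n. pmf p (xs ! i, ys ! i)) *
            of_bool (psi (phiX xs) (phiY ys (phi0 xs)) \<noteq> map (\<lambda>i. f (xs ! i) (ys ! i)) [0..<n]))
      \<le> (2 * b + 2 powr (real n * (gTU + \<delta>)) / (real KT * real KU * real M0)
              + 2 powr (real n * (gU + \<delta>)) / (real KU * real M0))
        + (4 * b + 2 powr (real n * (gTVW + \<delta>)) / (real KT * real KV * real KW * real MX * real MY)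
              + 2 powr (real n * (gVW + \<delta>)) / (real KV * real KW * real MX * real MY)
              + 2 powr (real n * (gV + \<delta>)) / (real KV * real MX)
              + 2 powr (real n * (gW + \<delta>)) / (real KW * real MY))
        + (2 * b + sqrt ((real KW - 1) * 2 powr - (real n * (hW - \<delta>))))
        + (2 * b + sqrt ((real KV - 1) * 2 powr - (real n * (hV - \<delta>))))
        + (2 * b + sqrt ((real KU - 1) * 2 powr - (real n * (hU - \<delta>))))
        + (2 * b + sqrt ((real KT - 1) * 2 powr - (real n * (hT - \<delta>))))"
proof -
  define ST where "ST = lists_n AT n"
  define SU where "SU = lists_n AU n"
  define SV where "SV = lists_n AV n"
  define SW where "SW = lists_n AW n"
  define SX where "SX = lists_n (UNIV :: 'x set) n"
  define SY where "SY = lists_n (UNIV :: 'y set) n"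
  note S_defs = ST_def SU_def SV_def SW_def SX_def SY_def
  define PP where "PP xs ys = (\<Prod>i<n. pmf p (xs ! i, ys ! i))" for xs ys
  define KTn where "KTn xs ts = (\<Prod>i<n. kT (xs ! i) (ts ! i))" for xs ts
  define KUn where "KUn xs ts us = (\<Prod>i<n. kU (xs ! i, ts ! i) (us ! i))" for xs ts us
  define KVn where "KVn xs ts vs = (\<Prod>i<n. kV (xs ! i, ts ! i) (vs ! i))" for xs ts vs
  define KWn where "KWn ts us ys ws = (\<Prod>i<n. kW (ts ! i, us ! i, ys ! i) (ws ! i))" for ts us ys ws
  note K_defs = PP_def KTn_def KUn_def KVn_def KWn_def
  have finS: "finite SX" "finite SY" "finite ST" "finite SU" "finite SV" "finite SW"
    unfolding S_defs using finA by (auto intro!: finite_lists_n)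
  have p1: "(\<Sum>x\<in>UNIV. \<Sum>y\<in>UNIV. pmf p (x, y)) = 1"
    using sum_pmf_eq_1[of UNIV p] by (simp add: sum.cartesian_product)
  interpret O: one_shot SX SY ST SU SV SW PP KTn KUn KVn KWn KT KU KV KW M0 MX MY
  proof
    show "(\<Sum>x\<in>SX. \<Sum>y\<in>SY. PP x y) = 1"
      unfolding S_defs PP_def sum_prod_lists_n[of "\<lambda>i y. pmf p (_ ! i, y)"]
        sum_prod_lists_n[of "\<lambda>i x. \<Sum>y\<in>UNIV. pmf p (x, y)"] p1 by simp
    show "(\<Sum>t\<in>ST. KTn x t) = 1" for x
      unfolding ST_def KTn_def sum_prod_lists_n[of "\<lambda>i. kT (x ! i)"] sums by simp
    show "(\<Sum>u\<in>SU. KUn x t u) = 1" for x t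
      unfolding SU_def KUn_def sum_prod_lists_n[of "\<lambda>i. kU (x ! i, t ! i)"] sums by simp
    show "(\<Sum>v\<in>SV. KVn x t v) = 1" for x t
      unfolding SV_def KVn_def sum_prod_lists_n[of "\<lambda>i. kV (x ! i, t ! i)"] sums by simp
    show "(\<Sum>w\<in>SW. KWn t u y w) = 1" for t u y
      unfolding SW_def KWn_def sum_prod_lists_n[of "\<lambda>i. kW (t ! i, u ! i, y ! i)"] sums by simp
  qed (auto simp: K_defs nonneg pos finS intro!: prod_nonneg)
  have J: "O.J xs ys ts us vs ws = (\<Prod>i<n. pmf Q (xs ! i, ys ! i, ts ! i, us ! i, vs ! i, ws ! i))" for xs ys ts us vs ws
    unfolding O.J_def K_defs factor prod.distrib ..
  \<comment> \<open>Under the ideal law the six blocks form one i.i.d. block drawn from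
    \<open>Q\<close>, which brings them within reach of the deviation bounds.\<close>
  have Ex_eq: "O.Ex F = (\<Sum>zs\<in>lists_n \<Omega> n. (\<Prod>i<n. pmf Q (zs ! i)) *
      F (map rX zs) (map rY zs) (map rT zs) (map rU zs) (map rV zs) (map rW zs))" for F
    unfolding O.Ex_def
    unfolding S_defs sum_six_lists \<Omega>
  proof (intro sum.cong refl)
    fix zs assume "zs \<in> lists_n ((UNIV :: 'x set) \<times> (UNIV :: 'y set) \<times> AT \<times> AU \<times> AV \<times> AW) n"
    then have "length zs = n" by (simp add: lists_n_def)
    then have "O.J (map rX zs) (map rY zs) (map rT zs) (map rU zs) (map rV zs) (map rW zs) = (\<Prod>i<n. pmf Q (zs ! i))"
      unfolding J by (intro prod.cong refl) (simp add: jnt_eta)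
    then show "O.J (map rX zs) (map rY zs) (map rT zs) (map rU zs) (map rV zs) (map rW zs) *
         F (map rX zs) (map rY zs) (map rT zs) (map rU zs) (map rV zs) (map rW zs)
       = (\<Prod>i<n. pmf Q (zs ! i)) * F (map rX zs) (map rY zs) (map rT zs) (map rU zs) (map rV zs) (map rW zs)" by simp
  qed
  note db = dev[unfolded dev_bound_def, rule_format, OF n d, folded b_def]
  have len: "zs \<in> lists_n \<Omega> n \<Longrightarrow> length zs = n" for zs by (simp add: lists_n_def)
  have bT: "O.Ex (\<lambda>x y t u v w. of_bool (KTn x t > 2 powr - (real n * (hT - \<delta>)))) \<le> b"
    by (rule order_trans[OF eq_refl db(1)[THEN conjunct1]])
      (unfold Ex_eq, unfold KTn_def, intro sum.cong refl, simp add: len cong: prod.cong_simp)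
  have bU: "O.Ex (\<lambda>x y t u v w. of_bool (KUn x t u > 2 powr - (real n * (hU - \<delta>)))) \<le> b"
    by (rule order_trans[OF eq_refl db(2)[THEN conjunct1]])
      (unfold Ex_eq, unfold KUn_def, intro sum.cong refl, simp add: len cong: prod.cong_simp)
  have bV: "O.Ex (\<lambda>x y t u v w. of_bool (KVn x t v > 2 powr - (real n * (hV - \<delta>)))) \<le> b"
    by (rule order_trans[OF eq_refl db(3)[THEN conjunct1]])
      (unfold Ex_eq, unfold KVn_def, intro sum.cong refl, simp add: len cong: prod.cong_simp)
  have bW: "O.Ex (\<lambda>x y t u v w. of_bool (KWn t u y w > 2 powr - (real n * (hW - \<delta>)))) \<le> b"
    by (rule order_trans[OF eq_refl db(4)[THEN conjunct1]])
      (unfold Ex_eq, unfold KWn_def, intro sum.cong refl, simp add: len cong: prod.cong_simp)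
  define wTU where "wTU ys = (\<lambda>(ts, us). \<Prod>i<n. jTU (ys ! i) (ts ! i, us ! i))" for ys
  define wU where "wU ts ys us = (\<Prod>i<n. jU (ts ! i, ys ! i) (us ! i))" for ts ys us
  define wTVW where "wTVW = (\<lambda>(ts, vs, ws). \<Prod>i<n. jTVW () (ts ! i, vs ! i, ws ! i))"
  define wVW where "wVW ts = (\<lambda>(vs, ws). \<Prod>i<n. jVW (ts ! i) (vs ! i, ws ! i))" for ts
  define wV where "wV ts ws vs = (\<Prod>i<n. jV (ts ! i, ws ! i) (vs ! i))" for ts ws vs
  define wW where "wW ts vs ws = (\<Prod>i<n. jW (ts ! i, vs ! i) (ws ! i))" for ts vs ws
  note w_defs = wTU_def wU_def wTVW_def wVW_def wV_def wW_def
  have bTU: "O.Ex (\<lambda>x y t u v w. of_bool (\<not> wTU y (t, u) \<ge> 2 powr - (real n * (gTU + \<delta>)))) \<le> b"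
    by (rule order_trans[OF eq_refl db(5)[THEN conjunct2]])
      (unfold Ex_eq, unfold wTU_def prod.case, intro sum.cong refl, simp add: len cong: prod.cong_simp)
  have bU': "O.Ex (\<lambda>x y t u v w. of_bool (\<not> wU t y u \<ge> 2 powr - (real n * (gU + \<delta>)))) \<le> b"
    by (rule order_trans[OF eq_refl db(6)[THEN conjunct2]])
      (unfold Ex_eq, unfold wU_def, intro sum.cong refl, simp add: len cong: prod.cong_simp)
  have bTVW: "O.Ex (\<lambda>x y t u v w. of_bool (\<not> wTVW (t, v, w) \<ge> 2 powr - (real n * (gTVW + \<delta>)))) \<le> b"
    by (rule order_trans[OF eq_refl db(7)[THEN conjunct2]])
      (unfold Ex_eq, unfold wTVW_def prod.case, intro sum.cong refl, simp add: len cong: prod.cong_simp)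
  have bVW: "O.Ex (\<lambda>x y t u v w. of_bool (\<not> wVW t (v, w) \<ge> 2 powr - (real n * (gVW + \<delta>)))) \<le> b"
    by (rule order_trans[OF eq_refl db(8)[THEN conjunct2]])
      (unfold Ex_eq, unfold wVW_def prod.case, intro sum.cong refl, simp add: len cong: prod.cong_simp)
  have bV': "O.Ex (\<lambda>x y t u v w. of_bool (\<not> wV t w v \<ge> 2 powr - (real n * (gV + \<delta>)))) \<le> b"
    by (rule order_trans[OF eq_refl db(9)[THEN conjunct2]])
      (unfold Ex_eq, unfold wV_def, intro sum.cong refl, simp add: len cong: prod.cong_simp)
  have bW': "O.Ex (\<lambda>x y t u v w. of_bool (\<not> wW t v w \<ge> 2 powr - (real n * (gW + \<delta>)))) \<le> b"
    by (rule order_trans[OF eq_refl db(10)[THEN conjunct2]])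
      (unfold Ex_eq, unfold wW_def, intro sum.cong refl, simp add: len cong: prod.cong_simp)
  define A1 where "A1 = {(t, u, y). wTU y (t, u) \<ge> 2 powr - (real n * (gTU + \<delta>)) \<and> wU t y u \<ge> 2 powr - (real n * (gU + \<delta>))}"
  define A2 where "A2 = {(t, v, w). wTVW (t, v, w) \<ge> 2 powr - (real n * (gTVW + \<delta>))
      \<and> wVW t (v, w) \<ge> 2 powr - (real n * (gVW + \<delta>))
      \<and> wV t w v \<ge> 2 powr - (real n * (gV + \<delta>)) \<and> wW t v w \<ge> 2 powr - (real n * (gW + \<delta>))}"
  have bA1: "O.Ex (\<lambda>x y t u v w. of_bool ((t, u, y) \<notin> A1)) \<le> 2 * b"
  proof -
    have "O.Ex (\<lambda>x y t u v w. of_bool ((t, u, y) \<notin> A1))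
       \<le> O.Ex (\<lambda>x y t u v w. of_bool (\<not> wTU y (t, u) \<ge> 2 powr - (real n * (gTU + \<delta>)))
            + of_bool (\<not> wU t y u \<ge> 2 powr - (real n * (gU + \<delta>))))"
      by (rule O.Ex_mono) (auto simp: A1_def)
    also have "\<dots> \<le> 2 * b" unfolding O.Ex_add using bTU bU' by linarith
    finally show ?thesis .
  qed
  have bA2: "O.Ex (\<lambda>x y t u v w. of_bool ((t, v, w) \<notin> A2)) \<le> 4 * b"
  proof -
    have "O.Ex (\<lambda>x y t u v w. of_bool ((t, v, w) \<notin> A2))
       \<le> O.Ex (\<lambda>x y t u v w. (of_bool (\<not> wTVW (t, v, w) \<ge> 2 powr - (real n * (gTVW + \<delta>)))
            + of_bool (\<not> wVW t (v, w) \<ge> 2 powr - (real n * (gVW + \<delta>))))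
            + (of_bool (\<not> wV t w v \<ge> 2 powr - (real n * (gV + \<delta>)))
            + of_bool (\<not> wW t v w \<ge> 2 powr - (real n * (gW + \<delta>)))))"
      by (rule O.Ex_mono) (auto simp: A2_def)
    also have "\<dots> \<le> 4 * b" unfolding O.Ex_add using bTVW bVW bV' bW' by linarith
    finally show ?thesis .
  qed
  have wnn: "0 \<le> wTU ys tu" "0 \<le> wU ts ys us" "0 \<le> wTVW tvw" "0 \<le> wVW ts vw" "0 \<le> wV ts ws vs" "0 \<le> wW ts vs ws"
    for ys tu ts us tvw vw ws vs
    by (auto simp: w_defs nonneg case_prod_unfold intro!: prod_nonneg)
  have sTU: "(\<Sum>s\<in>ST \<times> SU. wTU ys s) = 1" for ys
  proof -
    have "(\<Sum>s\<in>ST \<times> SU. wTU ys s) = (\<Sum>ts\<in>ST. \<Sum>us\<in>SU. \<Prod>i<n. jTU (ys ! i) (ts ! i, us ! i))"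
      by (simp add: wTU_def sum.cartesian_product)
    also have "\<dots> = (\<Prod>i<n. \<Sum>t\<in>AT. \<Sum>u\<in>AU. jTU (ys ! i) (t, u))"
      unfolding ST_def SU_def sum_prod_lists_n[of "\<lambda>i u. jTU (ys ! i) (_ ! i, u)"]
        sum_prod_lists_n[of "\<lambda>i t. \<Sum>u\<in>AU. jTU (ys ! i) (t, u)"] ..
    also have "\<dots> = 1" using sums(5) by (simp add: sum.cartesian_product)
    finally show ?thesis .
  qed
  have sU: "(\<Sum>s\<in>SU. wU ts ys s) = 1" for ts ys
    unfolding SU_def wU_def sum_prod_lists_n[of "\<lambda>i. jU (ts ! i, ys ! i)"] sums by simp
  have sVW': "(\<Sum>vs\<in>SV. \<Sum>ws\<in>SW. \<Prod>i<n. g i (vs ! i, ws ! i)) = (\<Prod>i<n. \<Sum>v\<in>AV. \<Sum>w\<in>AW. g i (v, w))" for g :: "nat \<Rightarrow> nat \<times> nat \<Rightarrow> real"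
    unfolding SV_def SW_def sum_prod_lists_n[of "\<lambda>i w. g i (_ ! i, w)"]
      sum_prod_lists_n[of "\<lambda>i v. \<Sum>w\<in>AW. g i (v, w)"] ..
  have sTVW: "(\<Sum>s\<in>ST \<times> SV \<times> SW. wTVW s) = 1"
  proof -
    have "(\<Sum>s\<in>ST \<times> SV \<times> SW. wTVW s) = (\<Sum>ts\<in>ST. \<Sum>vs\<in>SV. \<Sum>ws\<in>SW. \<Prod>i<n. (\<lambda>vw. jTVW () (ts ! i, vw)) (vs ! i, ws ! i))"
      by (simp add: wTVW_def sum.cartesian_product)
    also have "\<dots> = (\<Prod>i<n. \<Sum>t\<in>AT. \<Sum>v\<in>AV. \<Sum>w\<in>AW. jTVW () (t, v, w))"
      unfolding sVW'[of "\<lambda>i vw. jTVW () (_ ! i, vw)"] ST_def sum_prod_lists_n[of "\<lambda>i t. \<Sum>v\<in>AV. \<Sum>w\<in>AW. jTVW () (t, v, w)"] ..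
    also have "\<dots> = 1" using sums(7) by (simp add: sum.cartesian_product)
    finally show ?thesis .
  qed
  have sVW: "(\<Sum>s\<in>SV \<times> SW. wVW ts s) = 1" for ts
  proof -
    have "(\<Sum>s\<in>SV \<times> SW. wVW ts s) = (\<Sum>vs\<in>SV. \<Sum>ws\<in>SW. \<Prod>i<n. jVW (ts ! i) (vs ! i, ws ! i))"
      by (simp add: wVW_def sum.cartesian_product)
    also have "\<dots> = 1" unfolding sVW'[of "\<lambda>i. jVW (ts ! i)"] using sums(8) by (simp add: sum.cartesian_product)
    finally show ?thesis .
  qed
  have sV: "(\<Sum>s\<in>SV. wV ts ws s) = 1" for ts ws
    unfolding SV_def wV_def sum_prod_lists_n[of "\<lambda>i. jV (ts ! i, ws ! i)"] sums by simp
  have sW: "(\<Sum>s\<in>SW. wW ts vs s) = 1" for ts vs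
    unfolding SW_def wW_def sum_prod_lists_n[of "\<lambda>i. jW (ts ! i, vs ! i)"] sums by simp
  have finP: "finite (ST \<times> SU)" "finite (ST \<times> SV \<times> SW)" "finite (SV \<times> SW)" using finS by auto
  define fhat where "fhat ts vs ws = map (\<lambda>i. fh (ts ! i) (vs ! i) (ws ! i)) [0..<n]" for ts vs ws
  define F where "F xs ys = map (\<lambda>i. f (xs ! i) (ys ! i)) [0..<n]" for xs :: "'x list" and ys :: "'y list"
  let ?bound = "(O.Ex (\<lambda>x y t u v w. of_bool ((t, u, y) \<notin> A1))
          + 2 powr (real n * (gTU + \<delta>)) / (real KT * real KU * real M0) + 2 powr (real n * (gU + \<delta>)) / (real KU * real M0))
        + (O.Ex (\<lambda>x y t u v w. of_bool ((t, v, w) \<notin> A2))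
          + 2 powr (real n * (gTVW + \<delta>)) / (real KT * real KV * real KW * real MX * real MY)
          + 2 powr (real n * (gVW + \<delta>)) / (real KV * real KW * real MX * real MY)
          + 2 powr (real n * (gV + \<delta>)) / (real KV * real MX) + 2 powr (real n * (gW + \<delta>)) / (real KW * real MY))
        + (2 * O.Ex (\<lambda>x y t u v w. of_bool (KWn t u y w > 2 powr - (real n * (hW - \<delta>)))) + sqrt ((real KW - 1) * 2 powr - (real n * (hW - \<delta>))))
        + (2 * O.Ex (\<lambda>x y t u v w. of_bool (KVn x t v > 2 powr - (real n * (hV - \<delta>)))) + sqrt ((real KV - 1) * 2 powr - (real n * (hV - \<delta>))))
        + (2 * O.Ex (\<lambda>x y t u v w. of_bool (KUn x t u > 2 powr - (real n * (hU - \<delta>)))) + sqrt ((real KU - 1) * 2 powr - (real n * (hU - \<delta>))))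
        + (2 * O.Ex (\<lambda>x y t u v w. of_bool (KTn x t > 2 powr - (real n * (hT - \<delta>)))) + sqrt ((real KT - 1) * 2 powr - (real n * (hT - \<delta>))))"
  have "\<exists>phi0 phiX phiY psi. (\<forall>x\<in>SX. phi0 x < M0 \<and> phiX x < MX) \<and> (\<forall>y\<in>SY. \<forall>m. phiY y m < MY)
     \<and> (\<Sum>x\<in>SX. \<Sum>y\<in>SY. PP x y * of_bool (psi (phiX x) (phiY y (phi0 x)) \<noteq> F x y)) \<le> ?bound"
  proof (rule O.one_shot_code[where fhat = fhat])
    show "fhat t v w = F x y" if "O.J x y t u v w \<noteq> 0" for x y t u v w
    proof -
      have "pmf Q (x ! i, y ! i, t ! i, u ! i, v ! i, w ! i) \<noteq> 0" if "i < n" for i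
        using \<open>O.J x y t u v w \<noteq> 0\<close> that unfolding J by simp
      then have "fh (t ! i) (v ! i) (w ! i) = f (x ! i) (y ! i)" if "i < n" for i using that by (intro fh)
      then show ?thesis by (simp add: fhat_def F_def)
    qed
    show "real (card {(t', u'). t' \<in> ST \<and> u' \<in> SU \<and> (t', u', y) \<in> A1}) \<le> 2 powr (real n * (gTU + \<delta>))" for y
      by (rule card_typical_le[OF finP(1) wnn(1) sTU]) (auto simp: A1_def)
    show "real (card {u'. u' \<in> SU \<and> (t, u', y) \<in> A1}) \<le> 2 powr (real n * (gU + \<delta>))" for t y
      by (rule card_typical_le[OF finS(4) wnn(2) sU]) (auto simp: A1_def)
    show "real (card {(t', v', w'). t' \<in> ST \<and> v' \<in> SV \<and> w' \<in> SW \<and> (t', v', w') \<in> A2}) \<le> 2 powr (real n * (gTVW + \<delta>))"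
      by (rule card_typical_le[OF finP(2) wnn(3) sTVW]) (auto simp: A2_def)
    show "real (card {(v', w'). v' \<in> SV \<and> w' \<in> SW \<and> (t, v', w') \<in> A2}) \<le> 2 powr (real n * (gVW + \<delta>))" for t
      by (rule card_typical_le[OF finP(3) wnn(4) sVW]) (auto simp: A2_def)
    show "real (card {v'. v' \<in> SV \<and> (t, v', w) \<in> A2}) \<le> 2 powr (real n * (gV + \<delta>))" for t w
      by (rule card_typical_le[OF finS(5) wnn(5) sV]) (auto simp: A2_def)
    show "real (card {w'. w' \<in> SW \<and> (t, v, w') \<in> A2}) \<le> 2 powr (real n * (gW + \<delta>))" for t v
      by (rule card_typical_le[OF finS(6) wnn(6) sW]) (auto simp: A2_def)
  qed auto
  then obtain phi0 phiX phiY psi where c: "\<forall>x\<in>SX. phi0 x < M0 \<and> phiX x < MX" "\<forall>y\<in>SY. \<forall>m. phiY y m < MY"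
     "(\<Sum>x\<in>SX. \<Sum>y\<in>SY. PP x y * of_bool (psi (phiX x) (phiY y (phi0 x)) \<noteq> F x y)) \<le> ?bound" by blast
  note c(3)
  also have "?bound \<le> (2 * b + 2 powr (real n * (gTU + \<delta>)) / (real KT * real KU * real M0)
              + 2 powr (real n * (gU + \<delta>)) / (real KU * real M0))
        + (4 * b + 2 powr (real n * (gTVW + \<delta>)) / (real KT * real KV * real KW * real MX * real MY)
              + 2 powr (real n * (gVW + \<delta>)) / (real KV * real KW * real MX * real MY)
              + 2 powr (real n * (gV + \<delta>)) / (real KV * real MX)
              + 2 powr (real n * (gW + \<delta>)) / (real KW * real MY))
        + (2 * b + sqrt ((real KW - 1) * 2 powr - (real n * (hW - \<delta>))))
        + (2 * b + sqrt ((real KV - 1) * 2 powr - (real n * (hV - \<delta>))))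
        + (2 * b + sqrt ((real KU - 1) * 2 powr - (real n * (hU - \<delta>))))
        + (2 * b + sqrt ((real KT - 1) * 2 powr - (real n * (hT - \<delta>))))"
    using bA1 bA2 bT bU bV bW by (intro add_mono order_refl mult_left_mono) auto
  finally show ?thesis
    using c(1,2) unfolding PP_def F_def S_defs
    by (intro exI[of _ phi0] exI[of _ phiX] exI[of _ phiY] exI[of _ psi]) (simp add: lists_n_def)
qed

end

section \<open>Asymptotics of the error bound\<close>

lemma err_prob_eq_sum_lists:
  fixes p :: "('x::finite \<times> 'y::finite) pmf"
  shows "err_prob p f n phi0 phiX phiY psi
    = (\<Sum>xs\<in>lists_n UNIV n. \<Sum>ys\<in>lists_n UNIV n. (\<Prod>i<n. pmf p (xs ! i, ys ! i)) *
        of_bool (psi (phiX xs) (phiY ys (phi0 xs)) \<noteq> map (\<lambda>i. f (xs ! i) (ys ! i)) [0..<n]))"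
proof -
  have L: "{zs :: ('x \<times> 'y) list. length zs = n} = lists_n (UNIV \<times> UNIV) n" by (auto simp: lists_n_def)
  show ?thesis
    unfolding err_prob_def L sum_lists_n_Times[symmetric]
  proof (intro sum.cong refl)
    fix zs :: "('x \<times> 'y) list" assume "zs \<in> lists_n (UNIV \<times> UNIV) n"
    then have len: "length zs = n" by (simp add: lists_n_def)
    have "prod_list (map (pmf p) zs) = (\<Prod>i<n. pmf p (map fst zs ! i, map snd zs ! i))"
      using len by (simp add: prod.list_conv_set_nth atLeast0LessThan cong: prod.cong_simp)
    moreover have "map (\<lambda>(x, y). f x y) zs = map (\<lambda>i. f (map fst zs ! i) (map snd zs ! i)) [0..<n]"
      using len by (intro nth_equalityI) (auto simp: case_prod_unfold)
    ultimately show "prod_list (map (pmf p) zs) *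
         (if psi (phiX (map fst zs)) (phiY (map snd zs) (phi0 (map fst zs))) \<noteq> map (\<lambda>(x, y). f x y) zs then 1 else 0)
       = (\<Prod>i<n. pmf p (map fst zs ! i, map snd zs ! i)) *
         of_bool (psi (phiX (map fst zs)) (phiY (map snd zs) (phi0 (map fst zs))) \<noteq> map (\<lambda>i. f (map fst zs ! i) (map snd zs ! i)) [0..<n])"
      by (simp add: of_bool_def)
  qed
qed

lemma exists_slack:
  fixes G :: "real list"
  assumes "\<forall>g\<in>set G. 0 < g"
  shows "\<exists>\<delta>>0. \<forall>g\<in>set G. 8 * \<delta> \<le> g"
proof -
  define m where "m = Min (insert 1 (set G))"
  have "m > 0" unfolding m_def using assms by (subst Min_gr_iff) auto
  moreover have "m \<le> g" if "g \<in> set G" for g unfolding m_def using that by (intro Min_le) auto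
  ultimately show ?thesis by (intro exI[of _ "m / 8"]) auto
qed

context block_source
begin

text \<open>The margin 8\<delta> has two sources: at most three codebooks are each thinned 2\<delta>
  below their exponent, and \<open>quot\<close> needs another 2\<delta> to outweigh the \<delta> in
  the competitor count.\<close>

lemma achievable_rates:
  assumes d: "\<delta> > 0" and R: "0 \<le> R0" "0 \<le> RX" "0 \<le> RY"
    and gaps: "gTU + 8 * \<delta> \<le> hT + hU + R0" "gU + 8 * \<delta> \<le> hU + R0"
      "gTVW + 8 * \<delta> \<le> hT + hV + hW + RX + RY" "gVW + 8 * \<delta> \<le> hV + hW + RX + RY"
      "gV + 8 * \<delta> \<le> hV + RX" "gW + 8 * \<delta> \<le> hW + RY"
  shows "achievable p f (R0, RX, RY)"
proof -
  define e where "e n = 2 powr - (real n * \<delta>)" for n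
  \<comment> \<open>Thinning stays 2\<delta> below the exponent while heaviness is measured \<delta>
    below it, so K - 1 times the threshold is at most 2^(-n \<delta>). Rounding up keeps K positive
    even when the exponent is negative.\<close>
  define K where "K n h = nat \<lceil>2 powr (real n * (h - 2 * \<delta>))\<rceil>" for n h
  define M where "M n r = nat \<lfloor>2 powr (real n * r)\<rfloor>" for n r
  have K_ge: "2 powr (real n * (h - 2 * \<delta>)) \<le> real (K n h)" and K_pos: "K n h > 0"
    and K_le: "real (K n h) - 1 \<le> 2 powr (real n * (h - 2 * \<delta>))" for n h
  proof -
    have z: "2 powr (real n * (h - 2 * \<delta>)) > 0" by simp
    then show "2 powr (real n * (h - 2 * \<delta>)) \<le> real (K n h)" "K n h > 0" unfolding K_def by (auto simp: real_nat_ceiling_ge)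
    show "real (K n h) - 1 \<le> 2 powr (real n * (h - 2 * \<delta>))"
      unfolding K_def using z by (smt (verit) ceiling_correct of_nat_nat zero_le_ceiling)
  qed
  \<comment> \<open>A nonnegative rate makes the power at least 1, so rounding down costs at most a
    factor 2. At most two message sets occur in one denominator, hence the 4 in
    \<open>quot\<close>.\<close>
  have M_ge: "2 powr (real n * r) / 2 \<le> real (M n r)" and M_pos: "M n r > 0" if "0 \<le> r" for n r
  proof -
    have z: "2 powr (real n * r) \<ge> 1" using that by (intro ge_one_powr_ge_zero) auto
    then have "\<lfloor>2 powr (real n * r)\<rfloor> \<ge> 1" by (simp add: le_floor_iff)
    then show "2 powr (real n * r) / 2 \<le> real (M n r)" "M n r > 0"
      unfolding M_def by linarith+
  qed
  have sq: "sqrt ((real (K n h) - 1) * 2 powr - (real n * (h - \<delta>))) \<le> sqrt (e n)" for n h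
  proof -
    have "(real (K n h) - 1) * 2 powr - (real n * (h - \<delta>)) \<le> 2 powr (real n * (h - 2 * \<delta>)) * 2 powr - (real n * (h - \<delta>))"
      using K_le by (intro mult_right_mono) auto
    also have "\<dots> = e n" unfolding e_def powr_add[symmetric] by (simp add: algebra_simps)
    finally show ?thesis by simp
  qed
  have quot: "2 powr (real n * (g + \<delta>)) / D \<le> 4 * e n"
    if "2 powr (real n * b) / 4 \<le> D" "g + 2 * \<delta> \<le> b" for n :: nat and g b D
  proof -
    have "2 powr (real n * (g + \<delta>)) / D \<le> 2 powr (real n * (g + \<delta>)) / (2 powr (real n * b) / 4)"
      using that(1) by (intro divide_left_mono) (auto intro!: mult_pos_pos less_le_trans[OF _ that(1)])
    also have "\<dots> = 4 * 2 powr (real n * (g + \<delta>) - real n * b)" by (simp add: powr_diff)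
    also have "\<dots> \<le> 4 * e n"
    proof -
      have "real n * (g + 2 * \<delta>) \<le> real n * b" using that(2) by (intro mult_left_mono) auto
      then show ?thesis unfolding e_def by (simp add: algebra_simps)
    qed
    finally show ?thesis .
  qed
  have mm: "a * c \<le> A * C" if "0 \<le> a" "0 \<le> c" "a \<le> A" "c \<le> C" for a c A C :: real
    using that by (intro mult_mono) auto
  have q1: "2 powr (real n * (gTU + \<delta>)) / (real (K n hT) * real (K n hU) * real (M n R0)) \<le> 4 * e n" for n
  proof (rule quot[where b = "(hT - 2 * \<delta>) + (hU - 2 * \<delta>) + R0"])
    have "2 powr (real n * ((hT - 2 * \<delta>) + (hU - 2 * \<delta>) + R0)) / 4
       \<le> 2 powr (real n * (hT - 2 * \<delta>)) * 2 powr (real n * (hU - 2 * \<delta>)) * (2 powr (real n * R0) / 2)"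
      unfolding distrib_left powr_add by simp
    also have "\<dots> \<le> real (K n hT) * real (K n hU) * real (M n R0)"
      using R by (intro mm K_ge M_ge mult_nonneg_nonneg) auto
    finally show "2 powr (real n * ((hT - 2 * \<delta>) + (hU - 2 * \<delta>) + R0)) / 4 \<le> real (K n hT) * real (K n hU) * real (M n R0)" .
  qed (use gaps d in linarith)
  have q2: "2 powr (real n * (gU + \<delta>)) / (real (K n hU) * real (M n R0)) \<le> 4 * e n" for n
  proof (rule quot[where b = "(hU - 2 * \<delta>) + R0"])
    have "2 powr (real n * ((hU - 2 * \<delta>) + R0)) / 4
       \<le> 2 powr (real n * (hU - 2 * \<delta>)) * (2 powr (real n * R0) / 2)"
      unfolding distrib_left powr_add by simp
    also have "\<dots> \<le> real (K n hU) * real (M n R0)"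
      using R by (intro mm K_ge M_ge mult_nonneg_nonneg) auto
    finally show "2 powr (real n * ((hU - 2 * \<delta>) + R0)) / 4 \<le> real (K n hU) * real (M n R0)" .
  qed (use gaps d in linarith)
  have q3: "2 powr (real n * (gTVW + \<delta>)) / (real (K n hT) * real (K n hV) * real (K n hW) * real (M n RX) * real (M n RY)) \<le> 4 * e n" for n
  proof (rule quot[where b = "(hT - 2 * \<delta>) + (hV - 2 * \<delta>) + (hW - 2 * \<delta>) + RX + RY"])
    have "2 powr (real n * ((hT - 2 * \<delta>) + (hV - 2 * \<delta>) + (hW - 2 * \<delta>) + RX + RY)) / 4
       \<le> 2 powr (real n * (hT - 2 * \<delta>)) * 2 powr (real n * (hV - 2 * \<delta>)) * 2 powr (real n * (hW - 2 * \<delta>))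
         * (2 powr (real n * RX) / 2) * (2 powr (real n * RY) / 2)"
      unfolding distrib_left powr_add by simp
    also have "\<dots> \<le> real (K n hT) * real (K n hV) * real (K n hW) * real (M n RX) * real (M n RY)"
      using R by (intro mm K_ge M_ge mult_nonneg_nonneg) auto
    finally show "2 powr (real n * ((hT - 2 * \<delta>) + (hV - 2 * \<delta>) + (hW - 2 * \<delta>) + RX + RY)) / 4
        \<le> real (K n hT) * real (K n hV) * real (K n hW) * real (M n RX) * real (M n RY)" .
  qed (use gaps d in linarith)
  have q4: "2 powr (real n * (gVW + \<delta>)) / (real (K n hV) * real (K n hW) * real (M n RX) * real (M n RY)) \<le> 4 * e n" for n
  proof (rule quot[where b = "(hV - 2 * \<delta>) + (hW - 2 * \<delta>) + RX + RY"])
    have "2 powr (real n * ((hV - 2 * \<delta>) + (hW - 2 * \<delta>) + RX + RY)) / 4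
       \<le> 2 powr (real n * (hV - 2 * \<delta>)) * 2 powr (real n * (hW - 2 * \<delta>))
         * (2 powr (real n * RX) / 2) * (2 powr (real n * RY) / 2)"
      unfolding distrib_left powr_add by simp
    also have "\<dots> \<le> real (K n hV) * real (K n hW) * real (M n RX) * real (M n RY)"
      using R by (intro mm K_ge M_ge mult_nonneg_nonneg) auto
    finally show "2 powr (real n * ((hV - 2 * \<delta>) + (hW - 2 * \<delta>) + RX + RY)) / 4
        \<le> real (K n hV) * real (K n hW) * real (M n RX) * real (M n RY)" .
  qed (use gaps d in linarith)
  have q5: "2 powr (real n * (gV + \<delta>)) / (real (K n hV) * real (M n RX)) \<le> 4 * e n" for n
  proof (rule quot[where b = "(hV - 2 * \<delta>) + RX"])
    have "2 powr (real n * ((hV - 2 * \<delta>) + RX)) / 4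
       \<le> 2 powr (real n * (hV - 2 * \<delta>)) * (2 powr (real n * RX) / 2)"
      unfolding distrib_left powr_add by simp
    also have "\<dots> \<le> real (K n hV) * real (M n RX)"
      using R by (intro mm K_ge M_ge mult_nonneg_nonneg) auto
    finally show "2 powr (real n * ((hV - 2 * \<delta>) + RX)) / 4 \<le> real (K n hV) * real (M n RX)" .
  qed (use gaps d in linarith)
  have q6: "2 powr (real n * (gW + \<delta>)) / (real (K n hW) * real (M n RY)) \<le> 4 * e n" for n
  proof (rule quot[where b = "(hW - 2 * \<delta>) + RY"])
    have "2 powr (real n * ((hW - 2 * \<delta>) + RY)) / 4
       \<le> 2 powr (real n * (hW - 2 * \<delta>)) * (2 powr (real n * RY) / 2)"
      unfolding distrib_left powr_add by simp
    also have "\<dots> \<le> real (K n hW) * real (M n RY)"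
      using R by (intro mm K_ge M_ge mult_nonneg_nonneg) auto
    finally show "2 powr (real n * ((hW - 2 * \<delta>) + RY)) / 4 \<le> real (K n hW) * real (M n RY)" .
  qed (use gaps d in linarith)
  \<comment> \<open>Of the 14, 2 + 4 belong to the typicality tests and 2 to each of the four
    codebooks. The 24 is six kinds of competitors at \<open>4 * e n\<close> each.\<close>
  define g where "g n = 14 * (B / (real n * \<delta>\<^sup>2)) + 24 * e n + 4 * sqrt (e n)" for n
  have e_pow: "e n = (2 powr - \<delta>) ^ n" for n
    unfolding e_def by (simp add: powr_powr mult.commute flip: powr_realpow)
  have e0: "e \<longlonglongrightarrow> 0"
  proof -
    have "2 powr - \<delta> < 1" using d by (intro powr_less_one) auto
    then have "(\<lambda>n. (2 powr - \<delta>) ^ n) \<longlonglongrightarrow> 0" by (intro LIMSEQ_realpow_zero) auto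
    then show ?thesis by (simp add: e_pow[abs_def])
  qed
  have "(\<lambda>n. (B / \<delta>\<^sup>2) * inverse (real n)) \<longlonglongrightarrow> (B / \<delta>\<^sup>2) * 0"
    by (intro tendsto_intros LIMSEQ_inverse_real_of_nat[THEN LIMSEQ_imp_Suc] )
  then have b0: "(\<lambda>n. B / (real n * \<delta>\<^sup>2)) \<longlonglongrightarrow> 0" by (simp add: field_simps)
  have "g \<longlonglongrightarrow> 14 * 0 + 24 * 0 + 4 * sqrt 0"
    unfolding g_def[abs_def] by (intro tendsto_intros b0 e0)
  then have g0: "g \<longlonglongrightarrow> 0" by simp
  show ?thesis
    unfolding achievable_def prod.case
  proof (intro allI impI)
    fix \<epsilon> :: real assume "\<epsilon> > 0"
    then have "eventually (\<lambda>n. g n < \<epsilon>) sequentially" using order_tendstoD(2)[OF g0] by blast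
    then obtain N where N: "\<And>n. n \<ge> N \<Longrightarrow> g n < \<epsilon>" unfolding eventually_sequentially by blast
    show "\<exists>N. \<forall>n\<ge>N. \<exists>phi0 phiX phiY psi. is_code n R0 RX RY phi0 phiX phiY \<and> err_prob p f n phi0 phiX phiY psi \<le> \<epsilon>"
    proof (intro exI[of _ "max 1 N"] allI impI)
      fix n assume "max 1 N \<le> n"
      then have n: "n > 0" "n \<ge> N" by auto
      from block_code[OF n(1) d K_pos[of n hT] K_pos[of n hU] K_pos[of n hV] K_pos[of n hW] M_pos[OF R(1), of n] M_pos[OF R(2), of n] M_pos[OF R(3), of n]]
      obtain phi0 phiX phiY psi where c: "\<forall>xs::'x list. length xs = n \<longrightarrow> phi0 xs < M n R0 \<and> phiX xs < M n RX"
        "\<forall>ys::'y list. length ys = n \<longrightarrow> (\<forall>m::nat. phiY ys m < M n RY)"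
        and le: "(\<Sum>xs\<in>lists_n UNIV n. \<Sum>ys\<in>lists_n UNIV n. (\<Prod>i<n. pmf p (xs ! i, ys ! i)) *
            of_bool (psi (phiX xs) (phiY ys (phi0 xs)) \<noteq> map (\<lambda>i. f (xs ! i) (ys ! i)) [0..<n]))
          \<le> (2 * (B / (real n * \<delta>\<^sup>2)) + 2 powr (real n * (gTU + \<delta>)) / (real (K n hT) * real (K n hU) * real (M n R0))
              + 2 powr (real n * (gU + \<delta>)) / (real (K n hU) * real (M n R0)))
        + (4 * (B / (real n * \<delta>\<^sup>2)) + 2 powr (real n * (gTVW + \<delta>)) / (real (K n hT) * real (K n hV) * real (K n hW) * real (M n RX) * real (M n RY))
              + 2 powr (real n * (gVW + \<delta>)) / (real (K n hV) * real (K n hW) * real (M n RX) * real (M n RY))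
              + 2 powr (real n * (gV + \<delta>)) / (real (K n hV) * real (M n RX))
              + 2 powr (real n * (gW + \<delta>)) / (real (K n hW) * real (M n RY)))
        + (2 * (B / (real n * \<delta>\<^sup>2)) + sqrt ((real (K n hW) - 1) * 2 powr - (real n * (hW - \<delta>))))
        + (2 * (B / (real n * \<delta>\<^sup>2)) + sqrt ((real (K n hV) - 1) * 2 powr - (real n * (hV - \<delta>))))
        + (2 * (B / (real n * \<delta>\<^sup>2)) + sqrt ((real (K n hU) - 1) * 2 powr - (real n * (hU - \<delta>))))
        + (2 * (B / (real n * \<delta>\<^sup>2)) + sqrt ((real (K n hT) - 1) * 2 powr - (real n * (hT - \<delta>))))"
        by (elim exE conjE) blast
      note le
      also have "\<dots> \<le> (2 * (B / (real n * \<delta>\<^sup>2)) + 4 * e n + 4 * e n)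
          + (4 * (B / (real n * \<delta>\<^sup>2)) + 4 * e n + 4 * e n + 4 * e n + 4 * e n)
          + (2 * (B / (real n * \<delta>\<^sup>2)) + sqrt (e n)) + (2 * (B / (real n * \<delta>\<^sup>2)) + sqrt (e n))
          + (2 * (B / (real n * \<delta>\<^sup>2)) + sqrt (e n)) + (2 * (B / (real n * \<delta>\<^sup>2)) + sqrt (e n))"
        by (intro add_mono order_refl q1 q2 q3 q4 q5 q6 sq)
      also have "\<dots> = g n" unfolding g_def by simp
      also have "\<dots> \<le> \<epsilon>" using N[OF n(2)] by simp
      \<comment> \<open>Hash values start at 0 and messages at 1: the encoders add one, and whoever
        receives a message subtracts it.\<close>
      finally have err: "err_prob p f n (\<lambda>xs. Suc (phi0 xs)) (\<lambda>xs. Suc (phiX xs)) (\<lambda>ys m. Suc (phiY ys (m - 1)))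
          (\<lambda>i j. psi (i - 1) (j - 1)) \<le> \<epsilon>"
        unfolding err_prob_eq_sum_lists by simp
      have "is_code n R0 RX RY (\<lambda>xs. Suc (phi0 xs)) (\<lambda>xs. Suc (phiX xs)) (\<lambda>ys m. Suc (phiY ys (m - 1)))"
        using c unfolding is_code_def msgs_def M_def by (auto simp: Suc_le_eq)
      with err show "\<exists>phi0 phiX phiY psi. is_code n R0 RX RY phi0 phiX phiY \<and> err_prob p f n phi0 phiX phiY psi \<le> \<epsilon>" by blast
    qed
  qed
qed

end

section \<open>Achievability for every admissible choice of auxiliaries\<close>

lemma achievable_aux_region:
  fixes p :: "('x::finite \<times> 'y::finite) pmf" and f :: "'x \<Rightarrow> 'y \<Rightarrow> 'f"
  assumes adm: "admissible p f Q sV sW" and R: "(R0, RX, RY) \<in> aux_region Q"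
  shows "achievable p f (R0, RX, RY)"
proof -
  note ad = admissibleD[OF adm]
  note fin = ad(1)
  define AT where "AT = rT ` set_pmf Q"
  define AU where "AU = rU ` set_pmf Q"
  define AV where "AV = rV ` set_pmf Q"
  define AW where "AW = rW ` set_pmf Q"
  note A_defs = AT_def AU_def AV_def AW_def
  have finA: "finite AT" "finite AU" "finite AV" "finite AW" using fin by (auto simp: A_defs)
  define \<Omega> where "\<Omega> = (UNIV :: 'x set) \<times> (UNIV :: 'y set) \<times> AT \<times> AU \<times> AV \<times> AW"
  have fin\<Omega>: "finite \<Omega>" unfolding \<Omega>_def using finA by auto
  have sub\<Omega>: "set_pmf Q \<subseteq> \<Omega>"
  proof
    fix \<omega> assume "\<omega> \<in> set_pmf Q"
    then have "(rX \<omega>, rY \<omega>, rT \<omega>, rU \<omega>, rV \<omega>, rW \<omega>) \<in> \<Omega>" by (simp add: \<Omega>_def A_defs)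
    then show "\<omega> \<in> \<Omega>" by (simp add: jnt_eta)
  qed
  note ker = typical_kernel_exists[OF fin\<Omega> sub\<Omega>]
  have imT: "rT ` set_pmf Q \<subseteq> AT" "rU ` set_pmf Q \<subseteq> AU" "rV ` set_pmf Q \<subseteq> AV" "rW ` set_pmf Q \<subseteq> AW"
    "(rT && rU) ` set_pmf Q \<subseteq> AT \<times> AU" "(rT && rV && rW) ` set_pmf Q \<subseteq> AT \<times> AV \<times> AW"
    "(rV && rW) ` set_pmf Q \<subseteq> AV \<times> AW"
    by (auto simp: A_defs)
  have finP: "finite (AT \<times> AU)" "finite (AT \<times> AV \<times> AW)" "finite (AV \<times> AW)" using finA by auto
  obtain kT B1 where 1: "\<And>c a. 0 \<le> kT c a" "\<And>c. (\<Sum>a\<in>AT. kT c a) = 1"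
    "\<And>c a. pmf (map_pmf (rX && rT) Q) (c, a) = pmf (map_pmf rX Q) c * kT c a"
    "dev_bound Q \<Omega> (\<lambda>\<omega>. kT (rX \<omega>) (rT \<omega>)) (ent Q (rX && rT) - ent Q rX) B1"
    using ker[OF finA(1) imT(1), of rX] by (elim exE conjE) blast
  obtain kU B2 where 2: "\<And>c a. 0 \<le> kU c a" "\<And>c. (\<Sum>a\<in>AU. kU c a) = 1"
    "\<And>c a. pmf (map_pmf ((rX && rT) && rU) Q) (c, a) = pmf (map_pmf (rX && rT) Q) c * kU c a"
    "dev_bound Q \<Omega> (\<lambda>\<omega>. kU (rX \<omega>, rT \<omega>) (rU \<omega>)) (ent Q ((rX && rT) && rU) - ent Q (rX && rT)) B2"
    using ker[OF finA(2) imT(2), of "rX && rT"] by (elim exE conjE) blast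
  obtain kV B3 where 3: "\<And>c a. 0 \<le> kV c a" "\<And>c. (\<Sum>a\<in>AV. kV c a) = 1"
    "\<And>c a. pmf (map_pmf ((rX && rT) && rV) Q) (c, a) = pmf (map_pmf (rX && rT) Q) c * kV c a"
    "dev_bound Q \<Omega> (\<lambda>\<omega>. kV (rX \<omega>, rT \<omega>) (rV \<omega>)) (ent Q ((rX && rT) && rV) - ent Q (rX && rT)) B3"
    using ker[OF finA(3) imT(3), of "rX && rT"] by (elim exE conjE) blast
  obtain kW B4 where 4: "\<And>c a. 0 \<le> kW c a" "\<And>c. (\<Sum>a\<in>AW. kW c a) = 1"
    "\<And>c a. pmf (map_pmf ((rT && rU && rY) && rW) Q) (c, a) = pmf (map_pmf (rT && rU && rY) Q) c * kW c a"
    "dev_bound Q \<Omega> (\<lambda>\<omega>. kW (rT \<omega>, rU \<omega>, rY \<omega>) (rW \<omega>)) (ent Q ((rT && rU && rY) && rW) - ent Q (rT && rU && rY)) B4"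
    using ker[OF finA(4) imT(4), of "rT && rU && rY"] by (elim exE conjE) blast
  obtain jTU B5 where 5: "\<And>c a. 0 \<le> jTU c a" "\<And>c. (\<Sum>a\<in>AT \<times> AU. jTU c a) = 1"
    "dev_bound Q \<Omega> (\<lambda>\<omega>. jTU (rY \<omega>) (rT \<omega>, rU \<omega>)) (ent Q (rY && rT && rU) - ent Q rY) B5"
    using ker[OF finP(1) imT(5), of rY] by (elim exE conjE) blast
  obtain jU B6 where 6: "\<And>c a. 0 \<le> jU c a" "\<And>c. (\<Sum>a\<in>AU. jU c a) = 1"
    "dev_bound Q \<Omega> (\<lambda>\<omega>. jU (rT \<omega>, rY \<omega>) (rU \<omega>)) (ent Q ((rT && rY) && rU) - ent Q (rT && rY)) B6"
    using ker[OF finA(2) imT(2), of "rT && rY"] by (elim exE conjE) blast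
  obtain jTVW B7 where 7: "\<And>c a. 0 \<le> jTVW c a" "\<And>c. (\<Sum>a\<in>AT \<times> AV \<times> AW. jTVW c a) = 1"
    "dev_bound Q \<Omega> (\<lambda>\<omega>. jTVW () (rT \<omega>, rV \<omega>, rW \<omega>)) (ent Q (\<lambda>\<omega>. ((), rT \<omega>, rV \<omega>, rW \<omega>)) - ent Q (\<lambda>_. ())) B7"
    using ker[OF finP(2) imT(6), of "\<lambda>_. ()"] by (elim exE conjE) blast
  obtain jVW B8 where 8: "\<And>c a. 0 \<le> jVW c a" "\<And>c. (\<Sum>a\<in>AV \<times> AW. jVW c a) = 1"
    "dev_bound Q \<Omega> (\<lambda>\<omega>. jVW (rT \<omega>) (rV \<omega>, rW \<omega>)) (ent Q (rT && rV && rW) - ent Q rT) B8"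
    using ker[OF finP(3) imT(7), of rT] by (elim exE conjE) blast
  obtain jV B9 where 9: "\<And>c a. 0 \<le> jV c a" "\<And>c. (\<Sum>a\<in>AV. jV c a) = 1"
    "dev_bound Q \<Omega> (\<lambda>\<omega>. jV (rT \<omega>, rW \<omega>) (rV \<omega>)) (ent Q ((rT && rW) && rV) - ent Q (rT && rW)) B9"
    using ker[OF finA(3) imT(3), of "rT && rW"] by (elim exE conjE) blast
  obtain jW B10 where 10: "\<And>c a. 0 \<le> jW c a" "\<And>c. (\<Sum>a\<in>AW. jW c a) = 1"
    "dev_bound Q \<Omega> (\<lambda>\<omega>. jW (rT \<omega>, rV \<omega>) (rW \<omega>)) (ent Q ((rT && rV) && rW) - ent Q (rT && rV)) B10"
    using ker[OF finA(4) imT(4), of "rT && rV"] by (elim exE conjE) blast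
  define B where "B = Max {B1, B2, B3, B4, B5, B6, B7, B8, B9, B10}"
  have leB: "B1 \<le> B" "B2 \<le> B" "B3 \<le> B" "B4 \<le> B" "B5 \<le> B" "B6 \<le> B" "B7 \<le> B" "B8 \<le> B" "B9 \<le> B" "B10 \<le> B"
    unfolding B_def by (rule Max_ge; simp)+
  \<comment> \<open>The choice is unambiguous: by \<open>function_determined\<close> all outcomes in
    the support with the same (t, v, w) give the same value of f.\<close>
  define fh where "fh t v w = (SOME z. \<exists>\<omega>\<in>set_pmf Q. rT \<omega> = t \<and> rV \<omega> = v \<and> rW \<omega> = w \<and> z = f (rX \<omega>) (rY \<omega>))" for t v w
  have fh: "fh t v w = f x y" if "pmf Q (x, y, t, u, v, w) \<noteq> 0" for x y t u v w
  proof -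
    let ?\<omega> = "(x, y, t, u, v, w)"
    have w: "?\<omega> \<in> set_pmf Q" using that by (simp add: set_pmf_iff)
    have r: "rX ?\<omega> = x" "rY ?\<omega> = y" "rT ?\<omega> = t" "rV ?\<omega> = v" "rW ?\<omega> = w"
      by (simp_all add: rX_def rY_def rT_def rV_def rW_def)
    show ?thesis unfolding fh_def
    proof (rule some_equality)
      show "\<exists>\<omega>\<in>set_pmf Q. rT \<omega> = t \<and> rV \<omega> = v \<and> rW \<omega> = w \<and> f x y = f (rX \<omega>) (rY \<omega>)"
        using w r by (intro bexI[of _ ?\<omega>]) auto
      fix z assume "\<exists>\<omega>\<in>set_pmf Q. rT \<omega> = t \<and> rV \<omega> = v \<and> rW \<omega> = w \<and> z = f (rX \<omega>) (rY \<omega>)"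
      then obtain \<omega> where o: "\<omega> \<in> set_pmf Q" "rT \<omega> = t" "rV \<omega> = v" "rW \<omega> = w" "z = f (rX \<omega>) (rY \<omega>)" by blast
      then show "z = f x y" using function_determined[OF adm o(1) w] r by simp
    qed
  qed
  interpret block_source p f Q AT AU AV AW fh kT kU kV kW jTU jU jTVW jVW jV jW
    "ent Q (rX && rT) - ent Q rX"
    "ent Q ((rX && rT) && rU) - ent Q (rX && rT)"
    "ent Q ((rX && rT) && rV) - ent Q (rX && rT)"
    "ent Q ((rT && rU && rY) && rW) - ent Q (rT && rU && rY)"
    "ent Q (rY && rT && rU) - ent Q rY"
    "ent Q ((rT && rY) && rU) - ent Q (rT && rY)"
    "ent Q (\<lambda>\<omega>. ((), rT \<omega>, rV \<omega>, rW \<omega>)) - ent Q (\<lambda>_. ())"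
    "ent Q (rT && rV && rW) - ent Q rT"
    "ent Q ((rT && rW) && rV) - ent Q (rT && rW)"
    "ent Q ((rT && rV) && rW) - ent Q (rT && rV)"
    B \<Omega>
  proof (unfold_locales, goal_cases)
    \<comment> \<open>Goals 26 and 27 are the factorisation of \<open>Q\<close> and the recovery of
      f; the others are properties of the alphabets and the ten kernels.\<close>
    case 26 show ?case by (rule admissible_factorization[OF adm 1(3) 2(3) 3(3) 4(3)])
  next
    case (27 x y t u v w) then show ?case by (rule fh)
  qed (use finA \<Omega>_def 1 2 3 4 5 6 7 8 9 10 leB in \<open>auto intro: dev_bound_mono\<close>)
  note rc = rate_conditions[OF adm R]
  let ?hT = "ent Q (rX && rT) - ent Q rX"
  let ?hU = "ent Q ((rX && rT) && rU) - ent Q (rX && rT)"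
  let ?hV = "ent Q ((rX && rT) && rV) - ent Q (rX && rT)"
  let ?hW = "ent Q ((rT && rU && rY) && rW) - ent Q (rT && rU && rY)"
  \<comment> \<open>The slacks of the six strict inequalities; a common \<delta> is taken from their
    minimum.\<close>
  define G where "G = [?hT + ?hU + R0 - (ent Q (rY && rT && rU) - ent Q rY),
      ?hU + R0 - (ent Q ((rT && rY) && rU) - ent Q (rT && rY)),
      ?hT + ?hV + ?hW + RX + RY - (ent Q (\<lambda>\<omega>. ((), rT \<omega>, rV \<omega>, rW \<omega>)) - ent Q (\<lambda>_. ())),
      ?hV + ?hW + RX + RY - (ent Q (rT && rV && rW) - ent Q rT),
      ?hV + RX - (ent Q ((rT && rW) && rV) - ent Q (rT && rW)),
      ?hW + RY - (ent Q ((rT && rV) && rW) - ent Q (rT && rV))]"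
  have "\<forall>g\<in>set G. 0 < g" using rc(1-6) by (simp add: G_def)
  from exists_slack[OF this] obtain \<delta> where d: "\<delta> > 0" and gaps: "\<forall>g\<in>set G. 8 * \<delta> \<le> g" by blast
  show ?thesis
    by (rule achievable_rates[OF d rc(7-9)]) (use gaps in \<open>simp_all add: G_def algebra_simps\<close>)
qed

text \<open>For the equality of the unions it is enough that each region is contained in one with
  bounded alphabets; individual regions need not be preserved.\<close>

theorem theorem1:
  fixes p :: "('x::finite \<times> 'y::finite) pmf" and f :: "'x \<Rightarrow> 'y \<Rightarrow> 'f::finite"
  shows "(\<forall>Q sV sW. admissible p f Q sV sW \<longrightarrow>
            (\<forall>R \<in> aux_region Q. achievable p f R))
       \<and> (\<Union>{aux_region Q | Q sV sW. admissible p f Q sV sW}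
          = \<Union>{aux_region Q | Q sV sW. admissible p f Q sV sW
                 \<and> card (rT ` set_pmf Q) \<le> CARD('x) + 4
                 \<and> card (rV ` set_pmf Q) \<le> (CARD('x) + 4) * CARD('x) + 1
                 \<and> card (rW ` set_pmf Q) \<le> card (rU ` set_pmf Q) * CARD('y) + 1})"
proof (intro conjI allI impI ballI)
  fix Q sV sW R assume "admissible p f Q sV sW" "R \<in> aux_region Q"
  then show "achievable p f R" by (cases R) (auto intro: achievable_aux_region)
next
  show "\<Union>{aux_region Q | Q sV sW. admissible p f Q sV sW}
      = \<Union>{aux_region Q | Q sV sW. admissible p f Q sV sW
             \<and> card (rT ` set_pmf Q) \<le> CARD('x) + 4
             \<and> card (rV ` set_pmf Q) \<le> (CARD('x) + 4) * CARD('x) + 1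
             \<and> card (rW ` set_pmf Q) \<le> card (rU ` set_pmf Q) * CARD('y) + 1}" (is "?L = ?R")
  proof
    show "?L \<subseteq> ?R"
    proof
      fix r assume "r \<in> ?L"
      then obtain Q sV sW where Q: "admissible p f Q sV sW" "r \<in> aux_region Q" by blast
      from bounded_auxiliaries[OF Q(1)] obtain Q' sV' sW' where Q': "admissible p f Q' sV' sW'"
        "aux_region Q \<subseteq> aux_region Q'" "card (rT ` set_pmf Q') \<le> CARD('x) + 4"
        "card (rV ` set_pmf Q') \<le> (CARD('x) + 4) * CARD('x) + 1"
        "card (rW ` set_pmf Q') \<le> card (rU ` set_pmf Q') * CARD('y) + 1" by blast
      have "r \<in> aux_region Q'" using Q(2) Q'(2) by blast
      then show "r \<in> ?R" using Q'(1,3-5) by blast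
    qed
    show "?R \<subseteq> ?L" by blast
  qed
qed

end
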